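(* Suppose the regularity assumption holds with constant $L>0$, and let $\widehat L\ge L$. Consider the short-step RFW method with step size $$\eta_k^{\rm fb}:=\min\left\{1,\frac{g_k}{\widehat L\ell_k^2}\right\}.$$ Then every nonterminal update is feasible ($x_{k+1}\in\mathcal X$) and satisfies $$h_{k+1}\le h_k-\min\left\{\frac{h_k}{2},\frac{h_k^2}{2\widehat LD^2}\right\}.$$ So the algorithm either terminates at an optimizer or $h_k\to0$. If, in addition, the local Hölderian error bound holds with constants $c>0$, $\theta\in(0,1/2]$, $R_H>0$ and the $(\sigma,R_S)$ length-normalized directional scaling condition holds with $\sigma,R_S>0$, set $C_{\rm fb}:=\sigma^2/(2\widehat Lc^2)$. Then there is a finite index $S_{\rm fb}$ such that, for every $k\ge S_{\rm fb}$, $$h_{k+1}\le h_k-\min\left\{\frac{h_k}{2},C_{\rm fb}h_k^{2(1-\theta)}\right\}.$$ Moreover, $$h_k=O\left(k^{-1/(1-2\theta)}\right)\ \text{ if }0<\theta<\tfrac12,\qquad h_k=O\left((1-\min\{1/2,C_{\rm fb}\})^k\right)\ \text{ if }\theta=\tfrac12.$$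
   Context: Setting. $\mathcal M$ is a connected, complete, finite-dimensional Riemannian manifold with distance $d$, tangent spaces $T_x\mathcal M$, inner products $\langle\cdot,\cdot\rangle_x$, norms $\|\cdot\|_x$ and exponential map $\operatorname{Exp}_x$. The set $\mathcal X\subset\mathcal M$ is nonempty and compact, with diameter $D:=\sup_{x,y\in\mathcal X}d(x,y)>0$, and is weakly minimizing-geodesically convex: for all $x,y\in\mathcal X$ there is at least one distance-minimizing geodesic from $x$ to $y$ whose image is contained in $\mathcal X$. For $x\in\mathcal X$ the set of feasible minimizing initial velocities is $$\mathcal V(x):=\{v\in T_x\mathcal M:\ \operatorname{Exp}_x(v)\in\mathcal X,\ \|v\|_x=d(x,\operatorname{Exp}_x(v)),\ \operatorname{Exp}_x(tv)\in\mathcal X\ \text{for all }t\in[0,1]\}.$$ The function $f$ is real-valued and differentiable on an open neighborhood of $\mathcal X$, with Riemannian gradient $\operatorname{grad}f$. Put $f^\star:=\min_{\mathcal X}f$, $\mathcal X^\star:=\arg\min_{\mathcal X}f$ (its elements are called optimizers), $h(x):=f(x)-f^\star$, and $r(x):=d(x,\mathcal X^\star)=\min_{y\in\mathcal X^\star}d(x,y)$. Regularity assumption (constant $L>0$): for all $x\in\mathcal X$, $v\in\mathcal V(x)$, $t\in[0,1]$, $f(\operatorname{Exp}_x(tv))\le(1-t)f(x)+tf(\operatorname{Exp}_x(v))$ and $f(\operatorname{Exp}_x(tv))\le f(x)+t\langle\operatorname{grad}f(x),v\rangle_x+\frac L2t^2\|v\|_x^2$. Oracle. $\mathcal S(x):=\arg\min_{v\in\mathcal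 V(x)}\langle\operatorname{grad}f(x),v\rangle_x$ (nonempty and compact), $\bar\ell(x):=\max_{v\in\mathcal S(x)}\|v\|_x$, $g(x):=-\min_{v\in\mathcal V(x)}\langle\operatorname{grad}f(x),v\rangle_x$. Local Hölderian error bound ($c,\theta,R_H$): $r(x)\le c\,h(x)^\theta$ for all $x\in\mathcal X$ with $r(x)\le R_H$. $(\sigma,R_S)$ length-normalized directional scaling: for every $x\in\mathcal X\setminus\mathcal X^\star$ with $r(x)\le R_S$, $\ g(x)/\bar\ell(x)\ge\sigma\,h(x)/r(x)$. Short-step RFW method. Start from an arbitrary $x_0\in\mathcal X$. For $k=0,1,2,\dots$: choose any $v_k\in\mathcal S(x_k)$, set $g_k:=-\langle\operatorname{grad}f(x_k),v_k\rangle_{x_k}$ and $\ell_k:=\|v_k\|_{x_k}$; if $g_k=0$, terminate and return $x_k$; otherwise (a nonterminal iteration) set $x_{k+1}:=\operatorname{Exp}_{x_k}(\eta_k^{\rm fb}v_k)$. Write $h_k:=h(x_k)$. Asymptotic statements refer to the case where the algorithm does not terminate, and inequalities indexed by $k$ refer to nonterminal iterations. *)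

theory Defs
  imports
    "HOL-Analysis.Analysis"
    "HOL-Library.Landau_Symbols"
    "HOL-Library.Extended_Nat"
begin

section \<open>Smooth manifolds\<close>

fun Ck_on :: "nat \<Rightarrow> 'a::real_normed_vector set \<Rightarrow> ('a \<Rightarrow> 'b::real_normed_vector) \<Rightarrow> bool" where
  "Ck_on 0 S f \<longleftrightarrow> continuous_on S f"
| "Ck_on (Suc k) S f \<longleftrightarrow>
     (\<forall>p\<in>S. f differentiable (at p)) \<and>
     (\<forall>a. Ck_on k S (\<lambda>p. frechet_derivative f (at p) a))"

definition smooth_on :: "'a::real_normed_vector set \<Rightarrow> ('a \<Rightarrow> 'b::real_normed_vector) \<Rightarrow> bool" where
  "smooth_on S f \<longleftrightarrow> (\<forall>k. Ck_on k S f)"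

text \<open>A chart is a pair of its domain and its coordinate map; the values of the coordinate map
  outside the domain are irrelevant. The points of the manifold are all elements of the type
  \<open>'m\<close>, the model space \<open>'e\<close> is Euclidean.\<close>

type_synonym ('m, 'e) chart = "'m set \<times> ('m \<Rightarrow> 'e)"

abbreviation chart_dom :: "('m, 'e) chart \<Rightarrow> 'm set" where
  "chart_dom c \<equiv> fst c"

abbreviation chart_map :: "('m, 'e) chart \<Rightarrow> 'm \<Rightarrow> 'e" where
  "chart_map c \<equiv> snd c"

definition chart_inv :: "('m, 'e) chart \<Rightarrow> 'e \<Rightarrow> 'm" where
  "chart_inv c = inv_into (chart_dom c) (chart_map c)"

definition chart_img :: "('m, 'e) chart \<Rightarrow> 'e set" where
  "chart_img c = chart_map c ` chart_dom c"

definition transition :: "('m, 'e) chart \<Rightarrow> ('m, 'e) chart \<Rightarrow> 'e \<Rightarrow> 'e" where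
  "transition c c' = chart_map c' \<circ> chart_inv c"

text \<open>A tangent vector is the family of its coordinate representations, indexed by the charts
  around its base point, and extended by 0 to all other pairs so that equality of tangent vectors
  is equality of functions. Vector space operations are pointwise.\<close>

type_synonym ('m, 'e) tangent = "('m, 'e) chart \<Rightarrow> 'e"

record ('m, 'e) riem =
  charts :: "('m, 'e) chart set"
  metric :: "'m \<Rightarrow> ('m, 'e) tangent \<Rightarrow> ('m, 'e) tangent \<Rightarrow> real"

definition smooth_atlas :: "('m::topological_space, 'e::euclidean_space) chart set \<Rightarrow> bool" where
  "smooth_atlas A \<longleftrightarrow>
     (\<Union>c\<in>A. chart_dom c) = UNIV \<and>
     (\<forall>c\<in>A. open (chart_dom c) \<and> open (chart_img c) \<and>
        homeomorphism (chart_dom c) (chart_img c) (chart_map c) (chart_inv c)) \<and>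
     (\<forall>c\<in>A. \<forall>c'\<in>A.
        smooth_on (chart_map c ` (chart_dom c \<inter> chart_dom c')) (transition c c'))"

definition charts_at :: "('m, 'e) riem \<Rightarrow> 'm \<Rightarrow> ('m, 'e) chart set" where
  "charts_at M x = {c \<in> charts M. x \<in> chart_dom c}"

definition tangent_space ::
    "('m, 'e::euclidean_space) riem \<Rightarrow> 'm \<Rightarrow> ('m, 'e) tangent set" where
  "tangent_space M x = {v.
     (\<forall>c. c \<notin> charts_at M x \<longrightarrow> v c = 0) \<and>
     (\<forall>c\<in>charts_at M x. \<forall>c'\<in>charts_at M x.
        v c' = frechet_derivative (transition c c') (at (chart_map c x)) (v c))}"

definition tscale :: "real \<Rightarrow> ('m, 'e::real_vector) tangent \<Rightarrow> ('m, 'e) tangent" where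
  "tscale t v = (\<lambda>c. t *\<^sub>R v c)"

definition tadd :: "('m, 'e::real_vector) tangent \<Rightarrow> ('m, 'e) tangent \<Rightarrow> ('m, 'e) tangent" where
  "tadd u v = (\<lambda>c. u c + v c)"

text \<open>The tangent vector at \<open>x\<close> whose representation in the chart \<open>c\<close> is \<open>a\<close>.\<close>

definition tvec ::
    "('m, 'e::euclidean_space) riem \<Rightarrow> ('m, 'e) chart \<Rightarrow> 'm \<Rightarrow> 'e \<Rightarrow> ('m, 'e) tangent" where
  "tvec M c x a = (\<lambda>c'. if c' \<in> charts_at M x
     then frechet_derivative (transition c c') (at (chart_map c x)) a else 0)"


section \<open>Riemannian manifolds\<close>

definition inner_product_on_tangent ::
    "('m, 'e::euclidean_space) riem \<Rightarrow> 'm \<Rightarrow> bool" where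
  "inner_product_on_tangent M x \<longleftrightarrow>
     (\<forall>u\<in>tangent_space M x. \<forall>v\<in>tangent_space M x. metric M x u v = metric M x v u) \<and>
     (\<forall>u\<in>tangent_space M x. \<forall>v\<in>tangent_space M x. \<forall>w\<in>tangent_space M x.
        metric M x (tadd u v) w = metric M x u w + metric M x v w) \<and>
     (\<forall>t. \<forall>u\<in>tangent_space M x. \<forall>v\<in>tangent_space M x.
        metric M x (tscale t u) v = t * metric M x u v) \<and>
     (\<forall>v\<in>tangent_space M x. v \<noteq> (\<lambda>_. 0) \<longrightarrow> metric M x v v > 0)"

text \<open>The metric in the coordinates \<open>p\<close> of the chart \<open>c\<close>, as a bilinear form on \<open>'e\<close>.\<close>

definition metric_coord ::
    "('m, 'e::euclidean_space) riem \<Rightarrow> ('m, 'e) chart \<Rightarrow> 'e \<Rightarrow> 'e \<Rightarrow> 'e \<Rightarrow> real" where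
  "metric_coord M c p a b =
     metric M (chart_inv c p) (tvec M c (chart_inv c p) a) (tvec M c (chart_inv c p) b)"

definition riemannian_manifold ::
    "('m::{t2_space, second_countable_topology}, 'e::euclidean_space) riem \<Rightarrow> bool" where
  "riemannian_manifold M \<longleftrightarrow>
     smooth_atlas (charts M) \<and>
     (\<forall>x. inner_product_on_tangent M x) \<and>
     (\<forall>c\<in>charts M. \<forall>a b. smooth_on (chart_img c) (\<lambda>p. metric_coord M c p a b))"

definition tnorm :: "('m, 'e) riem \<Rightarrow> 'm \<Rightarrow> ('m, 'e) tangent \<Rightarrow> real" where
  "tnorm M x v = sqrt (metric M x v v)"


subsection \<open>Curves, length and distance\<close>

text \<open>Curves are considered on a nondegenerate interval \<open>I\<close>, with one-sided derivatives at
  end points of \<open>I\<close> that belong to \<open>I\<close>.\<close>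

definition velocity ::
    "('m, 'e::euclidean_space) riem \<Rightarrow> real set \<Rightarrow> (real \<Rightarrow> 'm) \<Rightarrow> real \<Rightarrow> ('m, 'e) tangent" where
  "velocity M I \<gamma> t = (\<lambda>c. if c \<in> charts_at M (\<gamma> t)
     then vector_derivative (chart_map c \<circ> \<gamma>) (at t within I) else 0)"

definition C1_curve ::
    "('m::topological_space, 'e::euclidean_space) riem \<Rightarrow> real set \<Rightarrow> (real \<Rightarrow> 'm) \<Rightarrow> bool" where
  "C1_curve M I \<gamma> \<longleftrightarrow>
     continuous_on I \<gamma> \<and>
     (\<forall>c\<in>charts M.
        (\<forall>t\<in>I. \<gamma> t \<in> chart_dom c \<longrightarrow> (chart_map c \<circ> \<gamma>) differentiable (at t within I)) \<and>
        continuous_on {t\<in>I. \<gamma> t \<in> chart_dom c}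
          (\<lambda>t. vector_derivative (chart_map c \<circ> \<gamma>) (at t within I)))"

text \<open>\<open>S\<close> contains the break points: the curve is \<open>C\<^sup>1\<close>, up to the end points, on every
  closed subinterval without break points in its interior.\<close>

definition piecewise_C1_curve ::
    "('m::topological_space, 'e::euclidean_space) riem \<Rightarrow> (real \<Rightarrow> 'm) \<Rightarrow> bool" where
  "piecewise_C1_curve M \<gamma> \<longleftrightarrow>
     (\<exists>S. finite S \<and>
        (\<forall>a b. 0 \<le> a \<and> a < b \<and> b \<le> 1 \<and> S \<inter> {a<..<b} = {} \<longrightarrow> C1_curve M {a..b} \<gamma>))"

definition curve_length ::
    "('m, 'e::euclidean_space) riem \<Rightarrow> (real \<Rightarrow> 'm) \<Rightarrow> real" where
  "curve_length M \<gamma> = integral {0..1} (\<lambda>t. tnorm M (\<gamma> t) (velocity M {0..1} \<gamma> t))"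

definition rdist ::
    "('m::topological_space, 'e::euclidean_space) riem \<Rightarrow> 'm \<Rightarrow> 'm \<Rightarrow> real" where
  "rdist M x y =
     Inf {curve_length M \<gamma> | \<gamma>. piecewise_C1_curve M \<gamma> \<and> \<gamma> 0 = x \<and> \<gamma> 1 = y}"


subsection \<open>Geodesics and the exponential map\<close>

text \<open>The Christoffel symbols (of the second kind) of the Levi-Civita connection in a chart,
  contracted with two coordinate vectors:
  \<open>g(\<Gamma>(a,b), w) = (\<partial>\<^sub>a g(b,w) + \<partial>\<^sub>b g(a,w) - \<partial>\<^sub>w g(a,b)) / 2\<close> for all \<open>w\<close>.\<close>

definition christoffel ::
    "('m, 'e::euclidean_space) riem \<Rightarrow> ('m, 'e) chart \<Rightarrow> 'e \<Rightarrow> 'e \<Rightarrow> 'e \<Rightarrow> 'e" where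
  "christoffel M c p a b = (THE e. \<forall>w. metric_coord M c p e w =
     (frechet_derivative (\<lambda>q. metric_coord M c q b w) (at p) a +
      frechet_derivative (\<lambda>q. metric_coord M c q a w) (at p) b -
      frechet_derivative (\<lambda>q. metric_coord M c q a b) (at p) w) / 2)"

definition geodesic ::
    "('m::topological_space, 'e::euclidean_space) riem \<Rightarrow> real set \<Rightarrow> (real \<Rightarrow> 'm) \<Rightarrow> bool" where
  "geodesic M I \<gamma> \<longleftrightarrow>
     continuous_on I \<gamma> \<and>
     (\<forall>c\<in>charts M. \<forall>t\<in>I. \<gamma> t \<in> chart_dom c \<longrightarrow>
        (let y = chart_map c \<circ> \<gamma>; y' = (\<lambda>s. vector_derivative y (at s within I)) in
           y differentiable (at t within I) \<and>
           (y' has_vector_derivative - christoffel M c (y t) (y' t) (y' t)) (at t within I)))"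

text \<open>Geodesic completeness, which for connected manifolds is equivalent to completeness of the
  metric space (Hopf--Rinow).\<close>

definition complete_manifold ::
    "('m::topological_space, 'e::euclidean_space) riem \<Rightarrow> bool" where
  "complete_manifold M \<longleftrightarrow>
     (\<forall>x. \<forall>v\<in>tangent_space M x.
        \<exists>\<gamma>. geodesic M UNIV \<gamma> \<and> \<gamma> 0 = x \<and> velocity M UNIV \<gamma> 0 = v)"

text \<open>Well defined because a geodesic is determined by its initial velocity.\<close>

definition rexp ::
    "('m::topological_space, 'e::euclidean_space) riem \<Rightarrow> 'm \<Rightarrow> ('m, 'e) tangent \<Rightarrow> 'm" where
  "rexp M x v =
     (THE y. \<exists>\<gamma>. geodesic M {0..1} \<gamma> \<and> \<gamma> 0 = x \<and> velocity M {0..1} \<gamma> 0 = v \<and> \<gamma> 1 = y)"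

definition minimizing_geodesic ::
    "('m::topological_space, 'e::euclidean_space) riem \<Rightarrow> 'm \<Rightarrow> 'm \<Rightarrow> (real \<Rightarrow> 'm) \<Rightarrow> bool" where
  "minimizing_geodesic M x y \<gamma> \<longleftrightarrow>
     geodesic M {0..1} \<gamma> \<and> \<gamma> 0 = x \<and> \<gamma> 1 = y \<and> curve_length M \<gamma> = rdist M x y"


subsection \<open>Differentiable functions and gradients\<close>

definition differentiable_fun_on ::
    "('m, 'e::euclidean_space) riem \<Rightarrow> 'm set \<Rightarrow> ('m \<Rightarrow> real) \<Rightarrow> bool" where
  "differentiable_fun_on M W f \<longleftrightarrow>
     (\<forall>x\<in>W. \<forall>c\<in>charts_at M x. (f \<circ> chart_inv c) differentiable (at (chart_map c x)))"

definition rgrad ::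
    "('m, 'e::euclidean_space) riem \<Rightarrow> ('m \<Rightarrow> real) \<Rightarrow> 'm \<Rightarrow> ('m, 'e) tangent" where
  "rgrad M f x = (THE w. w \<in> tangent_space M x \<and>
     (\<forall>v\<in>tangent_space M x. \<forall>c\<in>charts_at M x.
        metric M x w v = frechet_derivative (f \<circ> chart_inv c) (at (chart_map c x)) (v c)))"


section \<open>The optimization problem\<close>

definition weakly_minimizing_convex ::
    "('m::topological_space, 'e::euclidean_space) riem \<Rightarrow> 'm set \<Rightarrow> bool" where
  "weakly_minimizing_convex M X \<longleftrightarrow>
     (\<forall>x\<in>X. \<forall>y\<in>X. \<exists>\<gamma>. minimizing_geodesic M x y \<gamma> \<and> \<gamma> ` {0..1} \<subseteq> X)"

definition rdiam ::
    "('m::topological_space, 'e::euclidean_space) riem \<Rightarrow> 'm set \<Rightarrow> real" where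
  "rdiam M X = Sup {rdist M x y | x y. x \<in> X \<and> y \<in> X}"

definition feasible_dirs ::
    "('m::topological_space, 'e::euclidean_space) riem \<Rightarrow> 'm set \<Rightarrow> 'm \<Rightarrow> ('m, 'e) tangent set" where
  "feasible_dirs M X x = {v \<in> tangent_space M x.
     rexp M x v \<in> X \<and>
     tnorm M x v = rdist M x (rexp M x v) \<and>
     (\<forall>t\<in>{0..1}. rexp M x (tscale t v) \<in> X)}"

definition min_value :: "('m \<Rightarrow> real) \<Rightarrow> 'm set \<Rightarrow> real" where
  "min_value f X = (INF x\<in>X. f x)"

definition optimizers :: "('m \<Rightarrow> real) \<Rightarrow> 'm set \<Rightarrow> 'm set" where
  "optimizers f X = {x. is_arg_min f (\<lambda>y. y \<in> X) x}"

definition gap :: "('m \<Rightarrow> real) \<Rightarrow> 'm set \<Rightarrow> 'm \<Rightarrow> real" where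
  "gap f X x = f x - min_value f X"

definition dist_opt ::
    "('m::topological_space, 'e::euclidean_space) riem \<Rightarrow> ('m \<Rightarrow> real) \<Rightarrow> 'm set \<Rightarrow> 'm \<Rightarrow> real" where
  "dist_opt M f X x = (INF y\<in>optimizers f X. rdist M x y)"

definition regularity ::
    "('m::topological_space, 'e::euclidean_space) riem \<Rightarrow> ('m \<Rightarrow> real) \<Rightarrow> 'm set \<Rightarrow> real \<Rightarrow> bool" where
  "regularity M f X L \<longleftrightarrow>
     (\<forall>x\<in>X. \<forall>v\<in>feasible_dirs M X x. \<forall>t\<in>{0..1}.
        f (rexp M x (tscale t v)) \<le> (1 - t) * f x + t * f (rexp M x v) \<and>
        f (rexp M x (tscale t v)) \<le>
          f x + t * metric M x (rgrad M f x) v + L / 2 * t\<^sup>2 * (tnorm M x v)\<^sup>2)"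

definition fw_oracle ::
    "('m::topological_space, 'e::euclidean_space) riem \<Rightarrow> ('m \<Rightarrow> real) \<Rightarrow> 'm set \<Rightarrow> 'm
     \<Rightarrow> ('m, 'e) tangent set" where
  "fw_oracle M f X x =
     {v. is_arg_min (\<lambda>v. metric M x (rgrad M f x) v) (\<lambda>v. v \<in> feasible_dirs M X x) v}"

definition max_oracle_length ::
    "('m::topological_space, 'e::euclidean_space) riem \<Rightarrow> ('m \<Rightarrow> real) \<Rightarrow> 'm set \<Rightarrow> 'm \<Rightarrow> real" where
  "max_oracle_length M f X x = (SUP v\<in>fw_oracle M f X x. tnorm M x v)"

definition fw_gap ::
    "('m::topological_space, 'e::euclidean_space) riem \<Rightarrow> ('m \<Rightarrow> real) \<Rightarrow> 'm set \<Rightarrow> 'm \<Rightarrow> real" where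
  "fw_gap M f X x = - (INF v\<in>feasible_dirs M X x. metric M x (rgrad M f x) v)"

definition hoelder_error_bound ::
    "('m::topological_space, 'e::euclidean_space) riem \<Rightarrow> ('m \<Rightarrow> real) \<Rightarrow> 'm set
     \<Rightarrow> real \<Rightarrow> real \<Rightarrow> real \<Rightarrow> bool" where
  "hoelder_error_bound M f X c \<theta> R \<longleftrightarrow>
     (\<forall>x\<in>X. dist_opt M f X x \<le> R \<longrightarrow> dist_opt M f X x \<le> c * gap f X x powr \<theta>)"

definition length_normalized_scaling ::
    "('m::topological_space, 'e::euclidean_space) riem \<Rightarrow> ('m \<Rightarrow> real) \<Rightarrow> 'm set
     \<Rightarrow> real \<Rightarrow> real \<Rightarrow> bool" where
  "length_normalized_scaling M f X \<sigma> R \<longleftrightarrow>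
     (\<forall>x\<in>X - optimizers f X. dist_opt M f X x \<le> R \<longrightarrow>
        fw_gap M f X x / max_oracle_length M f X x \<ge> \<sigma> * gap f X x / dist_opt M f X x)"


section \<open>The short-step Riemannian Frank--Wolfe method\<close>

definition step_gap ::
    "('m::topological_space, 'e::euclidean_space) riem \<Rightarrow> ('m \<Rightarrow> real) \<Rightarrow> 'm
     \<Rightarrow> ('m, 'e) tangent \<Rightarrow> real" where
  "step_gap M f x v = - metric M x (rgrad M f x) v"

definition short_step ::
    "('m::topological_space, 'e::euclidean_space) riem \<Rightarrow> ('m \<Rightarrow> real) \<Rightarrow> real \<Rightarrow> 'm
     \<Rightarrow> ('m, 'e) tangent \<Rightarrow> real" where
  "short_step M f Lh x v = min 1 (step_gap M f x v / (Lh * (tnorm M x v)\<^sup>2))"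

text \<open>A complete run with iterates \<open>x k\<close> and chosen directions \<open>v k\<close>. The run terminates in
  iteration \<open>n\<close> if \<open>N = enat n\<close>, and it does not terminate if \<open>N = \<infinity>\<close>; thus iteration \<open>k\<close> is
  nonterminal iff \<open>enat k < N\<close>. The values of \<open>x\<close> and \<open>v\<close> beyond \<open>N\<close> are irrelevant.\<close>

definition short_step_RFW_run ::
    "('m::topological_space, 'e::euclidean_space) riem \<Rightarrow> ('m \<Rightarrow> real) \<Rightarrow> 'm set \<Rightarrow> real
     \<Rightarrow> (nat \<Rightarrow> 'm) \<Rightarrow> (nat \<Rightarrow> ('m, 'e) tangent) \<Rightarrow> enat \<Rightarrow> bool" where
  "short_step_RFW_run M f X Lh x v N \<longleftrightarrow>
     x 0 \<in> X \<and>
     (\<forall>k. enat k \<le> N \<longrightarrow> v k \<in> fw_oracle M f X (x k)) \<and>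
     (\<forall>k. enat k < N \<longrightarrow>
        step_gap M f (x k) (v k) \<noteq> 0 \<and>
        x (Suc k) = rexp M (x k) (tscale (short_step M f Lh (x k) (v k)) (v k))) \<and>
     (\<forall>n. N = enat n \<longrightarrow> step_gap M f (x n) (v n) = 0)"

end

theory Submission
  imports Defs
begin

text \<open>
  A minimizing geodesic from \<open>x \<in> X\<close> to an optimizer, together with convexity of \<open>f\<close> along it, shows
  that the oracle gap dominates the optimality gap, \<open>g \<ge> h\<close>. The step size minimizes the quadratic
  upper model, so one step decreases \<open>h\<close> by at least \<open>min (g/2) (g\<^sup>2 / (2 Lh \<ell>\<^sup>2))\<close>, and \<open>\<ell> \<le> D\<close> gives
  the global descent. The error bound and the scaling condition give
  \<open>g / \<ell> \<ge> \<sigma> h / r \<ge> (\<sigma> / c) h powr (1 - \<theta>)\<close> once \<open>r\<close> is small, which follows from \<open>h \<rightarrow> 0\<close> by compactness.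

  Since the exponential map is given by a definite description, the minimizing geodesic provides a
  feasible direction only by uniqueness of geodesics. This reduces to local Lipschitz continuity of
  the Christoffel symbols, read off from \<open>g(\<Gamma>(a,a), w)\<close> without inverting the metric. That \<open>D\<close> is
  an upper bound of the distances in \<open>X\<close> follows by joining coordinate segments and geodesics.
\<close>

section \<open>Charts and tangent spaces\<close>

text \<open>The one-step decrease involves the direction only through \<open>g\<close> and the
  quotient \<open>g / l\<close>, and both regimes come from lower bounds of these two numbers:
  globally \<open>h\<close> and \<open>h / D\<close>, locally \<open>h\<close> and
  \<open>(\<sigma> / c) * h powr (1 - \<theta>)\<close>. Hence the constant \<open>C\<close>: the
  square of \<open>\<sigma> / c\<close> over the \<open>2 * Lh\<close> of the quadratic model.

  Most of the length has another cause. \<open>rexp\<close>, \<open>rgrad\<close> and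
  \<open>christoffel\<close> are values of \<open>THE\<close>, so each carries information only
  after existence and uniqueness have been proved; \<open>rdist\<close>, \<open>rdiam\<close>,
  \<open>dist_opt\<close> and the oracle length are infima or suprema of reals, so each needs a
  bound before it can be compared with anything. Velocities exist only as families of coordinates;
  properties of curves are therefore proved in a chart around one time and carried to other charts
  by the chain rule.\<close>

lemma frechet_derivative_eqI:
  "(f has_derivative f') (at p) \<Longrightarrow> frechet_derivative f (at p) = f'"
  by (rule frechet_derivative_at[symmetric])

text \<open>Holds for non-differentiable functions as well: the choice operator in
  \<open>frechet_derivative\<close> is applied to the same predicate on both sides.\<close>

lemma frechet_derivative_cong_open:
  assumes "open U" "p \<in> U" "\<And>q. q \<in> U \<Longrightarrow> f q = g q"
  shows "frechet_derivative f (at p) = frechet_derivative g (at p)"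
proof -
  have "(f has_derivative D) (at p) \<longleftrightarrow> (g has_derivative D) (at p)" for D
    using assms by (metis has_derivative_transform_within_open)
  then show ?thesis
    unfolding frechet_derivative_def by simp
qed

lemma linear_real_basis:
  fixes \<phi> :: "'a::euclidean_space \<Rightarrow> real"
  assumes "linear \<phi>"
  shows "\<phi> w = (\<Sum>i\<in>Basis. (w \<bullet> i) * \<phi> i)"
proof -
  have "\<phi> w = \<phi> (\<Sum>i\<in>Basis. (w \<bullet> i) *\<^sub>R i)" by (simp add: euclidean_representation)
  also have "\<dots> = (\<Sum>i\<in>Basis. (w \<bullet> i) * \<phi> i)"
    by (simp add: linear_sum[OF assms] linear_scale[OF assms])
  finally show ?thesis .
qed

locale riem_mfd =
  fixes M :: "('m::{t2_space, second_countable_topology}, 'e::euclidean_space) riem"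
  assumes mfd: "riemannian_manifold M"
begin

lemma charts_exist: "\<exists>c. c \<in> charts_at M x"
proof -
  have "x \<in> (\<Union>c\<in>charts M. chart_dom c)"
    using mfd unfolding riemannian_manifold_def smooth_atlas_def by auto
  then show ?thesis unfolding charts_at_def by auto
qed

lemma chart_homeo:
  assumes "c \<in> charts M"
  shows "open (chart_dom c)" "open (chart_img c)"
    "homeomorphism (chart_dom c) (chart_img c) (chart_map c) (chart_inv c)"
  using assms mfd unfolding riemannian_manifold_def smooth_atlas_def by auto

lemma chart_inv_map [simp]:
  "c \<in> charts M \<Longrightarrow> x \<in> chart_dom c \<Longrightarrow> chart_inv c (chart_map c x) = x"
  using chart_homeo(3) unfolding homeomorphism_def by blast

lemma chart_map_inv [simp]:
  "c \<in> charts M \<Longrightarrow> p \<in> chart_img c \<Longrightarrow> chart_map c (chart_inv c p) = p"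
  using chart_homeo(3) unfolding homeomorphism_def by blast

lemma chart_inv_dom [simp]:
  "c \<in> charts M \<Longrightarrow> p \<in> chart_img c \<Longrightarrow> chart_inv c p \<in> chart_dom c"
  using chart_homeo(3) unfolding homeomorphism_def by blast

lemma chart_map_img [simp]: "x \<in> chart_dom c \<Longrightarrow> chart_map c x \<in> chart_img c"
  unfolding chart_img_def by auto

lemma charts_at_D: "c \<in> charts_at M x \<Longrightarrow> c \<in> charts M" "c \<in> charts_at M x \<Longrightarrow> x \<in> chart_dom c"
  unfolding charts_at_def by auto

lemma chart_inv_map_at [simp]: "c \<in> charts_at M x \<Longrightarrow> chart_inv c (chart_map c x) = x"
  by (simp add: charts_at_def)

lemma continuous_on_chart_map: "c \<in> charts M \<Longrightarrow> continuous_on (chart_dom c) (chart_map c)"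
  using chart_homeo(3) unfolding homeomorphism_def by blast

lemma continuous_on_chart_inv: "c \<in> charts M \<Longrightarrow> continuous_on (chart_img c) (chart_inv c)"
  using chart_homeo(3) unfolding homeomorphism_def by blast

lemma chart_map_open:
  assumes c: "c \<in> charts M" and U: "open U"
  shows "open (chart_map c ` (chart_dom c \<inter> U))"
proof -
  have "chart_map c ` (chart_dom c \<inter> U) = chart_img c \<inter> chart_inv c -` U"
    using c by (auto simp: chart_img_def)
  then show ?thesis
    using continuous_open_preimage[OF continuous_on_chart_inv[OF c] chart_homeo(2)[OF c] U] by simp
qed

lemma transition_smooth:
  "c \<in> charts M \<Longrightarrow> c' \<in> charts M \<Longrightarrow>
     Ck_on k (chart_map c ` (chart_dom c \<inter> chart_dom c')) (transition c c')"
  using mfd unfolding riemannian_manifold_def smooth_atlas_def smooth_on_def by auto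

lemma transition_apply [simp]:
  "c \<in> charts M \<Longrightarrow> x \<in> chart_dom c \<Longrightarrow> transition c c' (chart_map c x) = chart_map c' x"
  by (simp add: transition_def)

lemma transition_has_derivative:
  assumes "c \<in> charts_at M x" "c' \<in> charts_at M x"
  shows "(transition c c' has_derivative frechet_derivative (transition c c') (at (chart_map c x)))
           (at (chart_map c x))"
proof -
  have "Ck_on (Suc 0) (chart_map c ` (chart_dom c \<inter> chart_dom c')) (transition c c')"
    using assms transition_smooth charts_at_D by blast
  moreover have "chart_map c x \<in> chart_map c ` (chart_dom c \<inter> chart_dom c')"
    using assms charts_at_D by blast
  ultimately show ?thesis
    by (auto simp: frechet_derivative_works[symmetric])
qed

lemma transition_deriv_linear:
  "c \<in> charts_at M x \<Longrightarrow> c' \<in> charts_at M x \<Longrightarrow>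
     linear (frechet_derivative (transition c c') (at (chart_map c x)))"
  by (meson transition_has_derivative has_derivative_linear)

lemma transition_deriv_self:
  assumes "c \<in> charts_at M x"
  shows "frechet_derivative (transition c c) (at (chart_map c x)) = id"
proof -
  have "frechet_derivative (transition c c) (at (chart_map c x)) = frechet_derivative id (at (chart_map c x))"
    by (rule frechet_derivative_cong_open[where U = "chart_img c"])
      (use assms in \<open>auto simp: charts_at_def chart_homeo transition_def\<close>)
  then show ?thesis by (simp add: id_def)
qed

text \<open>Chain rule on the common overlap. This identity makes the families built by
  \<open>tvec\<close> consistent from chart to chart.\<close>

lemma transition_deriv_cocycle:
  assumes "c \<in> charts_at M x" "c1 \<in> charts_at M x" "c2 \<in> charts_at M x"
  shows "frechet_derivative (transition c c2) (at (chart_map c x)) =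
    frechet_derivative (transition c1 c2) (at (chart_map c1 x)) \<circ>
    frechet_derivative (transition c c1) (at (chart_map c x))"
proof -
  have tr: "transition c c1 (chart_map c x) = chart_map c1 x"
    using assms by (simp add: charts_at_def)
  have "((transition c1 c2 \<circ> transition c c1) has_derivative
     (frechet_derivative (transition c1 c2) (at (chart_map c1 x)) \<circ>
      frechet_derivative (transition c c1) (at (chart_map c x)))) (at (chart_map c x))"
    by (rule diff_chain_at) (use assms transition_has_derivative tr in auto)
  moreover have "frechet_derivative (transition c c2) (at (chart_map c x)) =
      frechet_derivative (transition c1 c2 \<circ> transition c c1) (at (chart_map c x))"
  proof (rule frechet_derivative_cong_open)
    show "open (chart_map c ` (chart_dom c \<inter> (chart_dom c1 \<inter> chart_dom c2)))"
      using assms by (intro chart_map_open open_Int) (auto simp: charts_at_def chart_homeo)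
  qed (use assms in \<open>auto simp: charts_at_def\<close>)
  ultimately show ?thesis
    using frechet_derivative_eqI by metis
qed

section \<open>Tangent vectors through one chart\<close>

lemma tvec_chart [simp]: "c \<in> charts_at M x \<Longrightarrow> tvec M c x a c = a"
  by (simp add: tvec_def transition_deriv_self)

lemma tvec_in_tangent_space:
  assumes "c \<in> charts_at M x"
  shows "tvec M c x a \<in> tangent_space M x"
proof -
  have cocycle: "frechet_derivative (transition c c2) (at (chart_map c x)) a =
    frechet_derivative (transition c1 c2) (at (chart_map c1 x))
      (frechet_derivative (transition c c1) (at (chart_map c x)) a)"
    if "c1 \<in> charts_at M x" "c2 \<in> charts_at M x" for c1 c2
    using transition_deriv_cocycle[OF assms that] by (simp add: o_def)
  show ?thesis
    unfolding tangent_space_def tvec_def mem_Collect_eq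
  proof (intro conjI allI impI ballI)
    fix c1 c2 assume c12: "c1 \<in> charts_at M x" "c2 \<in> charts_at M x"
    show "(if c2 \<in> charts_at M x then frechet_derivative (transition c c2) (at (chart_map c x)) a else 0) =
      frechet_derivative (transition c1 c2) (at (chart_map c1 x))
        (if c1 \<in> charts_at M x then frechet_derivative (transition c c1) (at (chart_map c x)) a else 0)"
      using c12 cocycle[OF c12] by (simp only: if_True)
  qed simp
qed

text \<open>Together with \<open>tvec_chart\<close>: evaluation in one chart identifies the tangent
  space with the model space, so closure under the vector operations can be transported from
  there.\<close>

lemma tvec_of_tangent:
  assumes "c \<in> charts_at M x" "v \<in> tangent_space M x"
  shows "tvec M c x (v c) = v"
proof
  fix c'
  show "tvec M c x (v c) c' = v c'"
  proof (cases "c' \<in> charts_at M x")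
    case True
    then have "v c' = frechet_derivative (transition c c') (at (chart_map c x)) (v c)"
      using assms unfolding tangent_space_def by blast
    then show ?thesis using True unfolding tvec_def by (simp only: if_True)
  next
    case False
    then have "v c' = 0" using assms unfolding tangent_space_def by blast
    then show ?thesis using False by (simp add: tvec_def)
  qed
qed

lemma tvec_add: "c \<in> charts_at M x \<Longrightarrow> tvec M c x (a + b) = tadd (tvec M c x a) (tvec M c x b)"
  by (auto simp: tvec_def tadd_def linear_add[OF transition_deriv_linear])

lemma tvec_scale: "c \<in> charts_at M x \<Longrightarrow> tvec M c x (t *\<^sub>R a) = tscale t (tvec M c x a)"
  by (auto simp: tvec_def tscale_def linear_scale[OF transition_deriv_linear])

lemma zero_tangent: "(\<lambda>_. 0) \<in> tangent_space M x"
  by (auto simp: tangent_space_def linear_0[OF transition_deriv_linear])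

lemma tscale_tangent:
  assumes "v \<in> tangent_space M x"
  shows "tscale t v \<in> tangent_space M x"
proof -
  obtain c where "c \<in> charts_at M x" using charts_exist by blast
  then show ?thesis
    using assms by (metis tvec_scale tvec_in_tangent_space tvec_of_tangent)
qed

lemma tadd_tangent:
  assumes "u \<in> tangent_space M x" "v \<in> tangent_space M x"
  shows "tadd u v \<in> tangent_space M x"
proof -
  obtain c where "c \<in> charts_at M x" using charts_exist by blast
  then show ?thesis
    using assms by (metis tvec_add tvec_in_tangent_space tvec_of_tangent)
qed

section \<open>The inner product of a tangent space\<close>

lemma tangent_inner_product: "inner_product_on_tangent M x"
  using mfd unfolding riemannian_manifold_def by blast

lemma metric_sym:
  "u \<in> tangent_space M x \<Longrightarrow> v \<in> tangent_space M x \<Longrightarrow> metric M x u v = metric M x v u"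
  using tangent_inner_product[of x] unfolding inner_product_on_tangent_def by (elim conjE) simp

lemma metric_add:
  "u \<in> tangent_space M x \<Longrightarrow> v \<in> tangent_space M x \<Longrightarrow> w \<in> tangent_space M x \<Longrightarrow>
     metric M x (tadd u v) w = metric M x u w + metric M x v w"
  using tangent_inner_product[of x] unfolding inner_product_on_tangent_def by (elim conjE) simp

lemma metric_scale:
  "u \<in> tangent_space M x \<Longrightarrow> v \<in> tangent_space M x \<Longrightarrow>
     metric M x (tscale t u) v = t * metric M x u v"
  using tangent_inner_product[of x] unfolding inner_product_on_tangent_def by (elim conjE) simp

lemma metric_pos:
  "v \<in> tangent_space M x \<Longrightarrow> v \<noteq> (\<lambda>_. 0) \<Longrightarrow> metric M x v v > 0"
  using tangent_inner_product[of x] unfolding inner_product_on_tangent_def by (elim conjE) simp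

lemma metric_zero_left: "v \<in> tangent_space M x \<Longrightarrow> metric M x (\<lambda>_. 0) v = 0"
  using metric_scale[of v x v 0] by (simp add: tscale_def)

lemma metric_zero_right: "v \<in> tangent_space M x \<Longrightarrow> metric M x v (\<lambda>_. 0) = 0"
  using metric_sym[OF zero_tangent, of v x] metric_zero_left[of v x] by simp

lemma metric_nonneg: "v \<in> tangent_space M x \<Longrightarrow> metric M x v v \<ge> 0"
  using metric_pos[of v x] metric_zero_left[of v x] by (cases "v = (\<lambda>_. 0)") auto

lemma tnorm_nonneg: "v \<in> tangent_space M x \<Longrightarrow> tnorm M x v \<ge> 0"
  by (simp add: tnorm_def metric_nonneg)

lemma tnorm_eq_0: "v \<in> tangent_space M x \<Longrightarrow> tnorm M x v = 0 \<Longrightarrow> v = (\<lambda>_. 0)"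
  using metric_pos[of v x] by (auto simp: tnorm_def)

lemma metric_Cauchy_Schwarz:
  assumes u: "u \<in> tangent_space M x" and v: "v \<in> tangent_space M x"
  shows "\<bar>metric M x u v\<bar> \<le> tnorm M x u * tnorm M x v"
proof (cases "v = (\<lambda>_. 0)")
  case True
  then show ?thesis using u v by (simp add: metric_zero_right tnorm_def metric_nonneg)
next
  case False
  define B where "B = metric M x v v"
  have B: "B > 0" using metric_pos[OF v False] by (simp add: B_def)
  \<comment> \<open>The minimizer of the squared norm of u + t v; that this minimum is nonnegative
    is the claim.\<close>
  define t where "t = - metric M x u v / B"
  define w where "w = tadd u (tscale t v)"
  have tv: "tscale t v \<in> tangent_space M x" by (simp add: tscale_tangent v)
  have w: "w \<in> tangent_space M x" by (simp add: w_def tadd_tangent u tv)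
  have "metric M x w w = metric M x u w + t * metric M x v w"
    using metric_add[OF u tv w] metric_scale[OF v w] by (simp add: w_def)
  moreover have "metric M x u w = metric M x u u + t * metric M x u v"
    using metric_add[OF u tv u] metric_scale[OF v u] metric_sym[OF u w] metric_sym[OF u v]
    by (simp add: w_def)
  moreover have "metric M x v w = metric M x u v + t * B"
    using metric_add[OF u tv v] metric_scale[OF v v] metric_sym[OF v w]
    by (simp add: w_def B_def)
  ultimately have "metric M x w w = metric M x u u - (metric M x u v)\<^sup>2 / B"
    using B by (simp add: t_def field_simps power2_eq_square)
  then have "(metric M x u v)\<^sup>2 \<le> metric M x u u * B"
    using mult_nonneg_nonneg[OF less_imp_le[OF B] metric_nonneg[OF w]] B
    by (simp add: field_simps)
  then have "sqrt ((metric M x u v)\<^sup>2) \<le> sqrt (metric M x u u * B)"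
    by (rule real_sqrt_le_mono)
  then show ?thesis by (simp add: tnorm_def real_sqrt_mult B_def)
qed

section \<open>The metric in coordinates\<close>

lemma metric_coord_add:
  assumes "c \<in> charts M" "p \<in> chart_img c"
  shows "metric_coord M c p (a + a') b = metric_coord M c p a b + metric_coord M c p a' b"
proof -
  have "c \<in> charts_at M (chart_inv c p)" using assms by (simp add: charts_at_def)
  then show ?thesis
    by (simp add: metric_coord_def tvec_add metric_add tvec_in_tangent_space)
qed

lemma metric_coord_scale:
  assumes "c \<in> charts M" "p \<in> chart_img c"
  shows "metric_coord M c p (t *\<^sub>R a) b = t * metric_coord M c p a b"
proof -
  have "c \<in> charts_at M (chart_inv c p)" using assms by (simp add: charts_at_def)
  then show ?thesis
    by (simp add: metric_coord_def tvec_scale metric_scale tvec_in_tangent_space)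
qed

lemma metric_coord_sym:
  assumes "c \<in> charts M" "p \<in> chart_img c"
  shows "metric_coord M c p a b = metric_coord M c p b a"
proof -
  have "c \<in> charts_at M (chart_inv c p)" using assms by (simp add: charts_at_def)
  from metric_sym[OF tvec_in_tangent_space[OF this] tvec_in_tangent_space[OF this]]
  show ?thesis
    unfolding metric_coord_def .
qed

lemma metric_coord_linear:
  assumes "c \<in> charts M" "p \<in> chart_img c"
  shows "linear (\<lambda>a. metric_coord M c p a b)" "linear (\<lambda>b. metric_coord M c p a b)"
proof -
  show 1: "linear (\<lambda>a. metric_coord M c p a b)" for b
    by (rule linearI) (use assms metric_coord_add metric_coord_scale in auto)
  show "linear (\<lambda>b. metric_coord M c p a b)"
  proof -
    have "(\<lambda>b. metric_coord M c p a b) = (\<lambda>b. metric_coord M c p b a)"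
      by (rule ext) (rule metric_coord_sym[OF assms])
    then show ?thesis using 1[of a] by (simp only:)
  qed
qed

lemma metric_coord_pos:
  assumes "c \<in> charts M" "p \<in> chart_img c" "a \<noteq> 0"
  shows "metric_coord M c p a a > 0"
proof -
  have c: "c \<in> charts_at M (chart_inv c p)" using assms by (simp add: charts_at_def)
  then have "tvec M c (chart_inv c p) a \<noteq> (\<lambda>_. 0)"
    using tvec_chart assms(3) by metis
  then show ?thesis
    by (simp add: metric_coord_def metric_pos tvec_in_tangent_space c)
qed

lemma metric_eq_coord:
  assumes "c \<in> charts_at M x" "u \<in> tangent_space M x" "v \<in> tangent_space M x"
  shows "metric M x u v = metric_coord M c (chart_map c x) (u c) (v c)"
  using assms by (simp add: metric_coord_def tvec_of_tangent)

lemma metric_coord_smooth: "c \<in> charts M \<Longrightarrow> Ck_on k (chart_img c) (\<lambda>p. metric_coord M c p a b)"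
  using mfd unfolding riemannian_manifold_def smooth_on_def by blast

text \<open>Positive definiteness makes \<open>T\<close>, the operator that represents the metric
  against the Euclidean inner product, injective, hence surjective in finite dimension. Both
  \<open>christoffel\<close> and \<open>rgrad\<close> get their meaning from this existence and
  uniqueness.\<close>

lemma metric_coord_Riesz:
  assumes "c \<in> charts M" "p \<in> chart_img c" "linear \<phi>"
  shows "\<exists>!e. \<forall>w. metric_coord M c p e w = \<phi> w"
proof -
  note lin = metric_coord_linear[OF assms(1,2)]
  define T where "T e = (\<Sum>i\<in>Basis. metric_coord M c p e i *\<^sub>R i)" for e
  have inner_T: "T e \<bullet> w = metric_coord M c p e w" for e w
  proof -
    have "metric_coord M c p e w = (\<Sum>i\<in>Basis. (w \<bullet> i) * metric_coord M c p e i)"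
      by (rule linear_real_basis[OF lin(2)])
    then show ?thesis
      by (simp add: T_def inner_sum_right inner_commute[of _ w] mult.commute)
  qed
  have linT: "linear T"
    by (rule linearI; rule vector_eq_rdot[THEN iffD1])
      (auto simp: inner_T inner_add_left linear_add[OF lin(1)] linear_scale[OF lin(1)])
  have injT: "inj T"
    unfolding linear_injective_0[OF linT]
    using inner_T metric_coord_pos[OF assms(1,2)] by (metis inner_zero_left less_irrefl)
  then have "surj T" by (rule linear_inj_imp_surj[OF linT])
  define b where "b = (\<Sum>i\<in>Basis. \<phi> i *\<^sub>R i)"
  have b: "b \<bullet> w = \<phi> w" for w
    using linear_real_basis[OF assms(3), of w]
    by (simp add: b_def inner_sum_right inner_commute[of _ w] mult.commute)
  have "(\<forall>w. metric_coord M c p e w = \<phi> w) \<longleftrightarrow> T e = b" for e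
    using inner_T b by (metis vector_eq_rdot)
  then show ?thesis
    using injT \<open>surj T\<close> by (metis injD surjD)
qed

end

section \<open>Local Lipschitz continuity and uniqueness for ODEs\<close>

text \<open>Ball and constant are hidden under existential quantifiers, so that the closure rules
  below can read local Lipschitz continuity off a formula without bookkeeping of radii.\<close>

definition lipschitz_near :: "'a::metric_space \<Rightarrow> ('a \<Rightarrow> 'b::metric_space) \<Rightarrow> bool" where
  "lipschitz_near z f \<longleftrightarrow> (\<exists>e>0. \<exists>K. K-lipschitz_on (ball z e) f)"

lemma lipschitz_nearI: "e > 0 \<Longrightarrow> K-lipschitz_on (ball z e) f \<Longrightarrow> lipschitz_near z f"
  unfolding lipschitz_near_def by blast

lemma lipschitz_near_bounded:
  fixes f :: "'a::metric_space \<Rightarrow> 'b::real_normed_vector"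
  assumes "lipschitz_near z f"
  shows "\<exists>e>0. \<exists>B. \<forall>u\<in>ball z e. norm (f u) \<le> B"
proof -
  obtain e K where e: "e > 0" and K: "K-lipschitz_on (ball z e) f"
    using assms unfolding lipschitz_near_def by blast
  have K0: "K \<ge> 0" using lipschitz_on_nonneg[OF K] .
  have "norm (f u) \<le> norm (f z) + K * e" if u: "u \<in> ball z e" for u
  proof -
    have "dist (f u) (f z) \<le> K * dist u z"
      using lipschitz_onD[OF K u] e by simp
    also have "\<dots> \<le> K * e"
      using u K0 by (intro mult_left_mono) (auto simp: dist_commute)
    finally show ?thesis
      using norm_triangle_sub[of "f u" "f z"] by (simp add: dist_norm)
  qed
  then show ?thesis using e by blast
qed

lemma lipschitz_near_const: "lipschitz_near z (\<lambda>_. k)"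
  by (rule lipschitz_nearI[of 1 0]) (auto intro: lipschitz_on_constant)

lemma lipschitz_near_add:
  fixes f g :: "'a::metric_space \<Rightarrow> 'b::real_normed_vector"
  assumes "lipschitz_near z f" "lipschitz_near z g"
  shows "lipschitz_near z (\<lambda>u. f u + g u)"
proof -
  obtain e1 K1 e2 K2 where *: "e1 > 0" "K1-lipschitz_on (ball z e1) f"
    "e2 > 0" "K2-lipschitz_on (ball z e2) g"
    using assms unfolding lipschitz_near_def by blast
  have "(K1 + K2)-lipschitz_on (ball z (min e1 e2)) (\<lambda>u. f u + g u)"
    using * by (intro lipschitz_on_add) (auto intro: lipschitz_on_subset)
  then show ?thesis using * by (intro lipschitz_nearI[of "min e1 e2"]) auto
qed

lemma lipschitz_near_sum:
  fixes f :: "'i \<Rightarrow> 'a::metric_space \<Rightarrow> 'b::real_normed_vector"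
  assumes "finite I" "\<And>i. i \<in> I \<Longrightarrow> lipschitz_near z (f i)"
  shows "lipschitz_near z (\<lambda>u. \<Sum>i\<in>I. f i u)"
  using assms
  by (induction I rule: finite_induct) (auto intro: lipschitz_near_const lipschitz_near_add)

text \<open>Lipschitz factors give a Lipschitz product only where they are also bounded, hence the
  four radii.\<close>

lemma lipschitz_near_scaleR:
  fixes f :: "'a::metric_space \<Rightarrow> real" and g :: "'a \<Rightarrow> 'b::real_normed_vector"
  assumes f: "lipschitz_near z f" and g: "lipschitz_near z g"
  shows "lipschitz_near z (\<lambda>u. f u *\<^sub>R g u)"
proof -
  obtain e1 K1 e2 K2 where 1: "e1 > 0" "K1-lipschitz_on (ball z e1) f"
    and 2: "e2 > 0" "K2-lipschitz_on (ball z e2) g"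
    using assms unfolding lipschitz_near_def by blast
  obtain e3 B1 where 3: "e3 > 0" "\<And>u. u \<in> ball z e3 \<Longrightarrow> norm (f u) \<le> B1"
    using lipschitz_near_bounded[OF f] by blast
  obtain e4 B2 where 4: "e4 > 0" "\<And>u. u \<in> ball z e4 \<Longrightarrow> norm (g u) \<le> B2"
    using lipschitz_near_bounded[OF g] by blast
  have K: "K1 \<ge> 0" "K2 \<ge> 0" using 1 2 lipschitz_on_nonneg by blast+
  have "norm (f z) \<le> B1" "norm (g z) \<le> B2" using 3 4 by auto
  then have B: "B1 \<ge> 0" "B2 \<ge> 0" using norm_ge_zero order_trans by blast+
  define e where "e = min (min e1 e2) (min e3 e4)"
  have "(B1 * K2 + K1 * B2)-lipschitz_on (ball z e) (\<lambda>u. f u *\<^sub>R g u)"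
  proof (rule lipschitz_onI)
    fix u v assume uv: "u \<in> ball z e" "v \<in> ball z e"
    have fuv: "\<bar>f u - f v\<bar> \<le> K1 * dist u v"
      using lipschitz_onD[OF 1(2), of u v] uv by (simp add: e_def dist_real_def)
    have guv: "norm (g u - g v) \<le> K2 * dist u v"
      using lipschitz_onD[OF 2(2), of u v] uv by (simp add: e_def dist_norm)
    have bf: "\<bar>f u\<bar> \<le> B1" using 3(2)[of u] uv by (simp add: e_def)
    have bg: "norm (g v) \<le> B2" using 4(2)[of v] uv by (simp add: e_def)
    have "f u *\<^sub>R g u - f v *\<^sub>R g v = f u *\<^sub>R (g u - g v) + (f u - f v) *\<^sub>R g v"
      by (simp add: algebra_simps)
    then have "norm (f u *\<^sub>R g u - f v *\<^sub>R g v) \<le>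
        \<bar>f u\<bar> * norm (g u - g v) + \<bar>f u - f v\<bar> * norm (g v)"
      by (metis norm_scaleR norm_triangle_ineq)
    also have "\<dots> \<le> B1 * (K2 * dist u v) + (K1 * dist u v) * B2"
      using fuv guv bf bg B K by (intro add_mono mult_mono) auto
    finally show "dist (f u *\<^sub>R g u) (f v *\<^sub>R g v) \<le> (B1 * K2 + K1 * B2) * dist u v"
      by (simp add: dist_norm algebra_simps)
  qed (use B K in simp)
  then show ?thesis
    using 1 2 3 4 by (intro lipschitz_nearI[of e]) (auto simp: e_def)
qed

lemma lipschitz_near_mult:
  fixes f g :: "'a::metric_space \<Rightarrow> real"
  assumes "lipschitz_near z f" "lipschitz_near z g"
  shows "lipschitz_near z (\<lambda>u. f u * g u)"
  using lipschitz_near_scaleR[OF assms] by simp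

lemma lipschitz_near_Pair:
  assumes "lipschitz_near z f" "lipschitz_near z g"
  shows "lipschitz_near z (\<lambda>u. (f u, g u))"
proof -
  obtain e1 K1 e2 K2 where *: "e1 > 0" "K1-lipschitz_on (ball z e1) f"
    "e2 > 0" "K2-lipschitz_on (ball z e2) g"
    using assms unfolding lipschitz_near_def by blast
  have "(sqrt (K1\<^sup>2 + K2\<^sup>2))-lipschitz_on (ball z (min e1 e2)) (\<lambda>u. (f u, g u))"
    using * by (intro lipschitz_on_Pair) (auto intro: lipschitz_on_subset)
  then show ?thesis using * by (intro lipschitz_nearI[of "min e1 e2"]) auto
qed

lemma lipschitz_near_bounded_linear:
  assumes "bounded_linear f"
  shows "lipschitz_near z f"
proof -
  obtain B where "\<And>u. norm (f u) \<le> norm u * B" "B > 0"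
    using bounded_linear.pos_bounded[OF assms] by blast
  then have "B-lipschitz_on (ball z 1) f"
    using assms by (intro lipschitz_onI)
      (auto simp: dist_norm linear_diff[OF bounded_linear.linear[OF assms], symmetric] mult.commute)
  then show ?thesis by (rule lipschitz_nearI[rotated]) simp
qed

lemma lipschitz_near_fst:
  assumes "lipschitz_near (fst z) f"
  shows "lipschitz_near z (\<lambda>u. f (fst u))"
proof -
  obtain e K where e: "e > 0" and K: "K-lipschitz_on (ball (fst z) e) f"
    using assms unfolding lipschitz_near_def by blast
  have "K-lipschitz_on (ball z e) (\<lambda>u. f (fst u))"
  proof (rule lipschitz_onI)
    fix u v assume "u \<in> ball z e" "v \<in> ball z e"
    then have "fst u \<in> ball (fst z) e" "fst v \<in> ball (fst z) e"
      using dist_fst_le[of z u] dist_fst_le[of z v] by auto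
    then have "dist (f (fst u)) (f (fst v)) \<le> K * dist (fst u) (fst v)"
      by (rule lipschitz_onD[OF K])
    also have "\<dots> \<le> K * dist u v"
      using lipschitz_on_nonneg[OF K] by (intro mult_left_mono dist_fst_le)
    finally show "dist (f (fst u)) (f (fst v)) \<le> K * dist u v" .
  qed (rule lipschitz_on_nonneg[OF K])
  then show ?thesis by (rule lipschitz_nearI[OF e])
qed

text \<open>\<open>Ck_on\<close> makes the derivative continuous in the base point for each fixed
  direction. A bound of the operator norm is therefore assembled from the bounds in the basis
  directions on a compact ball, where the mean value inequality then applies.\<close>

lemma C1_lipschitz_near:
  fixes f :: "'a::euclidean_space \<Rightarrow> real"
  assumes f: "Ck_on (Suc 0) S f" and S: "open S" "z \<in> S"
  shows "lipschitz_near z f"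
proof -
  let ?D = "\<lambda>p. frechet_derivative f (at p)"
  have der: "(f has_derivative ?D p) (at p)" if "p \<in> S" for p
    using f that unfolding Ck_on.simps frechet_derivative_works[symmetric] by blast
  have cont: "continuous_on S (\<lambda>p. ?D p a)" for a
    using f by auto
  obtain e where e: "e > 0" "cball z e \<subseteq> S"
    using S open_contains_cball by blast
  have "\<exists>B. \<forall>p\<in>cball z e. norm (?D p b) \<le> B" for b
  proof -
    have "bounded ((\<lambda>p. ?D p b) ` cball z e)"
      using continuous_on_subset[OF cont e(2)] compact_cball
      by (rule compact_imp_bounded[OF compact_continuous_image])
    then show ?thesis by (auto simp: bounded_iff)
  qed
  then obtain B where B: "\<And>b p. p \<in> cball z e \<Longrightarrow> norm (?D p b) \<le> B b" by metis
  define K where "K = (\<Sum>b\<in>Basis. B b)"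
  have on: "onorm (?D p) \<le> K" if p: "p \<in> cball z e" for p
  proof (rule onorm_le)
    fix h
    have lin: "linear (?D p)"
      using der p e has_derivative_linear by blast
    have "norm (?D p h) = \<bar>\<Sum>b\<in>Basis. (h \<bullet> b) * ?D p b\<bar>"
      using linear_real_basis[OF lin, of h] by simp
    also have "\<dots> \<le> (\<Sum>b\<in>Basis. \<bar>(h \<bullet> b) * ?D p b\<bar>)" by (rule sum_abs)
    also have "\<dots> \<le> (\<Sum>b\<in>Basis. norm h * B b)"
      unfolding abs_mult using B[OF p] Basis_le_norm
      by (intro sum_mono mult_mono) auto
    finally show "norm (?D p h) \<le> K * norm h"
      by (simp add: K_def sum_distrib_left mult.commute)
  qed
  have K0: "K \<ge> 0"
    using on[of z] e onorm_pos_le[OF has_derivative_bounded_linear[OF der[OF S(2)]]] by auto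
  have "K-lipschitz_on (ball z e) f"
  proof (rule lipschitz_onI)
    fix u v assume "u \<in> ball z e" "v \<in> ball z e"
    then have uv: "u \<in> cball z e" "v \<in> cball z e" by auto
    have "norm (f u - f v) \<le> K * norm (u - v)"
      by (rule differentiable_bound[OF convex_cball has_derivative_at_withinI[OF der] on uv])
        (use e in auto)
    then show "dist (f u) (f v) \<le> K * dist u v" by (simp add: dist_norm)
  qed (rule K0)
  then show ?thesis by (rule lipschitz_nearI[OF e(1)])
qed

section \<open>Uniqueness for ordinary differential equations\<close>

lemma zero_of_derivative_bound:
  fixes n :: "real \<Rightarrow> 'a::real_normed_vector"
  assumes J: "compact J" "convex J" "t0 \<in> J" and n0: "n t0 = 0"
    and der: "\<And>t. t \<in> J \<Longrightarrow> (n has_vector_derivative n' t) (at t within J)"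
    and bd: "\<And>t. t \<in> J \<Longrightarrow> norm (n' t) \<le> K * norm (n t)" and K: "K \<ge> 0"
    and small: "\<And>t. t \<in> J \<Longrightarrow> \<bar>t - t0\<bar> \<le> \<delta>" "K * \<delta> < 1"
    and t: "t \<in> J"
  shows "n t = 0"
proof -
  have "continuous_on J n"
    using der has_vector_derivative_continuous continuous_on_eq_continuous_within by blast
  then have "continuous_on J (\<lambda>t. norm (n t))" by (intro continuous_intros)
  \<comment> \<open>A short-interval substitute for Gronwall: at a maximum \<open>s\<close> of the
    norm, the mean value inequality from \<open>t0\<close> gives
    \<open>norm (n s) \<le> K * \<delta> * norm (n s)\<close>, and \<open>K * \<delta> < 1\<close>
    leaves only 0.\<close>
  then obtain s where s: "s \<in> J" and max: "\<And>t. t \<in> J \<Longrightarrow> norm (n t) \<le> norm (n s)"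
    using continuous_attains_sup[of J "\<lambda>t. norm (n t)"] J by blast
  have "norm (n s - n t0) \<le> (K * norm (n s)) * norm (s - t0)"
  proof (rule differentiable_bound[OF J(2) _ _ s J(3)])
    show "(n has_derivative (\<lambda>h. h *\<^sub>R n' r)) (at r within J)" if "r \<in> J" for r
      using der[OF that] by (simp add: has_vector_derivative_def)
    show "onorm (\<lambda>h. h *\<^sub>R n' r) \<le> K * norm (n s)" if r: "r \<in> J" for r
    proof (rule onorm_le)
      fix h :: real
      have "norm (n' r) \<le> K * norm (n s)"
        using bd[OF r] mult_left_mono[OF max[OF r] K] by linarith
      then show "norm (h *\<^sub>R n' r) \<le> K * norm (n s) * norm h"
        using mult_left_mono[of "norm (n' r)" "K * norm (n s)" "\<bar>h\<bar>"] by (simp add: mult.commute)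
    qed
  qed
  then have "norm (n s) \<le> K * norm (n s) * \<bar>s - t0\<bar>" using n0 by simp
  also have "\<dots> \<le> K * norm (n s) * \<delta>"
    using small(1)[OF s] K by (intro mult_left_mono) auto
  finally have "norm (n s) * (1 - K * \<delta>) \<le> 0" by (simp add: algebra_simps)
  then have "norm (n s) \<le> 0" using small(2) by (simp add: mult_le_0_iff)
  then show ?thesis using max[OF t] by simp
qed

lemma ode_unique_locally:
  fixes Y Z :: "real \<Rightarrow> 'a::real_normed_vector"
  assumes F: "lipschitz_near (Y t0) F" and I: "t0 \<in> {a..b}"
    and d: "d > 0"
    and Y: "\<And>t. t \<in> {a..b} \<Longrightarrow> \<bar>t - t0\<bar> < d \<Longrightarrow> (Y has_vector_derivative F (Y t)) (at t within {a..b})"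
    and Z: "\<And>t. t \<in> {a..b} \<Longrightarrow> \<bar>t - t0\<bar> < d \<Longrightarrow> (Z has_vector_derivative F (Z t)) (at t within {a..b})"
    and eq: "Y t0 = Z t0"
  shows "\<exists>\<delta>>0. \<forall>t\<in>{a..b}. \<bar>t - t0\<bar> < \<delta> \<longrightarrow> Y t = Z t"
proof -
  obtain e K where e: "e > 0" and K: "K-lipschitz_on (ball (Y t0) e) F"
    using F unfolding lipschitz_near_def by blast
  have K0: "K \<ge> 0" using lipschitz_on_nonneg[OF K] .
  have near: "\<exists>\<rho>>0. \<forall>t\<in>{a..b}. \<bar>t - t0\<bar> < \<rho> \<longrightarrow> G t \<in> ball (Y t0) e"
    if "(G has_vector_derivative g) (at t0 within {a..b})" "G t0 = Y t0" for G g
  proof -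
    have "continuous (at t0 within {a..b}) G"
      using that(1) by (rule has_vector_derivative_continuous)
    then obtain \<rho> where "\<rho> > 0" and
      \<rho>: "\<And>t. t \<in> {a..b} \<Longrightarrow> dist t t0 < \<rho> \<Longrightarrow> dist (G t) (G t0) < e"
      unfolding continuous_within_eps_delta using e by blast
    then show ?thesis
      using that(2) by (intro exI[of _ \<rho>]) (auto simp: dist_commute dist_real_def)
  qed
  obtain \<rho>1 where \<rho>1: "\<rho>1 > 0" "\<And>t. t \<in> {a..b} \<Longrightarrow> \<bar>t - t0\<bar> < \<rho>1 \<Longrightarrow> Y t \<in> ball (Y t0) e"
    using near[OF Y[of t0]] I d by auto
  obtain \<rho>2 where \<rho>2: "\<rho>2 > 0" "\<And>t. t \<in> {a..b} \<Longrightarrow> \<bar>t - t0\<bar> < \<rho>2 \<Longrightarrow> Z t \<in> ball (Y t0) e"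
    using near[OF Z[of t0]] I d eq by auto
  \<comment> \<open>\<open>K + 1\<close> because \<open>K\<close> may be 0. The strict inequalities
    for \<open>\<delta>\<close> let the closed interval \<open>J\<close> of radius
    \<open>\<delta>\<close> fit into the open neighbourhoods.\<close>
  have "0 < min (min d (1 / (K + 1))) (min \<rho>1 \<rho>2)"
    using d \<rho>1(1) \<rho>2(1) K0 by simp
  then obtain \<delta> where \<delta>: "\<delta> > 0" "\<delta> < d" "\<delta> < \<rho>1" "\<delta> < \<rho>2" "\<delta> < 1 / (K + 1)"
    using dense by (metis min_less_iff_conj)
  have K\<delta>: "K * \<delta> < 1"
  proof -
    have "K * \<delta> \<le> (K + 1) * \<delta>" using \<delta> by simp
    also have "\<dots> < 1" using \<delta>(5) K0 by (simp add: field_simps)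
    finally show ?thesis .
  qed
  define J where "J = {max a (t0 - \<delta>)..min b (t0 + \<delta>)}"
  have J: "t \<in> J \<longleftrightarrow> t \<in> {a..b} \<and> \<bar>t - t0\<bar> \<le> \<delta>" for t
    by (auto simp: J_def)
  have "Y t - Z t = 0" if t: "t \<in> J" for t
  proof (rule zero_of_derivative_bound[where n = "\<lambda>t. Y t - Z t" and n' = "\<lambda>t. F (Y t) - F (Z t)"
        and J = J and ?t0.0 = t0 and K = K and \<delta> = \<delta>])
    fix r assume r: "r \<in> J"
    then have r': "r \<in> {a..b}" "\<bar>r - t0\<bar> < d" "\<bar>r - t0\<bar> < \<rho>1" "\<bar>r - t0\<bar> < \<rho>2"
      using J \<delta> by fastforce+
    have "J \<subseteq> {a..b}" using J by auto
    then show "((\<lambda>t. Y t - Z t) has_vector_derivative F (Y r) - F (Z r)) (at r within J)"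
      using Y[OF r'(1,2)] Z[OF r'(1,2)]
      by (intro has_vector_derivative_diff) (auto intro: has_vector_derivative_within_subset)
    show "norm (F (Y r) - F (Z r)) \<le> K * norm (Y r - Z r)"
      using lipschitz_onD[OF K \<rho>1(2) \<rho>2(2)] r' by (simp add: dist_norm)
    show "\<bar>r - t0\<bar> \<le> \<delta>" using r J by simp
  qed (use t J I \<delta> eq K0 K\<delta> in \<open>auto simp: J_def\<close>)
  then show ?thesis using \<delta>(1) J by (intro exI[of _ \<delta>]) auto
qed

section \<open>Christoffel symbols\<close>

lemma Icc_not_bot:
  fixes a b t :: real
  shows "a < b \<Longrightarrow> t \<in> {a..b} \<Longrightarrow> at t within {a..b} \<noteq> bot"
  using islimpt_Icc[of a b t] by (simp add: trivial_limit_within)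

lemma vector_derivative_Icc:
  fixes a b t :: real
  assumes "a < b" "t \<in> {a..b}" "(f has_vector_derivative D) (at t within {a..b})"
  shows "vector_derivative f (at t within {a..b}) = D"
  using vector_derivative_within[OF Icc_not_bot assms(3)] assms by blast

context riem_mfd
begin

definition dmetric :: "('m, 'e) chart \<Rightarrow> 'e \<Rightarrow> 'e \<Rightarrow> 'e \<Rightarrow> 'e \<Rightarrow> real" where
  "dmetric c i j k p = frechet_derivative (\<lambda>q. metric_coord M c q i j) (at p) k"

lemma metric_coord_has_derivative:
  assumes "c \<in> charts M" "p \<in> chart_img c"
  shows "((\<lambda>q. metric_coord M c q a b) has_derivative
    frechet_derivative (\<lambda>q. metric_coord M c q a b) (at p)) (at p)"
  using metric_coord_smooth[OF assms(1), of "Suc 0" a b] assms(2)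
  unfolding Ck_on.simps frechet_derivative_works[symmetric] by blast

lemma metric_coord_expand:
  assumes "c \<in> charts M" "p \<in> chart_img c"
  shows "metric_coord M c p a b = (\<Sum>i\<in>Basis. \<Sum>j\<in>Basis. (a \<bullet> i) * (b \<bullet> j) * metric_coord M c p i j)"
proof -
  have "metric_coord M c p a b = (\<Sum>i\<in>Basis. (a \<bullet> i) * metric_coord M c p i b)"
    by (rule linear_real_basis[OF metric_coord_linear(1)[OF assms]])
  also have "\<dots> = (\<Sum>i\<in>Basis. (a \<bullet> i) * (\<Sum>j\<in>Basis. (b \<bullet> j) * metric_coord M c p i j))"
    by (intro sum.cong refl arg_cong2[where f = times] linear_real_basis[OF metric_coord_linear(2)[OF assms]])
  finally show ?thesis by (simp add: sum_distrib_left mult.assoc)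
qed

lemma metric_coord_deriv_expand:
  assumes c: "c \<in> charts M" and p: "p \<in> chart_img c"
  shows "frechet_derivative (\<lambda>q. metric_coord M c q a b) (at p) k =
    (\<Sum>i\<in>Basis. \<Sum>j\<in>Basis. (a \<bullet> i) * (b \<bullet> j) * dmetric c i j k p)"
proof -
  let ?f = "\<lambda>q. \<Sum>i\<in>Basis. \<Sum>j\<in>Basis. (a \<bullet> i) * (b \<bullet> j) * metric_coord M c q i j"
  have "(?f has_derivative (\<lambda>k. \<Sum>i\<in>Basis. \<Sum>j\<in>Basis. (a \<bullet> i) * (b \<bullet> j) * dmetric c i j k p)) (at p)"
    unfolding dmetric_def
    by (intro has_derivative_sum has_derivative_mult_right metric_coord_has_derivative[OF c p])
  moreover have "frechet_derivative (\<lambda>q. metric_coord M c q a b) (at p) = frechet_derivative ?f (at p)"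
    by (rule frechet_derivative_cong_open[OF chart_homeo(2)[OF c] p metric_coord_expand[OF c]])
  ultimately show ?thesis by (simp add: frechet_derivative_eqI)
qed

lemma dmetric_linear:
  assumes "c \<in> charts M" "p \<in> chart_img c"
  shows "linear (\<lambda>k. dmetric c i j k p)"
  unfolding dmetric_def by (rule has_derivative_linear[OF metric_coord_has_derivative[OF assms]])

lemma lipschitz_near_metric_coord:
  assumes "c \<in> charts M" "p \<in> chart_img c"
  shows "lipschitz_near p (\<lambda>q. metric_coord M c q a b)"
  by (rule C1_lipschitz_near[OF metric_coord_smooth[OF assms(1)] chart_homeo(2)[OF assms(1)] assms(2)])

lemma lipschitz_near_dmetric:
  assumes "c \<in> charts M" "p \<in> chart_img c"
  shows "lipschitz_near p (dmetric c i j k)"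
proof -
  have "Ck_on (Suc 0) (chart_img c) (\<lambda>q. frechet_derivative (\<lambda>q. metric_coord M c q i j) (at q) k)"
    using metric_coord_smooth[OF assms(1), of "Suc (Suc 0)" i j] unfolding Ck_on.simps(2)[of "Suc 0"] by blast
  from C1_lipschitz_near[OF this chart_homeo(2)[OF assms(1)] assms(2)]
  show ?thesis unfolding dmetric_def .
qed

text \<open>The lowered Christoffel symbol: \<open>g(\<Gamma>(a,a), w) = geo_force c p a \<bullet> w\<close>.\<close>

definition geo_force :: "('m, 'e) chart \<Rightarrow> 'e \<Rightarrow> 'e \<Rightarrow> 'e" where
  "geo_force c p a = (\<Sum>j\<in>Basis. (\<Sum>i\<in>Basis. \<Sum>k\<in>Basis.
      (a \<bullet> i) * (a \<bullet> k) * (dmetric c i j k p - dmetric c i k j p / 2)) *\<^sub>R j)"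

lemma geo_force_inner:
  assumes c: "c \<in> charts M" and p: "p \<in> chart_img c"
  shows "geo_force c p a \<bullet> w =
     frechet_derivative (\<lambda>q. metric_coord M c q a w) (at p) a -
     frechet_derivative (\<lambda>q. metric_coord M c q a a) (at p) w / 2"
proof -
  have dma: "dmetric c i j a p = (\<Sum>k\<in>Basis. (a \<bullet> k) * dmetric c i j k p)" for i j a
    by (rule linear_real_basis[OF dmetric_linear[OF c p]])
  have 1: "frechet_derivative (\<lambda>q. metric_coord M c q a w) (at p) a =
     (\<Sum>j\<in>Basis. \<Sum>i\<in>Basis. \<Sum>k\<in>Basis. (w \<bullet> j) * ((a \<bullet> i) * (a \<bullet> k) * dmetric c i j k p))"
    unfolding metric_coord_deriv_expand[OF c p] dma[of _ _ a] sum_distrib_left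
    by (subst sum.swap) (simp add: mult_ac)
  have 2: "frechet_derivative (\<lambda>q. metric_coord M c q a a) (at p) w =
     (\<Sum>j\<in>Basis. \<Sum>i\<in>Basis. \<Sum>k\<in>Basis. (w \<bullet> j) * ((a \<bullet> i) * (a \<bullet> k) * dmetric c i k j p))"
  proof -
    have "frechet_derivative (\<lambda>q. metric_coord M c q a a) (at p) w =
      (\<Sum>i\<in>Basis. \<Sum>j\<in>Basis. \<Sum>k\<in>Basis. (w \<bullet> j) * ((a \<bullet> i) * (a \<bullet> k) * dmetric c i k j p))"
      unfolding metric_coord_deriv_expand[OF c p] dma[of _ _ w] sum_distrib_left
      by (rule sum.cong[OF refl], subst sum.swap) (simp add: mult_ac)
    then show ?thesis by (subst sum.swap) simp
  qed
  have "geo_force c p a \<bullet> w = (\<Sum>j\<in>Basis. \<Sum>i\<in>Basis. \<Sum>k\<in>Basis.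
     (w \<bullet> j) * ((a \<bullet> i) * (a \<bullet> k) * (dmetric c i j k p - dmetric c i k j p / 2)))"
    unfolding geo_force_def inner_sum_left inner_scaleR_left sum_distrib_left sum_distrib_right
    by (simp add: mult_ac inner_commute[of _ w])
  also have "\<dots> = (\<Sum>j\<in>Basis. \<Sum>i\<in>Basis. \<Sum>k\<in>Basis. (w \<bullet> j) * ((a \<bullet> i) * (a \<bullet> k) * dmetric c i j k p)) -
     (\<Sum>j\<in>Basis. \<Sum>i\<in>Basis. \<Sum>k\<in>Basis. (w \<bullet> j) * ((a \<bullet> i) * (a \<bullet> k) * dmetric c i k j p)) / 2"
    unfolding sum_divide_distrib sum_subtractf[symmetric]
    by (intro sum.cong refl) (simp add: algebra_simps)
  finally show ?thesis using 1 2 by simp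
qed

text \<open>Unlike \<open>christoffel\<close>, \<open>geo_force\<close> is an explicit expression:
  quadratic in the velocity, with first derivatives of the smooth metric as coefficients.\<close>

lemma lipschitz_near_geo_force:
  assumes "c \<in> charts M" "p \<in> chart_img c"
  shows "lipschitz_near (p, a) (\<lambda>z. geo_force c (fst z) (snd z))"
proof -
  have snd: "lipschitz_near (p, a) (\<lambda>z. snd z \<bullet> i)" for i :: 'e
    by (rule lipschitz_near_bounded_linear)
      (intro bounded_linear_compose[OF bounded_linear_inner_left] bounded_linear_snd)
  have dm: "lipschitz_near (p, a) (\<lambda>z. dmetric c i j k (fst z) - dmetric c i k j (fst z) / 2)" for i j k
  proof -
    have "lipschitz_near (p, a) (\<lambda>z. dmetric c i j k (fst z) + (-1/2) * dmetric c i k j (fst z))"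
      using lipschitz_near_dmetric[OF assms]
      by (intro lipschitz_near_add lipschitz_near_mult lipschitz_near_const
          lipschitz_near_fst[where f = "dmetric c i j k"] lipschitz_near_fst[where f = "dmetric c i k j"]) auto
    then show ?thesis by simp
  qed
  show ?thesis
    unfolding geo_force_def
    by (intro lipschitz_near_sum lipschitz_near_scaleR lipschitz_near_mult lipschitz_near_const snd dm finite_Basis)
qed

text \<open>Equal arguments suffice, since the geodesic equation evaluates the symbols on the
  velocity twice.\<close>

lemma metric_christoffel:
  assumes c: "c \<in> charts M" and p: "p \<in> chart_img c"
  shows "metric_coord M c p (christoffel M c p a a) w = geo_force c p a \<bullet> w"
proof -
  have "linear (\<lambda>w. geo_force c p a \<bullet> w)"
    by (rule bounded_linear.linear) (rule bounded_linear_inner_right)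
  from theI'[OF metric_coord_Riesz[OF c p this]]
  have "metric_coord M c p (THE e. \<forall>w. metric_coord M c p e w = geo_force c p a \<bullet> w) w = geo_force c p a \<bullet> w"
    by blast
  \<comment> \<open>For equal arguments the first two derivatives in the definition of
    \<open>christoffel\<close> coincide, and half of their sum is the first term of
    \<open>geo_force_inner\<close>.\<close>
  moreover have "christoffel M c p a a = (THE e. \<forall>w. metric_coord M c p e w = geo_force c p a \<bullet> w)"
    unfolding christoffel_def geo_force_inner[OF c p] by (simp add: diff_divide_distrib)
  ultimately show ?thesis by simp
qed

section \<open>Local estimates for the metric and the Christoffel symbols\<close>

lemma metric_coord_locally_lipschitz:
  assumes c: "c \<in> charts M" and p: "p \<in> chart_img c"
  shows "\<exists>r>0. \<exists>K\<ge>0. ball p r \<subseteq> chart_img c \<and> (\<forall>q\<in>ball p r. \<forall>q'\<in>ball p r. \<forall>a b.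
     \<bar>metric_coord M c q a b - metric_coord M c q' a b\<bar> \<le> K * dist q q' * norm a * norm b)"
proof -
  have "\<forall>ij. \<exists>e>0. \<exists>K. K-lipschitz_on (ball p e) (\<lambda>q. metric_coord M c q (fst ij) (snd ij))"
    using lipschitz_near_metric_coord[OF c p] unfolding lipschitz_near_def by blast
  then obtain e K where e: "\<And>ij. e ij > 0"
    and K: "\<And>ij. (K ij)-lipschitz_on (ball p (e ij)) (\<lambda>q. metric_coord M c q (fst ij) (snd ij))"
    by metis
  obtain r0 where r0: "r0 > 0" "ball p r0 \<subseteq> chart_img c"
    using chart_homeo(2)[OF c] p open_contains_ball by blast
  let ?BB = "Basis \<times> Basis :: ('e \<times> 'e) set"
  \<comment> \<open>One radius and one constant serve all \<open>a\<close> and \<open>b\<close>,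
    because by bilinearity only the finitely many coefficients on basis pairs matter.\<close>
  define r where "r = Min (insert r0 (e ` ?BB))"
  have rr: "r > 0" unfolding r_def using r0 e by (subst Min_gr_iff) auto
  have rr0: "r \<le> r0" unfolding r_def by (intro Min_le) auto
  have re: "r \<le> e ij" if "ij \<in> ?BB" for ij
    unfolding r_def using that by (intro Min_le) auto
  define KK where "KK = (\<Sum>i\<in>Basis. \<Sum>j\<in>Basis. K (i, j))"
  have Kpos: "K ij \<ge> 0" for ij using lipschitz_on_nonneg[OF K] .
  have "\<bar>metric_coord M c q a b - metric_coord M c q' a b\<bar> \<le> KK * dist q q' * norm a * norm b"
    if q: "q \<in> ball p r" and q': "q' \<in> ball p r" for q q' a b
  proof -
    have img: "q \<in> chart_img c" "q' \<in> chart_img c" using q q' r0 rr0 by auto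
    have "metric_coord M c q a b - metric_coord M c q' a b =
      (\<Sum>i\<in>Basis. \<Sum>j\<in>Basis. (a \<bullet> i) * (b \<bullet> j) * (metric_coord M c q i j - metric_coord M c q' i j))"
      unfolding metric_coord_expand[OF c img(1), of a b] metric_coord_expand[OF c img(2), of a b]
      by (simp add: sum_subtractf right_diff_distrib)
    then have "\<bar>metric_coord M c q a b - metric_coord M c q' a b\<bar> \<le>
      (\<Sum>i\<in>Basis. \<Sum>j\<in>Basis. \<bar>(a \<bullet> i) * (b \<bullet> j) * (metric_coord M c q i j - metric_coord M c q' i j)\<bar>)"
      by (auto intro!: order_trans[OF sum_abs] sum_mono)
    also have "\<dots> \<le> (\<Sum>i\<in>Basis. \<Sum>j\<in>Basis. (norm a * norm b) * (K (i, j) * dist q q'))"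
    proof (intro sum_mono)
      fix i j :: 'e assume ij: "i \<in> Basis" "j \<in> Basis"
      have "\<bar>metric_coord M c q i j - metric_coord M c q' i j\<bar> \<le> K (i, j) * dist q q'"
        using lipschitz_onD[OF K[of "(i, j)"], of q q'] re[of "(i, j)"] q q' ij
        by (simp add: dist_real_def)
      then show "\<bar>(a \<bullet> i) * (b \<bullet> j) * (metric_coord M c q i j - metric_coord M c q' i j)\<bar> \<le>
         (norm a * norm b) * (K (i, j) * dist q q')"
        unfolding abs_mult using ij Basis_le_norm by (intro mult_mono) auto
    qed
    also have "\<dots> = KK * dist q q' * norm a * norm b"
      unfolding KK_def sum_distrib_right by (simp add: mult_ac)
    finally show ?thesis .
  qed
  moreover have "KK \<ge> 0" unfolding KK_def using Kpos by (intro sum_nonneg)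
  moreover have "ball p r \<subseteq> chart_img c" using r0 rr0 by auto
  ultimately show ?thesis using rr by blast
qed

text \<open>Only the bounds at the centre need compactness of the unit sphere; nearby points follow by
  Lipschitz continuity of the coefficients.\<close>

lemma metric_coord_locally_comparable:
  assumes c: "c \<in> charts M" and p: "p \<in> chart_img c"
  shows "\<exists>r>0. \<exists>\<mu>>0. \<exists>B>0. ball p r \<subseteq> chart_img c \<and> (\<forall>q\<in>ball p r. \<forall>a.
     \<mu> * (norm a)\<^sup>2 \<le> metric_coord M c q a a \<and> metric_coord M c q a a \<le> B * (norm a)\<^sup>2)"
proof -
  obtain r K where r: "r > 0" "ball p r \<subseteq> chart_img c" and K: "K \<ge> 0"
    "\<And>q q' a b. q \<in> ball p r \<Longrightarrow> q' \<in> ball p r \<Longrightarrow>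
       \<bar>metric_coord M c q a b - metric_coord M c q' a b\<bar> \<le> K * dist q q' * norm a * norm b"
    using metric_coord_locally_lipschitz[OF c p] by blast
  let ?Q = "\<lambda>a. metric_coord M c p a a"
  have Qeq: "?Q = (\<lambda>a. \<Sum>i\<in>Basis. \<Sum>j\<in>Basis. (a \<bullet> i) * (a \<bullet> j) * metric_coord M c p i j)"
    by (rule ext) (rule metric_coord_expand[OF c p])
  have cont: "continuous_on (sphere 0 1) ?Q"
    unfolding Qeq by (intro continuous_intros)
  have ne: "sphere (0::'e) 1 \<noteq> {}" by simp
  obtain s where s: "s \<in> sphere 0 1" "\<And>a. a \<in> sphere 0 1 \<Longrightarrow> ?Q s \<le> ?Q a"
    using continuous_attains_inf[OF compact_sphere ne cont] by blast
  obtain s' where s': "s' \<in> sphere 0 1" "\<And>a. a \<in> sphere 0 1 \<Longrightarrow> ?Q a \<le> ?Q s'"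
    using continuous_attains_sup[OF compact_sphere ne cont] by blast
  define m where "m = ?Q s"
  have m: "m > 0" unfolding m_def using s(1) by (intro metric_coord_pos[OF c p]) auto
  define m' where "m' = ?Q s'"
  have m': "m' > 0" unfolding m'_def using s'(1) by (intro metric_coord_pos[OF c p]) auto
  have centre: "m * (norm a)\<^sup>2 \<le> ?Q a \<and> ?Q a \<le> m' * (norm a)\<^sup>2" for a
  proof (cases "a = 0")
    case True
    then show ?thesis using linear_0[OF metric_coord_linear(1)[OF c p]] by simp
  next
    case False
    define u where "u = (1 / norm a) *\<^sub>R a"
    have u: "u \<in> sphere 0 1" using False by (simp add: u_def)
    have a: "a = norm a *\<^sub>R u" using False by (simp add: u_def)
    have "?Q a = (norm a)\<^sup>2 * ?Q u"
      by (subst (1 2) a)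
        (simp add: metric_coord_scale[OF c p] metric_coord_sym[OF c p, of u "norm a *\<^sub>R u"] power2_eq_square)
    then show ?thesis
      using s(2)[OF u] s'(2)[OF u] mult_left_mono[of _ _ "(norm a)\<^sup>2"]
      by (simp add: m_def m'_def mult.commute)
  qed
  \<comment> \<open>Within this radius the form moves by at most \<open>m / 2\<close> times the
    squared norm, half of its lower bound at the centre.\<close>
  define \<rho> where "\<rho> = min r (m / (2 * (K + 1)))"
  have \<rho>: "\<rho> > 0" "\<rho> \<le> r" using r m K(1) by (auto simp: \<rho>_def)
  have "(m / 2) * (norm a)\<^sup>2 \<le> metric_coord M c q a a \<and> metric_coord M c q a a \<le> (m' + m) * (norm a)\<^sup>2"
    if q: "q \<in> ball p \<rho>" for q a
  proof -
    have d: "dist q p \<le> m / (2 * (K + 1))" using q by (simp add: \<rho>_def dist_commute)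
    have "K * dist q p \<le> (K + 1) * (m / (2 * (K + 1)))"
      using d K(1) by (intro mult_mono) auto
    also have "\<dots> = m / 2" using K(1) by (simp add: field_simps)
    finally have "K * dist q p * (norm a)\<^sup>2 \<le> (m / 2) * (norm a)\<^sup>2"
      by (rule mult_right_mono) simp
    moreover have "\<bar>metric_coord M c q a a - ?Q a\<bar> \<le> K * dist q p * (norm a)\<^sup>2"
      using K(2)[of q p a a] q \<rho> r by (simp add: power2_eq_square mult.assoc)
    ultimately have "\<bar>metric_coord M c q a a - ?Q a\<bar> \<le> (m / 2) * (norm a)\<^sup>2" by linarith
    moreover have "0 \<le> m * (norm a)\<^sup>2" using m by simp
    ultimately show ?thesis
      using conjunct1[OF centre[of a]] conjunct2[OF centre[of a]]
      unfolding distrib_right times_divide_eq_left by (intro conjI) linarith+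
  qed
  moreover have "ball p \<rho> \<subseteq> chart_img c" using r \<rho> by auto
  moreover have "m / 2 > 0" "m' + m > 0" using m m' by auto
  ultimately show ?thesis using \<rho>(1) by blast
qed

text \<open>Coercivity replaces the inverse metric. For the difference \<open>d\<close> of two
  values, the metric at the first point, applied to \<open>d\<close> twice, is at least
  \<open>\<mu> * (norm d)\<^sup>2\<close>. It also splits into the difference of the forces tested
  with \<open>d\<close>, and the change of the metric between the two points tested with the second
  value and \<open>d\<close>. Both parts are at most a multiple of
  \<open>dist z1 z2 * norm d\<close>, and one factor \<open>norm d\<close> cancels. The second part
  requires the values to be bounded, which follows from coercivity in the same way.\<close>

lemma lipschitz_near_christoffel:
  assumes c: "c \<in> charts M" and p: "p \<in> chart_img c"
  shows "lipschitz_near (p, a) (\<lambda>z. christoffel M c (fst z) (snd z) (snd z))"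
proof -
  let ?\<Gamma> = "\<lambda>z. christoffel M c (fst z) (snd z) (snd z)"
  let ?S = "\<lambda>z. geo_force c (fst z) (snd z)"
  obtain r K where r: "r > 0" "ball p r \<subseteq> chart_img c" and K: "K \<ge> 0"
    "\<And>q q' a b. q \<in> ball p r \<Longrightarrow> q' \<in> ball p r \<Longrightarrow>
       \<bar>metric_coord M c q a b - metric_coord M c q' a b\<bar> \<le> K * dist q q' * norm a * norm b"
    using metric_coord_locally_lipschitz[OF c p] by blast
  obtain r2 \<mu> where r2: "r2 > 0" and \<mu>: "\<mu> > 0"
    "\<And>q a. q \<in> ball p r2 \<Longrightarrow> \<mu> * (norm a)\<^sup>2 \<le> metric_coord M c q a a"
    using metric_coord_locally_comparable[OF c p] by blast
  obtain r3 KS where r3: "r3 > 0" and KS: "KS-lipschitz_on (ball (p, a) r3) ?S"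
    using lipschitz_near_geo_force[OF c p, of a] unfolding lipschitz_near_def by blast
  obtain r4 BS where r4: "r4 > 0" and BS: "\<And>z. z \<in> ball (p, a) r4 \<Longrightarrow> norm (?S z) \<le> BS"
    using lipschitz_near_bounded[OF lipschitz_near_geo_force[OF c p, of a]] by blast
  define \<rho> where "\<rho> = min (min r r2) (min r3 r4)"
  have \<rho>: "\<rho> > 0" using r r2 r3 r4 by (simp add: \<rho>_def)
  have fst_ball: "fst z \<in> ball p r \<and> fst z \<in> ball p r2 \<and> z \<in> ball (p, a) r3 \<and> z \<in> ball (p, a) r4"
    if "z \<in> ball (p, a) \<rho>" for z
    using that dist_fst_le[of "(p, a)" z] by (auto simp: \<rho>_def)
  have cancel: "n \<le> B / \<mu>" if "\<mu> * n\<^sup>2 \<le> B * n" "n \<ge> 0" "B \<ge> 0" for n B :: real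
  proof (cases "n = 0")
    case False
    then have "\<mu> * n \<le> B" using that by (simp add: power2_eq_square mult.assoc[symmetric])
    then show ?thesis using \<mu>(1) by (simp add: field_simps)
  qed (use that \<mu> in simp)
  have "norm (?S (p, a)) \<le> BS" by (rule BS) (use r4 in simp)
  then have BS0: "BS \<ge> 0" by (rule order_trans[OF norm_ge_zero])
  have KS0: "KS \<ge> 0" using lipschitz_on_nonneg[OF KS] .
  have bound: "norm (?\<Gamma> z) \<le> BS / \<mu>" if z: "z \<in> ball (p, a) \<rho>" for z
  proof (rule cancel)
    have img: "fst z \<in> chart_img c" using fst_ball[OF z] r by blast
    have "\<mu> * (norm (?\<Gamma> z))\<^sup>2 \<le> ?S z \<bullet> ?\<Gamma> z"
      using \<mu>(2)[of "fst z" "?\<Gamma> z"] fst_ball[OF z] metric_christoffel[OF c img] by simp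
    also have "\<dots> \<le> norm (?S z) * norm (?\<Gamma> z)" by (rule norm_cauchy_schwarz)
    also have "\<dots> \<le> BS * norm (?\<Gamma> z)" using BS fst_ball[OF z] by (intro mult_right_mono) auto
    finally show "\<mu> * (norm (?\<Gamma> z))\<^sup>2 \<le> BS * norm (?\<Gamma> z)" .
  qed (use BS0 in auto)
  have "((KS + K * (BS / \<mu>)) / \<mu>)-lipschitz_on (ball (p, a) \<rho>) ?\<Gamma>"
  proof (rule lipschitz_onI)
    fix z1 z2 assume z: "z1 \<in> ball (p, a) \<rho>" "z2 \<in> ball (p, a) \<rho>"
    define d where "d = ?\<Gamma> z1 - ?\<Gamma> z2"
    define e where "e = ?\<Gamma> z2"
    note b1 = fst_ball[OF z(1)] and b2 = fst_ball[OF z(2)]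
    have img: "fst z1 \<in> chart_img c" "fst z2 \<in> chart_img c" using b1 b2 r by blast+
    have "metric_coord M c (fst z1) d d =
      metric_coord M c (fst z1) (?\<Gamma> z1) d - metric_coord M c (fst z2) e d
      + (metric_coord M c (fst z2) e d - metric_coord M c (fst z1) e d)"
      using linear_diff[OF metric_coord_linear(1)[OF c img(1)], of "?\<Gamma> z1" e d]
      by (simp add: d_def e_def)
    also have "\<dots> = (?S z1 - ?S z2) \<bullet> d + (metric_coord M c (fst z2) e d - metric_coord M c (fst z1) e d)"
      using metric_christoffel[OF c img(1)] metric_christoffel[OF c img(2)]
      by (simp add: e_def inner_diff_left)
    also have "\<dots> \<le> KS * dist z1 z2 * norm d + K * dist z1 z2 * (BS / \<mu>) * norm d"
    proof (rule add_mono)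
      have "(?S z1 - ?S z2) \<bullet> d \<le> norm (?S z1 - ?S z2) * norm d" by (rule norm_cauchy_schwarz)
      also have "\<dots> \<le> KS * dist z1 z2 * norm d"
        using lipschitz_onD[OF KS, of z1 z2] b1 b2 by (intro mult_right_mono) (auto simp: dist_norm)
      finally show "(?S z1 - ?S z2) \<bullet> d \<le> KS * dist z1 z2 * norm d" .
      have "metric_coord M c (fst z2) e d - metric_coord M c (fst z1) e d
         \<le> K * dist (fst z2) (fst z1) * norm e * norm d"
        using K(2)[of "fst z2" "fst z1" e d] b1 b2 by linarith
      also have "\<dots> \<le> K * dist z1 z2 * (BS / \<mu>) * norm d"
        using K(1) bound[OF z(2)] dist_fst_le[of z2 z1] BS0 \<mu>(1)
        by (intro mult_right_mono mult_mono) (auto simp: e_def dist_commute)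
      finally show "metric_coord M c (fst z2) e d - metric_coord M c (fst z1) e d
        \<le> K * dist z1 z2 * (BS / \<mu>) * norm d" .
    qed
    finally have "\<mu> * (norm d)\<^sup>2 \<le> ((KS + K * (BS / \<mu>)) * dist z1 z2) * norm d"
      using \<mu>(2)[of "fst z1" d] b1 by (simp add: algebra_simps)
    from cancel[OF this] show "dist (?\<Gamma> z1) (?\<Gamma> z2) \<le> (KS + K * (BS / \<mu>)) / \<mu> * dist z1 z2"
      using KS0 K(1) BS0 \<mu>(1) by (simp add: d_def dist_norm)
  qed (use KS0 K(1) BS0 \<mu>(1) in simp)
  then show ?thesis by (rule lipschitz_nearI[OF \<rho>])
qed

end

section \<open>Geodesics\<close>

lemma continuous_on_stays_near:
  fixes \<gamma> :: "real \<Rightarrow> 'a::topological_space"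
  assumes "continuous_on I \<gamma>" "t \<in> I" "open U" "\<gamma> t \<in> U"
  shows "\<exists>d>0. \<forall>s\<in>I. \<bar>s - t\<bar> < d \<longrightarrow> \<gamma> s \<in> U"
proof -
  have "\<forall>\<^sub>F s in at t within I. \<gamma> s \<in> U"
    using assms topological_tendstoD unfolding continuous_on_def by blast
  then obtain d where "d > 0" "\<And>s. s \<in> I \<Longrightarrow> s \<noteq> t \<Longrightarrow> dist s t < d \<Longrightarrow> \<gamma> s \<in> U"
    unfolding eventually_at by blast
  then show ?thesis
    using assms(4) by (intro exI[of _ d]) (auto simp: dist_real_def)
qed

text \<open>Product rule for the metric along a curve in coordinates. The three sums are kept apart
  because \<open>metric_coord_deriv_expand\<close> and \<open>metric_coord_expand\<close> fold each
  of them back.\<close>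

lemma quadratic_form_has_vector_derivative:
  fixes y a :: "real \<Rightarrow> 'e::euclidean_space" and m :: "'e \<Rightarrow> 'e \<Rightarrow> 'e \<Rightarrow> real"
  assumes m: "\<And>i j. ((\<lambda>t. m (y t) i j) has_vector_derivative d i j) (at t within I)"
    and a: "(a has_vector_derivative a') (at t within I)"
  shows "((\<lambda>t. \<Sum>i\<in>Basis. \<Sum>j\<in>Basis. (a t \<bullet> i) * (a t \<bullet> j) * m (y t) i j) has_vector_derivative
     ((\<Sum>i\<in>Basis. \<Sum>j\<in>Basis. (a t \<bullet> i) * (a t \<bullet> j) * d i j) +
      ((\<Sum>i\<in>Basis. \<Sum>j\<in>Basis. (a' \<bullet> i) * (a t \<bullet> j) * m (y t) i j) +
       (\<Sum>i\<in>Basis. \<Sum>j\<in>Basis. (a t \<bullet> i) * (a' \<bullet> j) * m (y t) i j)))) (at t within I)"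
proof -
  have ai: "((\<lambda>t. a t \<bullet> i) has_vector_derivative a' \<bullet> i) (at t within I)" for i
    using bounded_linear.has_vector_derivative[OF bounded_linear_inner_left a] .
  have "((\<lambda>t. \<Sum>i\<in>Basis. \<Sum>j\<in>Basis. (a t \<bullet> i) * (a t \<bullet> j) * m (y t) i j) has_vector_derivative
     (\<Sum>i\<in>Basis. \<Sum>j\<in>Basis. (a t \<bullet> i) * (a t \<bullet> j) * d i j +
       ((a t \<bullet> i) * (a' \<bullet> j) + (a' \<bullet> i) * (a t \<bullet> j)) * m (y t) i j)) (at t within I)"
    by (intro has_vector_derivative_sum has_vector_derivative_mult ai m)
  then show ?thesis
    by (simp add: sum.distrib distrib_right add_ac)
qed

context riem_mfd
begin

lemma chart_change_derivative:
  fixes \<gamma> :: "real \<Rightarrow> 'm"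
  assumes cont: "continuous_on I \<gamma>" and t: "t \<in> I"
    and c: "c \<in> charts_at M (\<gamma> t)" and c': "c' \<in> charts_at M (\<gamma> t)"
    and der: "((chart_map c \<circ> \<gamma>) has_vector_derivative u) (at t within I)"
  shows "((chart_map c' \<circ> \<gamma>) has_vector_derivative
    frechet_derivative (transition c c') (at (chart_map c (\<gamma> t))) u) (at t within I)"
proof -
  note cD = charts_at_D[OF c]
  obtain d where d: "d > 0" "\<And>s. s \<in> I \<Longrightarrow> \<bar>s - t\<bar> < d \<Longrightarrow> \<gamma> s \<in> chart_dom c"
    using continuous_on_stays_near[OF cont t chart_homeo(1)[OF cD(1)] cD(2)] by blast
  have "((transition c c' \<circ> (chart_map c \<circ> \<gamma>)) has_vector_derivative
     frechet_derivative (transition c c') (at (chart_map c (\<gamma> t))) u) (at t within I)"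
    by (rule vector_derivative_diff_chain_within[OF der])
      (simp add: has_derivative_at_withinI transition_has_derivative[OF c c'])
  then show ?thesis
    by (rule has_vector_derivative_transform_within[OF _ d(1) t])
      (use d cD in \<open>auto simp: dist_real_def\<close>)
qed

lemma velocity_chart:
  assumes "a < b" "t \<in> {a..b}" "c \<in> charts_at M (\<gamma> t)"
    "((chart_map c \<circ> \<gamma>) has_vector_derivative u) (at t within {a..b})"
  shows "velocity M {a..b} \<gamma> t c = u"
  using assms vector_derivative_Icc by (simp add: velocity_def)

text \<open>Differentiability in a single chart is assumed; \<open>chart_change_derivative\<close>
  yields the other charts.\<close>

lemma velocity_tangent:
  fixes \<gamma> :: "real \<Rightarrow> 'm"
  assumes ab: "a < b" "t \<in> {a..b}" and cont: "continuous_on {a..b} \<gamma>"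
    and c: "c \<in> charts_at M (\<gamma> t)"
    and der: "((chart_map c \<circ> \<gamma>) has_vector_derivative u) (at t within {a..b})"
  shows "velocity M {a..b} \<gamma> t = tvec M c (\<gamma> t) u"
proof
  fix c'
  show "velocity M {a..b} \<gamma> t c' = tvec M c (\<gamma> t) u c'"
  proof (cases "c' \<in> charts_at M (\<gamma> t)")
    case True
    show ?thesis
      using velocity_chart[OF ab True chart_change_derivative[OF cont ab(2) c True der]] True
      by (simp add: tvec_def)
  qed (simp add: velocity_def tvec_def)
qed

section \<open>Uniqueness of geodesics and the exponential map\<close>

lemma geodesicD:
  assumes "geodesic M {0..1} \<gamma>"
  shows "continuous_on {0..1} \<gamma>"
    and "c \<in> charts M \<Longrightarrow> t \<in> {0..1} \<Longrightarrow> \<gamma> t \<in> chart_dom c \<Longrightarrow>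
      ((chart_map c \<circ> \<gamma>) has_vector_derivative
         vector_derivative (chart_map c \<circ> \<gamma>) (at t within {0..1})) (at t within {0..1})"
    and "c \<in> charts M \<Longrightarrow> t \<in> {0..1} \<Longrightarrow> \<gamma> t \<in> chart_dom c \<Longrightarrow>
      ((\<lambda>s. vector_derivative (chart_map c \<circ> \<gamma>) (at s within {0..1})) has_vector_derivative
         - christoffel M c (chart_map c (\<gamma> t))
             (vector_derivative (chart_map c \<circ> \<gamma>) (at t within {0..1}))
             (vector_derivative (chart_map c \<circ> \<gamma>) (at t within {0..1}))) (at t within {0..1})"
  using assms unfolding geodesic_def Let_def vector_derivative_works[symmetric] by auto

text \<open>Reduction of order: position and velocity together satisfy a first-order equation whose
  right-hand side \<open>spray\<close> is the geodesic spray in coordinates.\<close>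

definition phase :: "('m, 'e) chart \<Rightarrow> (real \<Rightarrow> 'm) \<Rightarrow> real \<Rightarrow> 'e \<times> 'e" where
  "phase c \<gamma> t = (chart_map c (\<gamma> t), vector_derivative (chart_map c \<circ> \<gamma>) (at t within {0..1}))"

definition spray :: "('m, 'e) chart \<Rightarrow> 'e \<times> 'e \<Rightarrow> 'e \<times> 'e" where
  "spray c z = (snd z, - christoffel M c (fst z) (snd z) (snd z))"

lemma phase_derivative:
  assumes "geodesic M {0..1} \<gamma>" "c \<in> charts M" "t \<in> {0..1}" "\<gamma> t \<in> chart_dom c"
  shows "(phase c \<gamma> has_vector_derivative spray c (phase c \<gamma> t)) (at t within {0..1})"
  using has_vector_derivative_Pair[OF geodesicD(2,3)[OF assms]]
  by (simp add: phase_def[abs_def] spray_def o_def)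

lemma lipschitz_near_spray:
  assumes "c \<in> charts M" "fst z \<in> chart_img c"
  shows "lipschitz_near z (spray c)"
proof -
  have "lipschitz_near (fst z, snd z) (\<lambda>z. (snd z, (-1) *\<^sub>R christoffel M c (fst z) (snd z) (snd z)))"
    by (intro lipschitz_near_Pair lipschitz_near_scaleR lipschitz_near_const
        lipschitz_near_christoffel assms lipschitz_near_bounded_linear bounded_linear_snd)
  then show ?thesis by (simp add: spray_def[abs_def])
qed

text \<open>The times at which both curves agree to first order form a set that is open by
  \<open>ode_unique_locally\<close>, closed since points are separated and velocities are
  continuous, and nonempty by the initial data; the interval is connected.\<close>

lemma geodesic_unique:
  assumes g1: "geodesic M {0..1} \<gamma>1" and g2: "geodesic M {0..1} \<gamma>2"
    and start: "\<gamma>1 0 = \<gamma>2 0" "velocity M {0..1} \<gamma>1 0 = velocity M {0..1} \<gamma>2 0"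
  shows "\<forall>t\<in>{0..1}. \<gamma>1 t = \<gamma>2 t"
proof -
  \<comment> \<open>Agreement is required in every chart, so that any chart around the common point
    may be used at a time of \<open>A\<close>.\<close>
  define A where "A = {t\<in>{0..1}. \<gamma>1 t = \<gamma>2 t \<and>
     (\<forall>c\<in>charts_at M (\<gamma>1 t). phase c \<gamma>1 t = phase c \<gamma>2 t)}"
  note cont1 = geodesicD(1)[OF g1] and cont2 = geodesicD(1)[OF g2]
  have near: "\<exists>d>0. \<forall>s\<in>{0..1}. \<bar>s - t\<bar> < d \<longrightarrow> \<gamma>1 s \<in> U \<and> \<gamma>2 s \<in> V"
    if UV: "t \<in> {0..1}" "open U" "\<gamma>1 t \<in> U" "open V" "\<gamma>2 t \<in> V" for t U V
  proof -
    obtain d1 d2 where "d1 > 0" "\<forall>s\<in>{0..1}. \<bar>s - t\<bar> < d1 \<longrightarrow> \<gamma>1 s \<in> U"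
      "d2 > 0" "\<forall>s\<in>{0..1}. \<bar>s - t\<bar> < d2 \<longrightarrow> \<gamma>2 s \<in> V"
      using continuous_on_stays_near[OF cont1 UV(1-3)] continuous_on_stays_near[OF cont2 UV(1,4,5)]
      by blast
    then show ?thesis by (intro exI[of _ "min d1 d2"]) auto
  qed
  have "openin (top_of_set {0..1}) A"
    unfolding openin_euclidean_subtopology_iff
  proof (intro conjI ballI)
    fix t assume tA: "t \<in> A"
    then have t: "t \<in> {0..1}" and eq: "\<gamma>1 t = \<gamma>2 t" by (auto simp: A_def)
    obtain c where c: "c \<in> charts_at M (\<gamma>1 t)" using charts_exist by blast
    note cD = charts_at_D[OF c]
    obtain d where d: "d > 0" and
      dom: "\<And>s. s \<in> {0..1} \<Longrightarrow> \<bar>s - t\<bar> < d \<Longrightarrow> \<gamma>1 s \<in> chart_dom c \<and> \<gamma>2 s \<in> chart_dom c"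
      using near[OF t chart_homeo(1)[OF cD(1)] cD(2) chart_homeo(1)[OF cD(1)]] eq cD(2) by auto
    have ph: "phase c \<gamma>1 t = phase c \<gamma>2 t" using tA c by (simp add: A_def)
    have lip: "lipschitz_near (phase c \<gamma>1 t) (spray c)"
      by (rule lipschitz_near_spray[OF cD(1)]) (simp add: phase_def cD(2))
    have "\<exists>\<delta>>0. \<forall>s\<in>{0..1}. \<bar>s - t\<bar> < \<delta> \<longrightarrow> phase c \<gamma>1 s = phase c \<gamma>2 s"
    proof (rule ode_unique_locally[where Y = "phase c \<gamma>1" and Z = "phase c \<gamma>2", OF lip t d _ _ ph])
      fix s assume s: "s \<in> {0..1}" "\<bar>s - t\<bar> < d"
      show "(phase c \<gamma>1 has_vector_derivative spray c (phase c \<gamma>1 s)) (at s within {0..1})"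
        "(phase c \<gamma>2 has_vector_derivative spray c (phase c \<gamma>2 s)) (at s within {0..1})"
        using dom[OF s] phase_derivative[OF g1 cD(1) s(1)] phase_derivative[OF g2 cD(1) s(1)] by blast+
    qed
    then obtain \<delta> where \<delta>: "\<delta> > 0" "\<And>s. s \<in> {0..1} \<Longrightarrow> \<bar>s - t\<bar> < \<delta> \<Longrightarrow> phase c \<gamma>1 s = phase c \<gamma>2 s"
      by blast
    have eqn: "\<gamma>1 s = \<gamma>2 s" if "s \<in> {0..1}" "\<bar>s - t\<bar> < min d \<delta>" for s
    proof -
      have "chart_map c (\<gamma>1 s) = chart_map c (\<gamma>2 s)" using \<delta>(2)[of s] that by (simp add: phase_def)
      then show ?thesis using dom[of s] that cD(1) chart_inv_map by (metis min_less_iff_conj)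
    qed
    show "\<exists>e>0. \<forall>s\<in>{0..1}. dist s t < e \<longrightarrow> s \<in> A"
    proof (intro exI[of _ "min d \<delta>"] conjI ballI impI)
      fix s assume s: "s \<in> {0..1::real}" "dist s t < min d \<delta>"
      then have st: "\<bar>s - t\<bar> < min d \<delta>" by (simp add: dist_real_def)
      \<comment> \<open>Uniqueness for the differential equation settles \<open>c\<close> only. In
        the other charts the velocities agree because the two curves coincide on a whole
        neighbourhood of \<open>s\<close>.\<close>
      have "phase c' \<gamma>1 s = phase c' \<gamma>2 s" if c': "c' \<in> charts_at M (\<gamma>1 s)" for c'
      proof -
        have "((chart_map c' \<circ> \<gamma>1) has_vector_derivative
            vector_derivative (chart_map c' \<circ> \<gamma>1) (at s within {0..1})) (at s within {0..1})"
          using geodesicD(2)[OF g1 charts_at_D(1)[OF c'] s(1) charts_at_D(2)[OF c']] .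
        then have "((chart_map c' \<circ> \<gamma>2) has_vector_derivative
            vector_derivative (chart_map c' \<circ> \<gamma>1) (at s within {0..1})) (at s within {0..1})"
        proof (rule has_vector_derivative_transform_within[where d = "min d \<delta> - \<bar>s - t\<bar>", OF _ _ s(1)])
          fix r assume r: "r \<in> {0..1}" "dist r s < min d \<delta> - \<bar>s - t\<bar>"
          then have "\<bar>r - t\<bar> < min d \<delta>" unfolding dist_real_def by linarith
          then show "(chart_map c' \<circ> \<gamma>1) r = (chart_map c' \<circ> \<gamma>2) r" using eqn[OF r(1)] by simp
        qed (use st in simp)
        from vector_derivative_Icc[OF _ s(1) this] show ?thesis
          using eqn[OF s(1) st] by (simp add: phase_def)
      qed
      then show "s \<in> A" using s(1) eqn[OF s(1) st] by (simp add: A_def)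
    qed (use d \<delta> in auto)
  qed (auto simp: A_def)
  moreover have "openin (top_of_set {0..1}) ({0..1} - A)"
    unfolding openin_euclidean_subtopology_iff
  proof (intro conjI ballI)
    fix t assume "t \<in> {0..1} - A"
    then have t: "t \<in> {0..1}" and tA: "t \<notin> A" by auto
    show "\<exists>e>0. \<forall>s\<in>{0..1}. dist s t < e \<longrightarrow> s \<in> {0..1} - A"
    proof (cases "\<gamma>1 t = \<gamma>2 t")
      case False
      from hausdorff[OF this] obtain U V where UV: "open U" "open V" "\<gamma>1 t \<in> U" "\<gamma>2 t \<in> V" "U \<inter> V = {}"
        by blast
      obtain d where d: "d > 0" "\<And>s. s \<in> {0..1} \<Longrightarrow> \<bar>s - t\<bar> < d \<Longrightarrow> \<gamma>1 s \<in> U \<and> \<gamma>2 s \<in> V"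
        using near[OF t UV(1,3,2,4)] by blast
      have "s \<notin> A" if "s \<in> {0..1}" "dist s t < d" for s
        using d(2)[of s] that UV(5) by (auto simp: A_def dist_real_def)
      then show ?thesis using d(1) by (intro exI[of _ d]) blast
    next
      case True
      then obtain c where c: "c \<in> charts_at M (\<gamma>1 t)" and ne: "phase c \<gamma>1 t \<noteq> phase c \<gamma>2 t"
        using t tA by (auto simp: A_def)
      note cD = charts_at_D[OF c]
      obtain d where d: "d > 0" and
        dom: "\<And>s. s \<in> {0..1} \<Longrightarrow> \<bar>s - t\<bar> < d \<Longrightarrow> \<gamma>1 s \<in> chart_dom c \<and> \<gamma>2 s \<in> chart_dom c"
        using near[OF t chart_homeo(1)[OF cD(1)] cD(2) chart_homeo(1)[OF cD(1)]] True cD(2) by auto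
      \<comment> \<open>Common position but different velocity: the difference of the phases is
        continuous at \<open>t\<close> and nonzero there, so it does not vanish nearby.\<close>
      let ?n = "\<lambda>s. phase c \<gamma>1 s - phase c \<gamma>2 s"
      have "(?n has_vector_derivative spray c (phase c \<gamma>1 t) - spray c (phase c \<gamma>2 t)) (at t within {0..1})"
        using dom[OF t] d by (intro has_vector_derivative_diff phase_derivative g1 g2 cD(1) t) auto
      then have "continuous (at t within {0..1}) ?n" by (rule has_vector_derivative_continuous)
      then obtain \<delta> where \<delta>: "\<delta> > 0" "\<And>s. s \<in> {0..1} \<Longrightarrow> dist s t < \<delta> \<Longrightarrow> dist (?n s) (?n t) < norm (?n t)"
        unfolding continuous_within_eps_delta using ne by (metis right_minus_eq zero_less_norm_iff)
      have "s \<notin> A" if "s \<in> {0..1}" "dist s t < min d \<delta>" for s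
      proof
        assume "s \<in> A"
        moreover have "c \<in> charts_at M (\<gamma>1 s)"
          using dom[of s] that cD(1) by (simp add: charts_at_def dist_real_def)
        ultimately have "?n s = 0" by (simp add: A_def)
        then have "dist (?n s) (?n t) = norm (?n t)" by (simp only: dist_0_norm)
        then show False using \<delta>(2)[of s] that by simp
      qed
      then show ?thesis using d \<delta>(1) by (intro exI[of _ "min d \<delta>"]) auto
    qed
  qed auto
  then have "closedin (top_of_set {0..1}) A"
    by (auto simp: closedin_def A_def)
  moreover have "0 \<in> A"
  proof -
    have "phase c \<gamma>1 0 = phase c \<gamma>2 0" if "c \<in> charts_at M (\<gamma>1 0)" for c
      using fun_cong[OF start(2), of c] start(1) that by (simp add: velocity_def phase_def)
    then show ?thesis using start(1) by (simp add: A_def)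
  qed
  moreover have "connected {0..1::real}" by simp
  ultimately have "A = {0..1}" unfolding connected_clopen by blast
  then show ?thesis by (auto simp: A_def)
qed

lemma rexp_geodesic:
  assumes "geodesic M {0..1} \<gamma>"
  shows "rexp M (\<gamma> 0) (velocity M {0..1} \<gamma> 0) = \<gamma> 1"
  unfolding rexp_def
proof (rule the_equality)
  fix y
  assume "\<exists>\<gamma>'. geodesic M {0..1} \<gamma>' \<and> \<gamma>' 0 = \<gamma> 0 \<and>
    velocity M {0..1} \<gamma>' 0 = velocity M {0..1} \<gamma> 0 \<and> \<gamma>' 1 = y"
  then obtain \<gamma>' where "geodesic M {0..1} \<gamma>'" "\<gamma>' 0 = \<gamma> 0"
    "velocity M {0..1} \<gamma>' 0 = velocity M {0..1} \<gamma> 0" and y: "\<gamma>' 1 = y" by blast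
  from geodesic_unique[OF this(1) assms this(2,3)] y show "y = \<gamma> 1" by simp
next
  show "\<exists>\<gamma>'. geodesic M {0..1} \<gamma>' \<and> \<gamma>' 0 = \<gamma> 0 \<and>
    velocity M {0..1} \<gamma>' 0 = velocity M {0..1} \<gamma> 0 \<and> \<gamma>' 1 = \<gamma> 1"
    by (intro exI[of _ \<gamma>] conjI assms refl)
qed

text \<open>This homogeneity of degree two is what keeps \<open>\<gamma> (s * t)\<close> a geodesic,
  as its acceleration carries the factor \<open>s\<^sup>2\<close>.\<close>

lemma christoffel_scale:
  assumes c: "c \<in> charts M" and p: "p \<in> chart_img c"
  shows "christoffel M c p (s *\<^sub>R a) (s *\<^sub>R a) = s\<^sup>2 *\<^sub>R christoffel M c p a a"
proof -
  have force: "geo_force c p (s *\<^sub>R a) = s\<^sup>2 *\<^sub>R geo_force c p a"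
    unfolding geo_force_def scaleR_sum_right scaleR_scaleR sum_distrib_left
    by (simp add: power2_eq_square mult_ac)
  have "linear (\<lambda>w. geo_force c p (s *\<^sub>R a) \<bullet> w)"
    by (rule bounded_linear.linear) (rule bounded_linear_inner_right)
  from metric_coord_Riesz[OF c p this]
  show ?thesis
    using metric_christoffel[OF c p] metric_coord_scale[OF c p] force
    by (metis inner_scaleR_left)
qed

text \<open>Includes \<open>s = 0\<close>, the constant geodesic, because
  \<open>feasible_dirs\<close> lets \<open>t\<close> range over the closed unit interval.\<close>

lemma geodesic_restrict:
  assumes g: "geodesic M {0..1} \<gamma>" and s: "s \<in> {0..1}"
  shows "geodesic M {0..1} (\<lambda>t. \<gamma> (s * t))"
    and "velocity M {0..1} (\<lambda>t. \<gamma> (s * t)) 0 = tscale s (velocity M {0..1} \<gamma> 0)"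
proof -
  have img: "(\<lambda>t. s * t) ` {0..1} \<subseteq> {0..1}" using s by (auto intro: mult_le_one)
  have st: "s * t \<in> {0..1}" if "t \<in> {0..1}" for t using img that by blast
  have lin: "((\<lambda>t. s * t) has_vector_derivative s) (at t within {0..1})" for t
    using has_vector_derivative_mult_right[OF has_vector_derivative_id, of s] by simp
  have chain: "((\<lambda>t. f (s * t)) has_vector_derivative s *\<^sub>R f') (at t within {0..1})"
    if "(f has_vector_derivative f') (at (s * t) within {0..1})" for f :: "real \<Rightarrow> 'e" and f' t
    using vector_diff_chain_within[OF lin has_vector_derivative_within_subset[OF that img]]
    by (simp add: o_def)
  let ?y = "\<lambda>c. chart_map c \<circ> \<gamma>"
  let ?D = "\<lambda>c t. vector_derivative (?y c) (at t within {0..1})"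
  let ?z = "\<lambda>c. chart_map c \<circ> (\<lambda>t. \<gamma> (s * t))"
  let ?E = "\<lambda>c t. vector_derivative (?z c) (at t within {0..1})"
  have zy: "(?z c has_vector_derivative s *\<^sub>R ?D c (s * t)) (at t within {0..1})"
    if "c \<in> charts M" "t \<in> {0..1}" "\<gamma> (s * t) \<in> chart_dom c" for c t
    using chain[OF geodesicD(2)[OF g that(1) st[OF that(2)] that(3)]] by (simp add: o_def)
  have E: "?E c t = s *\<^sub>R ?D c (s * t)"
    if "c \<in> charts M" "t \<in> {0..1}" "\<gamma> (s * t) \<in> chart_dom c" for c t
    by (rule vector_derivative_Icc[OF _ that(2) zy[OF that]]) simp
  have cont: "continuous_on {0..1} (\<lambda>t. \<gamma> (s * t))"
    using img by (intro continuous_on_compose2[OF geodesicD(1)[OF g]] continuous_intros)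
  have acc: "(?E c has_vector_derivative - christoffel M c (?z c t) (?E c t) (?E c t)) (at t within {0..1})"
    if c: "c \<in> charts M" and t: "t \<in> {0..1}" and dom: "\<gamma> (s * t) \<in> chart_dom c" for c t
  proof -
    obtain d where d: "d > 0" "\<And>r. r \<in> {0..1} \<Longrightarrow> \<bar>r - t\<bar> < d \<Longrightarrow> \<gamma> (s * r) \<in> chart_dom c"
      using continuous_on_stays_near[OF cont t chart_homeo(1)[OF c] dom] by blast
    have "((\<lambda>t. s *\<^sub>R ?D c (s * t)) has_vector_derivative
       s *\<^sub>R (s *\<^sub>R - christoffel M c (chart_map c (\<gamma> (s * t))) (?D c (s * t)) (?D c (s * t))))
       (at t within {0..1})"
      by (rule bounded_linear.has_vector_derivative[OF bounded_linear_scaleR_right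
            chain[OF geodesicD(3)[OF g c st[OF t] dom]]])
    then have "(?E c has_vector_derivative
       s *\<^sub>R (s *\<^sub>R - christoffel M c (chart_map c (\<gamma> (s * t))) (?D c (s * t)) (?D c (s * t))))
       (at t within {0..1})"
      by (rule has_vector_derivative_transform_within[OF _ d(1) t])
        (use d E[OF c] in \<open>auto simp: dist_real_def\<close>)
    then show ?thesis
      using E[OF c t dom] christoffel_scale[OF c chart_map_img[OF dom], of s "?D c (s * t)"]
      by (simp add: power2_eq_square)
  qed
  show "geodesic M {0..1} (\<lambda>t. \<gamma> (s * t))"
    unfolding geodesic_def Let_def
    using cont acc zy differentiableI_vector by blast
  show "velocity M {0..1} (\<lambda>t. \<gamma> (s * t)) 0 = tscale s (velocity M {0..1} \<gamma> 0)"
  proof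
    fix c
    show "velocity M {0..1} (\<lambda>t. \<gamma> (s * t)) 0 c = tscale s (velocity M {0..1} \<gamma> 0) c"
      using E[of c 0] by (simp add: velocity_def tscale_def charts_at_def)
  qed
qed

text \<open>Identifies the curve of exponentials in \<open>feasible_dirs\<close> with the geodesic
  itself.\<close>

lemma rexp_scaled_geodesic:
  assumes "geodesic M {0..1} \<gamma>" "s \<in> {0..1}"
  shows "rexp M (\<gamma> 0) (tscale s (velocity M {0..1} \<gamma> 0)) = \<gamma> s"
  using rexp_geodesic[OF geodesic_restrict(1)[OF assms]] geodesic_restrict(2)[OF assms] by simp

section \<open>Speed and length of a geodesic\<close>

lemma geodesic_velocity:
  assumes "geodesic M {0..1} \<gamma>" "t \<in> {0..1}" "c \<in> charts_at M (\<gamma> t)"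
  shows "velocity M {0..1} \<gamma> t =
    tvec M c (\<gamma> t) (vector_derivative (chart_map c \<circ> \<gamma>) (at t within {0..1}))"
  by (rule velocity_tangent[OF _ assms(2) geodesicD(1)[OF assms(1)] assms(3)
        geodesicD(2)[OF assms(1) charts_at_D(1)[OF assms(3)] assms(2) charts_at_D(2)[OF assms(3)]]])
    simp

lemma geodesic_velocity_tangent:
  assumes "geodesic M {0..1} \<gamma>" "t \<in> {0..1}"
  shows "velocity M {0..1} \<gamma> t \<in> tangent_space M (\<gamma> t)"
  using geodesic_velocity[OF assms] tvec_in_tangent_space charts_exist by metis

text \<open>With \<open>a\<close> the coordinate velocity, the derivative is that of the metric
  coefficients in direction \<open>a\<close>, tested with \<open>a\<close> twice, minus twice the
  product of \<open>geo_force\<close> with \<open>a\<close>. By \<open>geo_force_inner\<close> with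
  \<open>w = a\<close>, this product is half of the first term.\<close>

lemma geodesic_speed_derivative:
  assumes g: "geodesic M {0..1} \<gamma>" and t: "t \<in> {0..1}"
  shows "((\<lambda>t. metric M (\<gamma> t) (velocity M {0..1} \<gamma> t) (velocity M {0..1} \<gamma> t))
     has_vector_derivative 0) (at t within {0..1})"
proof -
  obtain c where c: "c \<in> charts_at M (\<gamma> t)" using charts_exist by blast
  note cD = charts_at_D[OF c]
  obtain d where d: "d > 0" and dom: "\<And>r. r \<in> {0..1} \<Longrightarrow> \<bar>r - t\<bar> < d \<Longrightarrow> \<gamma> r \<in> chart_dom c"
    using continuous_on_stays_near[OF geodesicD(1)[OF g] t chart_homeo(1)[OF cD(1)] cD(2)] by blast
  define y where "y = chart_map c \<circ> \<gamma>"
  define a where "a r = vector_derivative y (at r within {0..1})" for r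
  let ?m = "metric_coord M c"
  let ?\<Gamma> = "christoffel M c (y t) (a t) (a t)"
  have img: "y r \<in> chart_img c" if "r \<in> {0..1}" "\<bar>r - t\<bar> < d" for r
    using dom[OF that] by (simp add: y_def)
  have yt: "y t \<in> chart_img c" using img[OF t] d by simp
  have y': "(y has_vector_derivative a t) (at t within {0..1})"
    unfolding a_def y_def by (rule geodesicD(2)[OF g cD(1) t cD(2)])
  have a': "(a has_vector_derivative - ?\<Gamma>) (at t within {0..1})"
    using geodesicD(3)[OF g cD(1) t cD(2)] unfolding a_def[abs_def] y_def by simp
  have mder: "((\<lambda>t. ?m (y t) i j) has_vector_derivative dmetric c i j (a t) (y t)) (at t within {0..1})" for i j
    using vector_derivative_diff_chain_within[OF y' has_derivative_at_withinI[OF metric_coord_has_derivative[OF cD(1) yt]]]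
    unfolding dmetric_def by (simp add: o_def)
  let ?q = "\<lambda>t. \<Sum>i\<in>Basis. \<Sum>j\<in>Basis. (a t \<bullet> i) * (a t \<bullet> j) * ?m (y t) i j"
  have "(?q has_vector_derivative
      frechet_derivative (\<lambda>q. ?m q (a t) (a t)) (at (y t)) (a t) +
      (?m (y t) (- ?\<Gamma>) (a t) + ?m (y t) (a t) (- ?\<Gamma>))) (at t within {0..1})"
    using quadratic_form_has_vector_derivative[OF mder a']
    unfolding metric_coord_deriv_expand[OF cD(1) yt] metric_coord_expand[OF cD(1) yt, of "- ?\<Gamma>" "a t"]
      metric_coord_expand[OF cD(1) yt, of "a t" "- ?\<Gamma>"] .
  moreover have "?m (y t) (- ?\<Gamma>) (a t) = - (geo_force c (y t) (a t) \<bullet> a t)"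
    using metric_coord_scale[OF cD(1) yt, of "-1" ?\<Gamma> "a t"] metric_christoffel[OF cD(1) yt, of "a t" "a t"]
    by simp
  moreover have "?m (y t) (a t) (- ?\<Gamma>) = ?m (y t) (- ?\<Gamma>) (a t)"
    by (rule metric_coord_sym[OF cD(1) yt])
  ultimately have "(?q has_vector_derivative 0) (at t within {0..1})"
    using geo_force_inner[OF cD(1) yt, of "a t" "a t"] by simp
  then show ?thesis
  proof (rule has_vector_derivative_transform_within[OF _ d t])
    fix r assume r: "r \<in> {0..1::real}" "dist r t < d"
    then have rd: "\<bar>r - t\<bar> < d" by (simp add: dist_real_def)
    have cr: "c \<in> charts_at M (\<gamma> r)" using dom[OF r(1) rd] cD(1) by (simp add: charts_at_def)
    have "metric M (\<gamma> r) (velocity M {0..1} \<gamma> r) (velocity M {0..1} \<gamma> r) = ?m (y r) (a r) (a r)"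
      using metric_eq_coord[OF cr geodesic_velocity_tangent[OF g r(1)] geodesic_velocity_tangent[OF g r(1)]]
        geodesic_velocity[OF g r(1) cr] tvec_chart[OF cr]
      by (simp add: y_def a_def)
    then show "?q r = metric M (\<gamma> r) (velocity M {0..1} \<gamma> r) (velocity M {0..1} \<gamma> r)"
      using metric_coord_expand[OF cD(1) img[OF r(1) rd], of "a r" "a r"] by simp
  qed
qed

text \<open>Constancy of the speed turns minimality of the length into the condition on
  \<open>tnorm\<close> in \<open>feasible_dirs\<close>.\<close>

lemma geodesic_length:
  assumes g: "geodesic M {0..1} \<gamma>"
  shows "curve_length M \<gamma> = tnorm M (\<gamma> 0) (velocity M {0..1} \<gamma> 0)"
proof -
  let ?\<phi> = "\<lambda>t. metric M (\<gamma> t) (velocity M {0..1} \<gamma> t) (velocity M {0..1} \<gamma> t)"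
  have const: "?\<phi> t = ?\<phi> 0" if "t \<in> {0..1}" for t
  proof (rule has_derivative_zero_unique[of "{0..1}" ?\<phi>])
    show "(?\<phi> has_derivative (\<lambda>h. 0)) (at r within {0..1})" if "r \<in> {0..1}" for r
      using geodesic_speed_derivative[OF g that] by (simp add: has_vector_derivative_def)
  qed (use that in auto)
  let ?v = "tnorm M (\<gamma> 0) (velocity M {0..1} \<gamma> 0)"
  have "((\<lambda>_. ?v) has_integral ?v) {0..1::real}"
    using has_integral_const_real[of ?v 0 1] by simp
  then have "((\<lambda>t. tnorm M (\<gamma> t) (velocity M {0..1} \<gamma> t)) has_integral ?v) {0..1::real}"
    by (rule has_integral_eq[rotated]) (simp only: tnorm_def const)
  then show ?thesis unfolding curve_length_def by (rule integral_unique)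
qed

end

section \<open>Length and distance\<close>

text \<open>Induction on the break points: one in the open interval splits it, any other is
  dropped.\<close>

lemma integrable_of_pieces:
  fixes h :: "real \<Rightarrow> real"
  assumes "finite S" "a \<le> b"
    and "\<And>a' b'. a \<le> a' \<Longrightarrow> a' < b' \<Longrightarrow> b' \<le> b \<Longrightarrow> S \<inter> {a'<..<b'} = {} \<Longrightarrow> h integrable_on {a'..b'}"
  shows "h integrable_on {a..b}"
  using assms
proof (induction S arbitrary: a b rule: finite_induct)
  case empty
  then show ?case using integrable_on_refl[of h a] by (cases "a = b") auto
next
  case (insert s S)
  show ?case
  proof (cases "s \<in> {a<..<b}")
    case True
    have "h integrable_on {a..s}"
    proof (rule insert.IH)
      fix a' b' assume "a \<le> a'" "a' < b'" "b' \<le> s" "S \<inter> {a'<..<b'} = {}"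
      then show "h integrable_on {a'..b'}" using True by (intro insert.prems(2)) auto
    qed (use True in auto)
    moreover have "h integrable_on {s..b}"
    proof (rule insert.IH)
      fix a' b' assume "s \<le> a'" "a' < b'" "b' \<le> b" "S \<inter> {a'<..<b'} = {}"
      then show "h integrable_on {a'..b'}" using True by (intro insert.prems(2)) auto
    qed (use True in auto)
    ultimately show ?thesis using True by (intro Henstock_Kurzweil_Integration.integrable_combine[of a s b]) auto
  next
    case False
    show ?thesis
    proof (rule insert.IH)
      fix a' b' assume "a \<le> a'" "a' < b'" "b' \<le> b" "S \<inter> {a'<..<b'} = {}"
      then show "h integrable_on {a'..b'}" using False by (intro insert.prems(2)) auto
    qed (rule insert.prems(1))
  qed
qed

context riem_mfd
begin

abbreviation speed :: "real set \<Rightarrow> (real \<Rightarrow> 'm) \<Rightarrow> real \<Rightarrow> real" where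
  "speed I \<gamma> t \<equiv> tnorm M (\<gamma> t) (velocity M I \<gamma> t)"

lemma C1_curve_derivative:
  assumes "C1_curve M I \<gamma>" "t \<in> I" "c \<in> charts_at M (\<gamma> t)"
  shows "((chart_map c \<circ> \<gamma>) has_vector_derivative
     vector_derivative (chart_map c \<circ> \<gamma>) (at t within I)) (at t within I)"
  using assms charts_at_D[OF assms(3)] unfolding C1_curve_def vector_derivative_works[symmetric] by blast

lemma C1_curve_velocity:
  assumes "C1_curve M {a..b} \<gamma>" "a < b" "t \<in> {a..b}" "c \<in> charts_at M (\<gamma> t)"
  shows "velocity M {a..b} \<gamma> t = tvec M c (\<gamma> t) (vector_derivative (chart_map c \<circ> \<gamma>) (at t within {a..b}))"
  using velocity_tangent[OF assms(2,3) _ assms(4) C1_curve_derivative[OF assms(1,3,4)]] assms(1)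
  by (simp add: C1_curve_def)

lemma C1_curve_velocity_tangent:
  assumes "C1_curve M {a..b} \<gamma>" "a < b" "t \<in> {a..b}"
  shows "velocity M {a..b} \<gamma> t \<in> tangent_space M (\<gamma> t)"
  using C1_curve_velocity[OF assms] tvec_in_tangent_space charts_exist by metis

lemma C1_curve_speed_continuous:
  assumes g: "C1_curve M {a..b} \<gamma>" and ab: "a < b"
  shows "continuous_on {a..b} (speed {a..b} \<gamma>)"
  unfolding continuous_on_eq_continuous_within
proof
  fix t0 assume t0: "t0 \<in> {a..b}"
  obtain c where c: "c \<in> charts_at M (\<gamma> t0)" using charts_exist by blast
  note cD = charts_at_D[OF c]
  have cont: "continuous_on {a..b} \<gamma>" using g by (simp add: C1_curve_def)
  obtain d where d: "d > 0" and dom: "\<And>r. r \<in> {a..b} \<Longrightarrow> \<bar>r - t0\<bar> < d \<Longrightarrow> \<gamma> r \<in> chart_dom c"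
    using continuous_on_stays_near[OF cont t0 chart_homeo(1)[OF cD(1)] cD(2)] by blast
  define T where "T = {t\<in>{a..b}. \<gamma> t \<in> chart_dom c}"
  define y where "y = chart_map c \<circ> \<gamma>"
  define u where "u t = vector_derivative y (at t within {a..b})" for t
  have cu: "continuous_on T u"
    using g cD(1) unfolding C1_curve_def T_def u_def y_def by blast
  have cy: "continuous_on T y"
    unfolding y_def T_def
    by (rule continuous_on_compose[OF continuous_on_subset[OF cont] continuous_on_subset[OF continuous_on_chart_map[OF cD(1)]]])
      auto
  have "continuous_on (chart_img c) (\<lambda>q. metric_coord M c q i j)" for i j
    using metric_coord_smooth[OF cD(1), of 0 i j] by simp
  then have cm: "continuous_on T (\<lambda>t. metric_coord M c (y t) i j)" for i j
    by (rule continuous_on_compose2[OF _ cy]) (auto simp: y_def T_def)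
  have "continuous_on T (\<lambda>t. sqrt (\<Sum>i\<in>Basis. \<Sum>j\<in>Basis. (u t \<bullet> i) * (u t \<bullet> j) * metric_coord M c (y t) i j))"
    by (intro continuous_intros cu cm)
  moreover have "sqrt (\<Sum>i\<in>Basis. \<Sum>j\<in>Basis. (u t \<bullet> i) * (u t \<bullet> j) * metric_coord M c (y t) i j) =
      speed {a..b} \<gamma> t" if "t \<in> T" for t
  proof -
    have t: "t \<in> {a..b}" and ct: "c \<in> charts_at M (\<gamma> t)"
      using that cD(1) by (auto simp: T_def charts_at_def)
    have v: "velocity M {a..b} \<gamma> t = tvec M c (\<gamma> t) (u t)"
      using C1_curve_velocity[OF g ab t ct] by (simp add: u_def y_def)
    have "metric M (\<gamma> t) (velocity M {a..b} \<gamma> t) (velocity M {a..b} \<gamma> t) = metric_coord M c (y t) (u t) (u t)"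
      unfolding v using ct by (simp add: metric_coord_def y_def)
    also have "\<dots> = (\<Sum>i\<in>Basis. \<Sum>j\<in>Basis. (u t \<bullet> i) * (u t \<bullet> j) * metric_coord M c (y t) i j)"
      by (rule metric_coord_expand[OF cD(1)]) (use charts_at_D(2)[OF ct] in \<open>simp add: y_def\<close>)
    finally show ?thesis by (simp add: tnorm_def)
  qed
  ultimately have "continuous_on T (speed {a..b} \<gamma>)"
    by (subst continuous_on_cong[OF refl, symmetric]) auto
  moreover have "t0 \<in> T" using t0 cD(2) by (simp add: T_def)
  ultimately have "continuous (at t0 within T) (speed {a..b} \<gamma>)"
    unfolding continuous_on_eq_continuous_within by blast
  \<comment> \<open>\<open>T\<close>, the times spent in the domain of \<open>c\<close>, is a
    relative neighbourhood of \<open>t0\<close>.\<close>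
  moreover have "at t0 within T = at t0 within {a..b}"
    by (rule at_within_nhd[of _ "ball t0 d"]) (use d dom in \<open>auto simp: T_def dist_real_def abs_minus_commute\<close>)
  ultimately show "continuous (at t0 within {a..b}) (speed {a..b} \<gamma>)" by simp
qed

text \<open>\<open>curve_length\<close> differentiates within the whole interval, a
  \<open>C1_curve\<close> within its piece; away from the end points of the piece both are two-sided
  derivatives.\<close>

lemma velocity_interior:
  assumes "t \<in> {a<..<b}" "{a..b} \<subseteq> {c..d}"
  shows "velocity M {c..d} \<gamma> t = velocity M {a..b} \<gamma> t"
proof -
  have "t \<in> interior {a..b}" using assms(1) by simp
  moreover have "t \<in> interior {c..d}" using calculation assms(2) interior_mono by blast
  ultimately show ?thesis
    unfolding velocity_def by (simp only: at_within_interior)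
qed

lemma smooth_piece:
  assumes S: "finite S"
    and pw: "\<And>a b. 0 \<le> a \<Longrightarrow> a < b \<Longrightarrow> b \<le> 1 \<Longrightarrow> S \<inter> {a<..<b} = {} \<Longrightarrow> C1_curve M {a..b} \<gamma>"
    and t: "t \<in> {0<..<1} - S"
  shows "\<exists>a b. 0 \<le> a \<and> a < t \<and> t < b \<and> b \<le> 1 \<and> C1_curve M {a..b} \<gamma>"
proof -
  obtain d where d: "d > 0" "\<And>s. s \<in> S \<Longrightarrow> s \<noteq> t \<Longrightarrow> d \<le> dist t s"
    using finite_set_avoid[OF S, of t] by blast
  have "S \<inter> {max 0 (t - d)<..<min 1 (t + d)} = {}"
    using d(2) t by (force simp: dist_real_def)
  then have "C1_curve M {max 0 (t - d)..min 1 (t + d)} \<gamma>"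
    using t d(1) by (intro pw) auto
  then show ?thesis
    using t d(1) by (intro exI[of _ "max 0 (t - d)"] exI[of _ "min 1 (t + d)"]) auto
qed

lemma piecewise_C1_speed:
  assumes "piecewise_C1_curve M \<gamma>"
  shows "(speed {0..1} \<gamma> has_integral curve_length M \<gamma>) {0..1}" and "curve_length M \<gamma> \<ge> 0"
proof -
  obtain S where S: "finite S" and
    pw: "\<And>a b. 0 \<le> a \<Longrightarrow> a < b \<Longrightarrow> b \<le> 1 \<Longrightarrow> S \<inter> {a<..<b} = {} \<Longrightarrow> C1_curve M {a..b} \<gamma>"
    using assms unfolding piecewise_C1_curve_def by blast
  have "speed {0..1} \<gamma> integrable_on {0..1}"
  proof (rule integrable_of_pieces[OF S])
    fix a b :: real assume ab: "0 \<le> a" "a < b" "b \<le> 1" "S \<inter> {a<..<b} = {}"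
    have "speed {a..b} \<gamma> integrable_on {a..b}"
      by (rule integrable_continuous_real[OF C1_curve_speed_continuous[OF pw[OF ab] ab(2)]])
    then show "speed {0..1} \<gamma> integrable_on {a..b}"
    proof (rule integrable_spike_finite[rotated -1])
      fix t assume "t \<in> {a..b} - {a, b}"
      then have "t \<in> {a<..<b}" by auto
      then show "speed {0..1} \<gamma> t = speed {a..b} \<gamma> t"
        using velocity_interior[of t a b 0 1] ab by auto
    qed simp
  qed simp
  then show int: "(speed {0..1} \<gamma> has_integral curve_length M \<gamma>) {0..1}"
    unfolding curve_length_def by (rule integrable_integral)
  let ?S = "insert 0 (insert 1 S)"
  \<comment> \<open>At a break point \<open>velocity\<close> need not be a tangent vector, and
    \<open>tnorm\<close> may even be negative. Finitely many values do not affect the integral, so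
    they are set to 0.\<close>
  have "((\<lambda>t. if t \<in> ?S then 0 else speed {0..1} \<gamma> t) has_integral curve_length M \<gamma>) {0..1}"
    by (rule has_integral_spike_finite[OF _ _ int, of ?S]) (use S in auto)
  then show "curve_length M \<gamma> \<ge> 0"
  proof (rule has_integral_nonneg)
    fix t :: real assume t: "t \<in> {0..1}"
    show "0 \<le> (if t \<in> ?S then 0 else speed {0..1} \<gamma> t)"
    proof (cases "t \<in> ?S")
      case False
      then have "t \<in> {0<..<1} - S" using t by auto
      from smooth_piece[OF S pw this] obtain a b where ab: "0 \<le> a" "a < t" "t < b" "b \<le> 1" "C1_curve M {a..b} \<gamma>"
        by blast
      then have "velocity M {0..1} \<gamma> t = velocity M {a..b} \<gamma> t"
        by (intro velocity_interior) auto
      then show ?thesis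
        using False tnorm_nonneg[OF C1_curve_velocity_tangent[OF ab(5)]] ab by simp
    qed simp
  qed
qed

text \<open>Nonnegativity bounds the set of lengths from below, so that its \<open>Inf\<close> is a
  lower bound.\<close>

lemma rdist_le_length:
  assumes "piecewise_C1_curve M \<gamma>" "\<gamma> 0 = x" "\<gamma> 1 = y"
  shows "rdist M x y \<le> curve_length M \<gamma>"
  unfolding rdist_def
  using assms piecewise_C1_speed(2)
  by (intro cInf_lower bdd_belowI[where m = 0]) auto

section \<open>Reparametrizing and joining curves\<close>

lemma C1_curve_affine:
  assumes g: "C1_curve M {m * a + k..m * b + k} \<gamma>" and m: "m > 0" and ab: "a < b"
    and eq: "\<And>t. t \<in> {a..b} \<Longrightarrow> \<gamma>' t = \<gamma> (m * t + k)"
  shows "C1_curve M {a..b} \<gamma>'"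
    and "t \<in> {a..b} \<Longrightarrow> velocity M {a..b} \<gamma>' t = tscale m (velocity M {m * a + k..m * b + k} \<gamma> (m * t + k))"
proof -
  let ?I = "{m * a + k..m * b + k}"
  have img: "(\<lambda>t. m * t + k) ` {a..b} \<subseteq> ?I" using m by auto
  have mt: "m * t + k \<in> ?I" if "t \<in> {a..b}" for t using img that by blast
  let ?D = "\<lambda>c t. vector_derivative (chart_map c \<circ> \<gamma>) (at t within ?I)"
  have der: "((chart_map c \<circ> \<gamma>') has_vector_derivative m *\<^sub>R ?D c (m * t + k)) (at t within {a..b})"
    if t: "t \<in> {a..b}" and c: "c \<in> charts_at M (\<gamma>' t)" for c t
  proof -
    have lin: "((\<lambda>t. m * t + k) has_vector_derivative m) (at t within {a..b})"
      by (auto intro!: derivative_eq_intros simp: has_real_derivative_iff_has_vector_derivative[symmetric])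
    have "((chart_map c \<circ> \<gamma>) has_vector_derivative ?D c (m * t + k)) (at (m * t + k) within ?I)"
      using C1_curve_derivative[OF g mt[OF t]] c eq[OF t] by simp
    then have "((chart_map c \<circ> \<gamma>) has_vector_derivative ?D c (m * t + k))
        (at (m * t + k) within (\<lambda>t. m * t + k) ` {a..b})"
      by (rule has_vector_derivative_within_subset[OF _ img])
    from vector_diff_chain_within[OF lin this] show ?thesis
      by (rule has_vector_derivative_transform_within[OF _ zero_less_one t]) (simp add: eq)
  qed
  have vd: "vector_derivative (chart_map c \<circ> \<gamma>') (at t within {a..b}) = m *\<^sub>R ?D c (m * t + k)"
    if "t \<in> {a..b}" "c \<in> charts_at M (\<gamma>' t)" for c t
    using vector_derivative_Icc[OF ab that(1) der[OF that]] .
  have contI: "continuous_on ?I \<gamma>" using g by (simp add: C1_curve_def)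
  have lin: "continuous_on A (\<lambda>t. m * t + k)" for A by (intro continuous_intros)
  have "continuous_on {a..b} (\<lambda>t. \<gamma> (m * t + k))"
    by (rule continuous_on_compose2[OF contI lin img])
  then have cont: "continuous_on {a..b} \<gamma>'"
    by (rule continuous_on_eq) (simp add: eq)
  have "continuous_on {t \<in> {a..b}. \<gamma>' t \<in> chart_dom c}
      (\<lambda>t. vector_derivative (chart_map c \<circ> \<gamma>') (at t within {a..b}))" if c: "c \<in> charts M" for c
  proof -
    have "(\<lambda>t. m * t + k) ` {t \<in> {a..b}. \<gamma>' t \<in> chart_dom c} \<subseteq> {t \<in> ?I. \<gamma> t \<in> chart_dom c}"
    proof (intro image_subsetI CollectI conjI)
      fix t assume "t \<in> {t \<in> {a..b}. \<gamma>' t \<in> chart_dom c}"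
      then have t: "t \<in> {a..b}" and "\<gamma>' t \<in> chart_dom c" by blast+
      then show "\<gamma> (m * t + k) \<in> chart_dom c" by (simp only: eq[OF t])
      show "m * t + k \<in> ?I" by (rule mt[OF t])
    qed
    moreover have "continuous_on {t \<in> ?I. \<gamma> t \<in> chart_dom c} (?D c)"
      using g c unfolding C1_curve_def by blast
    ultimately have "continuous_on {t \<in> {a..b}. \<gamma>' t \<in> chart_dom c} (\<lambda>t. ?D c (m * t + k))"
      by (rule continuous_on_compose2[OF _ lin, rotated])
    then have "continuous_on {t \<in> {a..b}. \<gamma>' t \<in> chart_dom c} (\<lambda>t. m *\<^sub>R ?D c (m * t + k))"
      by (intro continuous_on_scaleR continuous_on_const)
    then show ?thesis
      by (rule continuous_on_eq) (use vd[symmetric] c in \<open>simp add: charts_at_def\<close>)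
  qed
  then show "C1_curve M {a..b} \<gamma>'"
    using cont differentiableI_vector[OF der] unfolding C1_curve_def charts_at_def by blast
  show "velocity M {a..b} \<gamma>' t = tscale m (velocity M ?I \<gamma> (m * t + k))" if t: "t \<in> {a..b}"
  proof
    fix c
    show "velocity M {a..b} \<gamma>' t c = tscale m (velocity M ?I \<gamma> (m * t + k)) c"
      using vd[OF t, of c] eq[OF t] by (simp add: velocity_def tscale_def)
  qed
qed

lemma tnorm_scale:
  assumes "v \<in> tangent_space M x" "m \<ge> 0"
  shows "tnorm M x (tscale m v) = m * tnorm M x v"
proof -
  have "metric M x (tscale m v) (tscale m v) = m\<^sup>2 * metric M x v v"
    using assms metric_scale metric_sym tscale_tangent by (simp add: power2_eq_square mult.assoc)
  then show ?thesis using assms(2) by (simp add: tnorm_def real_sqrt_mult)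
qed

text \<open>The factor \<open>m\<close> in the speed cancels the \<open>1 / m\<close> of the
  substitution. The interval is the preimage of \<open>{0..1}\<close> under the affine map;
  elsewhere \<open>\<gamma>'\<close> may be anything, as for one half of a joined path.\<close>

lemma speed_affine_piece:
  assumes \<gamma>: "piecewise_C1_curve M \<gamma>" and m: "m > 0"
    and eq: "\<And>t. m * t + k \<in> {0..1} \<Longrightarrow> t \<in> {0..1} \<and> \<gamma>' t = \<gamma> (m * t + k)"
  shows "(speed {0..1} \<gamma>' has_integral curve_length M \<gamma>) {- k / m..(1 - k) / m}"
proof -
  obtain S where S: "finite S" and
    pw: "\<And>a b. 0 \<le> a \<Longrightarrow> a < b \<Longrightarrow> b \<le> 1 \<Longrightarrow> S \<inter> {a<..<b} = {} \<Longrightarrow> C1_curve M {a..b} \<gamma>"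
    using \<gamma> unfolding piecewise_C1_curve_def by blast
  have I: "t \<in> {- k / m..(1 - k) / m} \<longleftrightarrow> m * t + k \<in> {0..1}" for t
    using m by (auto simp: field_simps)
  have "((\<lambda>t. speed {0..1} \<gamma> (m * t + k)) has_integral curve_length M \<gamma> / m) {- k / m..(1 - k) / m}"
    using has_integral_affinity'[of "speed {0..1} \<gamma>" "curve_length M \<gamma>" 0 1 m k] piecewise_C1_speed(1)[OF \<gamma>] m
    by (simp add: field_simps)
  from has_integral_mult_right[OF this, of m]
  have "((\<lambda>t. m * speed {0..1} \<gamma> (m * t + k)) has_integral curve_length M \<gamma>) {- k / m..(1 - k) / m}"
    using m by simp
  then show ?thesis
  proof (rule has_integral_spike_finite[rotated -1])
    \<comment> \<open>The times at which \<open>\<gamma>\<close> passes its break points or ends;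
      there the speeds are not compared.\<close>
    let ?T = "(\<lambda>s. (s - k) / m) ` insert 0 (insert 1 S)"
    show "finite ?T" using S by simp
    fix t assume t: "t \<in> {- k / m..(1 - k) / m} - ?T"
    have "m * t + k \<notin> insert 0 (insert 1 S)"
    proof
      assume "m * t + k \<in> insert 0 (insert 1 S)"
      then have "((m * t + k) - k) / m \<in> ?T" by (rule imageI)
      then show False using t m by simp
    qed
    then have "m * t + k \<in> {0<..<1} - S" using t I[of t] by auto
    from smooth_piece[OF S pw this] obtain a b where
      ab: "0 \<le> a" "a < m * t + k" "m * t + k < b" "b \<le> 1" and C1: "C1_curve M {a..b} \<gamma>" by blast
    define a' b' where "a' = (a - k) / m" and "b' = (b - k) / m"
    have a': "m * a' + k = a" and b': "m * b' + k = b" using m by (auto simp: a'_def b'_def)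
    have t': "a' < t" "t < b'" using ab m by (auto simp: a'_def b'_def field_simps)
    have in01: "m * s + k \<in> {0..1}" if "s \<in> {a'..b'}" for s
    proof -
      have "m * a' + k \<le> m * s + k" "m * s + k \<le> m * b' + k" using that m by auto
      then show ?thesis using ab a' b' by auto
    qed
    have eq': "\<gamma>' s = \<gamma> (m * s + k)" "s \<in> {0..1}" if "s \<in> {a'..b'}" for s
      using eq[OF in01[OF that]] by auto
    have C1': "C1_curve M {m * a' + k..m * b' + k} \<gamma>" using C1 a' b' by simp
    have "velocity M {a'..b'} \<gamma>' t = tscale m (velocity M {a..b} \<gamma> (m * t + k))"
      using C1_curve_affine(2)[OF C1' m _ eq'(1)] t' a' b' by simp
    moreover have "velocity M {0..1} \<gamma>' t = velocity M {a'..b'} \<gamma>' t"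
      using t' eq'(2) by (intro velocity_interior) auto
    moreover have "velocity M {0..1} \<gamma> (m * t + k) = velocity M {a..b} \<gamma> (m * t + k)"
      using ab by (intro velocity_interior) auto
    moreover have "velocity M {a..b} \<gamma> (m * t + k) \<in> tangent_space M (\<gamma> (m * t + k))"
      using ab by (intro C1_curve_velocity_tangent[OF C1]) auto
    moreover have "\<gamma>' t = \<gamma> (m * t + k)" using eq'(1) t' by simp
    ultimately show "speed {0..1} \<gamma>' t = m * speed {0..1} \<gamma> (m * t + k)"
      using tnorm_scale m by simp
  qed
qed

lemma join_curves:
  assumes \<gamma>1: "piecewise_C1_curve M \<gamma>1" and \<gamma>2: "piecewise_C1_curve M \<gamma>2" and join: "\<gamma>1 1 = \<gamma>2 0"
  shows "\<exists>\<gamma>. piecewise_C1_curve M \<gamma> \<and> \<gamma> 0 = \<gamma>1 0 \<and> \<gamma> 1 = \<gamma>2 1 \<and>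
     curve_length M \<gamma> = curve_length M \<gamma>1 + curve_length M \<gamma>2"
proof -
  define \<gamma> where "\<gamma> = \<gamma>1 +++ \<gamma>2"
  \<comment> \<open>The added \<open>0\<close> and \<open>-1\<close> give both halves the form
    \<open>m * t + k\<close> of \<open>C1_curve_affine\<close> and
    \<open>speed_affine_piece\<close>.\<close>
  have left: "\<gamma> t = \<gamma>1 (2 * t + 0)" if "t \<le> 1/2" for t using that by (simp add: \<gamma>_def joinpaths_def)
  have right: "\<gamma> t = \<gamma>2 (2 * t + (-1))" if "t \<ge> 1/2" for t
  proof (cases "t = 1/2")
    case True
    show ?thesis unfolding True using join by (simp add: \<gamma>_def joinpaths_def)
  qed (use that in \<open>simp add: \<gamma>_def joinpaths_def\<close>)
  obtain S1 where S1: "finite S1" and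
    pw1: "\<And>a b. 0 \<le> a \<Longrightarrow> a < b \<Longrightarrow> b \<le> 1 \<Longrightarrow> S1 \<inter> {a<..<b} = {} \<Longrightarrow> C1_curve M {a..b} \<gamma>1"
    using \<gamma>1 unfolding piecewise_C1_curve_def by blast
  obtain S2 where S2: "finite S2" and
    pw2: "\<And>a b. 0 \<le> a \<Longrightarrow> a < b \<Longrightarrow> b \<le> 1 \<Longrightarrow> S2 \<inter> {a<..<b} = {} \<Longrightarrow> C1_curve M {a..b} \<gamma>2"
    using \<gamma>2 unfolding piecewise_C1_curve_def by blast
  \<comment> \<open>The joint is a break point; the others are those of the two curves, carried to
    their halves.\<close>
  define S where "S = insert (1/2) ((\<lambda>s. s / 2) ` S1 \<union> (\<lambda>s. (s + 1) / 2) ` S2)"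
  have "C1_curve M {a..b} \<gamma>" if ab: "0 \<le> a" "a < b" "b \<le> 1" and nb: "S \<inter> {a<..<b} = {}" for a b
  proof (cases "b \<le> 1/2")
    case True
    have "S1 \<inter> {2 * a<..<2 * b} = {}"
    proof (intro equalityI subsetI)
      fix s assume s: "s \<in> S1 \<inter> {2 * a<..<2 * b}"
      then have "s / 2 \<in> S \<inter> {a<..<b}" by (auto simp: S_def)
      then show "s \<in> {}" using nb by simp
    qed simp
    then have "C1_curve M {2 * a + 0..2 * b + 0} \<gamma>1" using pw1[of "2 * a" "2 * b"] ab True by simp
    then show ?thesis using True left by (intro C1_curve_affine(1)[OF _ _ ab(2), where m = 2 and k = 0 and \<gamma> = \<gamma>1]) auto
  next
    case False
    have a: "a \<ge> 1/2"
    proof (rule ccontr)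
      assume "\<not> 1/2 \<le> a"
      then have "1/2 \<in> S \<inter> {a<..<b}" using False by (simp add: S_def)
      then show False using nb by simp
    qed
    have "S2 \<inter> {2 * a - 1<..<2 * b - 1} = {}"
    proof (intro equalityI subsetI)
      fix s assume s: "s \<in> S2 \<inter> {2 * a - 1<..<2 * b - 1}"
      then have "(s + 1) / 2 \<in> S \<inter> {a<..<b}" by (auto simp: S_def)
      then show "s \<in> {}" using nb by simp
    qed simp
    then have "C1_curve M {2 * a + (-1)..2 * b + (-1)} \<gamma>2" using pw2[of "2 * a - 1" "2 * b - 1"] ab a by simp
    then show ?thesis using a right by (intro C1_curve_affine(1)[OF _ _ ab(2), where m = 2 and k = "-1" and \<gamma> = \<gamma>2]) auto
  qed
  moreover have "finite S" using S1 S2 by (simp add: S_def)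
  ultimately have pw: "piecewise_C1_curve M \<gamma>" unfolding piecewise_C1_curve_def by blast
  have "(speed {0..1} \<gamma> has_integral curve_length M \<gamma>1) {0..1/2}"
    using speed_affine_piece[OF \<gamma>1, of 2 0 \<gamma>] left by simp
  moreover have "(speed {0..1} \<gamma> has_integral curve_length M \<gamma>2) {1/2..1}"
    using speed_affine_piece[OF \<gamma>2, of 2 "-1" \<gamma>] right by simp
  ultimately have "(speed {0..1} \<gamma> has_integral curve_length M \<gamma>1 + curve_length M \<gamma>2) {0..1}"
    by (intro Henstock_Kurzweil_Integration.has_integral_combine[of 0 "1/2" 1]) auto
  then have "curve_length M \<gamma> = curve_length M \<gamma>1 + curve_length M \<gamma>2"
    unfolding curve_length_def by (rule integral_unique)
  then show ?thesis
    using pw left[of 0] right[of 1] by (intro exI[of _ \<gamma>]) simp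
qed

section \<open>Coordinate segments and bounded distances\<close>

lemma segment_curve:
  assumes c: "c \<in> charts M" and r: "ball p0 r \<subseteq> chart_img c"
    and B: "\<And>q a. q \<in> ball p0 r \<Longrightarrow> metric_coord M c q a a \<le> B\<^sup>2 * (norm a)\<^sup>2" and B0: "B \<ge> 0"
    and x: "x \<in> chart_dom c" "chart_map c x \<in> ball p0 r" and y: "y \<in> chart_dom c" "chart_map c y \<in> ball p0 r"
  shows "\<exists>\<gamma>. piecewise_C1_curve M \<gamma> \<and> \<gamma> 0 = x \<and> \<gamma> 1 = y \<and>
     curve_length M \<gamma> \<le> B * norm (chart_map c x - chart_map c y)"
proof -
  define w where "w = chart_map c y - chart_map c x"
  \<comment> \<open>The straight segment in coordinates: it stays in the convex ball, its coordinate
    velocity is the constant \<open>w\<close>, and so its speed is at most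
    \<open>B * norm w\<close>.\<close>
  define \<sigma> where "\<sigma> t = chart_map c x + t *\<^sub>R w" for t
  define \<gamma> where "\<gamma> t = chart_inv c (\<sigma> t)" for t
  have \<sigma>: "\<sigma> t \<in> ball p0 r" if "t \<in> {0..1}" for t
  proof -
    have "\<sigma> t = (1 - t) *\<^sub>R chart_map c x + t *\<^sub>R chart_map c y"
      by (simp add: \<sigma>_def w_def algebra_simps)
    then show ?thesis using convexD_alt[OF convex_ball x(2) y(2)] that by simp
  qed
  have img: "\<sigma> t \<in> chart_img c" if "t \<in> {0..1}" for t using \<sigma>[OF that] r by blast
  have c\<gamma>: "c \<in> charts_at M (\<gamma> t)" "chart_map c (\<gamma> t) = \<sigma> t" if "t \<in> {0..1}" for t
    using c img[OF that] by (auto simp: charts_at_def \<gamma>_def)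
  have c\<sigma>: "continuous_on A \<sigma>" for A unfolding \<sigma>_def by (intro continuous_intros)
  have cont: "continuous_on {0..1} \<gamma>"
    unfolding \<gamma>_def by (rule continuous_on_compose2[OF continuous_on_chart_inv[OF c] c\<sigma>]) (use img in auto)
  have der: "((chart_map c \<circ> \<gamma>) has_vector_derivative w) (at t within {a..b})"
    if t: "t \<in> {a..b}" and I: "{a..b} \<subseteq> {0..1}" for t a b
  proof -
    have "(\<sigma> has_vector_derivative w) (at t within {a..b})"
      unfolding \<sigma>_def by (auto intro!: derivative_eq_intros)
    then show ?thesis
      by (rule has_vector_derivative_transform_within[OF _ zero_less_one t]) (use c\<gamma>(2) I in auto)
  qed
  have C1: "C1_curve M {a..b} \<gamma>" if ab: "0 \<le> a" "a < b" "b \<le> 1" for a b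
    unfolding C1_curve_def
  proof (intro conjI ballI impI)
    have I: "{a..b} \<subseteq> {0..1}" using ab by auto
    show contI: "continuous_on {a..b} \<gamma>" by (rule continuous_on_subset[OF cont I])
    \<comment> \<open>\<open>C1_curve\<close> asks for continuous velocities in every chart; in
      \<open>c'\<close> the velocity is the derivative of the transition map applied to
      \<open>w\<close>.\<close>
    fix c' assume c': "c' \<in> charts M"
    have der': "((chart_map c' \<circ> \<gamma>) has_vector_derivative
        frechet_derivative (transition c c') (at (\<sigma> t)) w) (at t within {a..b})"
      if t: "t \<in> {a..b}" and dom: "\<gamma> t \<in> chart_dom c'" for t
    proof -
      have t01: "t \<in> {0..1}" using t I by blast
      have "c' \<in> charts_at M (\<gamma> t)" using c' dom by (simp add: charts_at_def)
      from chart_change_derivative[OF contI t c\<gamma>(1)[OF t01] this der[OF t I]]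
      show ?thesis by (simp only: c\<gamma>(2)[OF t01])
    qed
    show "(chart_map c' \<circ> \<gamma>) differentiable (at t within {a..b})"
      if "t \<in> {a..b}" "\<gamma> t \<in> chart_dom c'" for t
      using der'[OF that] by (rule differentiableI_vector)
    have "continuous_on (chart_map c ` (chart_dom c \<inter> chart_dom c'))
        (\<lambda>p. frechet_derivative (transition c c') (at p) w)"
      using transition_smooth[OF c c', of "Suc 0"] unfolding Ck_on.simps by blast
    then have "continuous_on {t \<in> {a..b}. \<gamma> t \<in> chart_dom c'}
        (\<lambda>t. frechet_derivative (transition c c') (at (\<sigma> t)) w)"
    proof (rule continuous_on_compose2[OF _ c\<sigma>], intro image_subsetI)
      fix t assume t: "t \<in> {t \<in> {a..b}. \<gamma> t \<in> chart_dom c'}"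
      then have t01: "t \<in> {0..1}" using I by blast
      have "\<sigma> t = chart_map c (\<gamma> t)" using c\<gamma>(2)[OF t01] by simp
      then show "\<sigma> t \<in> chart_map c ` (chart_dom c \<inter> chart_dom c')"
        using t charts_at_D(2)[OF c\<gamma>(1)[OF t01]] by blast
    qed
    then show "continuous_on {t \<in> {a..b}. \<gamma> t \<in> chart_dom c'}
        (\<lambda>t. vector_derivative (chart_map c' \<circ> \<gamma>) (at t within {a..b}))"
    proof (rule continuous_on_eq)
      fix t assume "t \<in> {t \<in> {a..b}. \<gamma> t \<in> chart_dom c'}"
      then have t: "t \<in> {a..b}" "\<gamma> t \<in> chart_dom c'" by blast+
      show "frechet_derivative (transition c c') (at (\<sigma> t)) w =
          vector_derivative (chart_map c' \<circ> \<gamma>) (at t within {a..b})"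
        by (rule vector_derivative_Icc[OF ab(2) t(1) der'[OF t], symmetric])
    qed
  qed
  have pw: "piecewise_C1_curve M \<gamma>"
    unfolding piecewise_C1_curve_def using C1 by (intro exI[of _ "{}"]) auto
  have ends: "\<gamma> 0 = x" "\<gamma> 1 = y"
    using c x y by (auto simp: \<gamma>_def \<sigma>_def w_def)
  have "speed {0..1} \<gamma> t \<le> B * norm w" if t: "t \<in> {0..1}" for t
  proof -
    have "velocity M {0..1} \<gamma> t = tvec M c (\<gamma> t) w"
      using velocity_tangent[OF _ t cont c\<gamma>(1)[OF t] der[OF t]] by simp
    then have "metric M (\<gamma> t) (velocity M {0..1} \<gamma> t) (velocity M {0..1} \<gamma> t) = metric_coord M c (\<sigma> t) w w"
      by (simp add: metric_coord_def \<gamma>_def)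
    also have "\<dots> \<le> (B * norm w)\<^sup>2" using B[OF \<sigma>[OF t]] by (simp add: power_mult_distrib)
    finally show ?thesis using B0 by (simp add: tnorm_def real_le_lsqrt)
  qed
  then have "curve_length M \<gamma> \<le> B * norm w * (1 - 0)"
    using has_integral_le[OF piecewise_C1_speed(1)[OF pw] has_integral_const_real[of "B * norm w" 0 1]]
    by simp
  then show ?thesis
    using pw ends by (intro exI[of _ \<gamma>]) (simp add: w_def norm_minus_commute)
qed

text \<open>Stated for curves instead of \<open>rdist\<close>, so that they can still be joined with
  others.\<close>

lemma local_curves:
  "\<exists>U. open U \<and> x0 \<in> U \<and> (\<exists>c\<in>charts_at M x0. U \<subseteq> chart_dom c \<and> (\<exists>B>0. \<forall>x\<in>U. \<forall>y\<in>U.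
     \<exists>\<gamma>. piecewise_C1_curve M \<gamma> \<and> \<gamma> 0 = x \<and> \<gamma> 1 = y \<and>
       curve_length M \<gamma> \<le> B * norm (chart_map c x - chart_map c y)))"
proof -
  obtain c where c: "c \<in> charts_at M x0" using charts_exist by blast
  note cD = charts_at_D[OF c]
  obtain r B where r: "r > 0" "ball (chart_map c x0) r \<subseteq> chart_img c" and B: "B > 0"
    "\<And>q a. q \<in> ball (chart_map c x0) r \<Longrightarrow> metric_coord M c q a a \<le> B * (norm a)\<^sup>2"
    using metric_coord_locally_comparable[OF cD(1) chart_map_img[OF cD(2)]] by blast
  define U where "U = chart_dom c \<inter> chart_map c -` ball (chart_map c x0) r"
  have "open U"
    unfolding U_def
    by (rule continuous_open_preimage[OF continuous_on_chart_map[OF cD(1)] chart_homeo(1)[OF cD(1)] open_ball])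
  moreover have "x0 \<in> U" using cD(2) r by (simp add: U_def)
  moreover have "\<forall>x\<in>U. \<forall>y\<in>U. \<exists>\<gamma>. piecewise_C1_curve M \<gamma> \<and> \<gamma> 0 = x \<and> \<gamma> 1 = y \<and>
       curve_length M \<gamma> \<le> sqrt B * norm (chart_map c x - chart_map c y)"
    using B by (intro ballI segment_curve[OF cD(1) r(2)]) (auto simp: U_def)
  moreover have "U \<subseteq> chart_dom c" by (auto simp: U_def)
  moreover have "sqrt B > 0" using B by simp
  ultimately show ?thesis using c by blast
qed

lemma geodesic_piecewise_C1:
  assumes g: "geodesic M {0..1} \<gamma>"
  shows "piecewise_C1_curve M \<gamma>"
proof -
  have "C1_curve M {a..b} \<gamma>" if ab: "0 \<le> a" "a < b" "b \<le> 1" for a b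
  proof -
    have I: "{a..b} \<subseteq> {0..1}" using ab by auto
    let ?D = "\<lambda>c t. vector_derivative (chart_map c \<circ> \<gamma>) (at t within {0..1})"
    have der: "((chart_map c \<circ> \<gamma>) has_vector_derivative ?D c t) (at t within {a..b})"
      if "c \<in> charts M" "t \<in> {a..b}" "\<gamma> t \<in> chart_dom c" for c t
    proof -
      have "t \<in> {0..1}" using that(2) I by blast
      from has_vector_derivative_within_subset[OF geodesicD(2)[OF g that(1) this that(3)] I]
      show ?thesis .
    qed
    have cD: "continuous_on {t \<in> {a..b}. \<gamma> t \<in> chart_dom c} (?D c)" if c: "c \<in> charts M" for c
      unfolding continuous_on_eq_continuous_within
    proof
      fix t assume t: "t \<in> {t \<in> {a..b}. \<gamma> t \<in> chart_dom c}"
      then have "t \<in> {0..1}" "\<gamma> t \<in> chart_dom c" using I by auto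
      from has_vector_derivative_continuous[OF geodesicD(3)[OF g c this]]
      show "continuous (at t within {t \<in> {a..b}. \<gamma> t \<in> chart_dom c}) (?D c)"
        by (rule continuous_within_subset) (use I in auto)
    qed
    have "continuous_on {t \<in> {a..b}. \<gamma> t \<in> chart_dom c}
        (\<lambda>t. vector_derivative (chart_map c \<circ> \<gamma>) (at t within {a..b}))" if c: "c \<in> charts M" for c
      using cD[OF c]
    proof (rule continuous_on_eq)
      fix t assume "t \<in> {t \<in> {a..b}. \<gamma> t \<in> chart_dom c}"
      then have t: "t \<in> {a..b}" "\<gamma> t \<in> chart_dom c" by blast+
      show "?D c t = vector_derivative (chart_map c \<circ> \<gamma>) (at t within {a..b})"
        by (rule vector_derivative_Icc[OF ab(2) t(1) der[OF c t], symmetric])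
    qed
    then show ?thesis
      unfolding C1_curve_def
      using continuous_on_subset[OF geodesicD(1)[OF g] I] differentiableI_vector[OF der] by blast
  qed
  then show ?thesis unfolding piecewise_C1_curve_def by (intro exI[of _ "{}"]) auto
qed

text \<open>Without an upper bound the \<open>Sup\<close> in \<open>rdiam\<close> would be an
  unspecified number. Compactness leaves finitely many centres; a point reaches a centre by a curve
  of bounded length, and minimizing geodesics connect the centres. Curves to and from a centre are
  both provided, so that no curve has to be reversed.\<close>

lemma rdist_bounded:
  assumes X: "compact X" "weakly_minimizing_convex M X"
  shows "\<exists>R. \<forall>x\<in>X. \<forall>y\<in>X. rdist M x y \<le> R"
proof -
  have "\<exists>U. open U \<and> x0 \<in> U \<and> (\<exists>R. \<forall>x\<in>U.
     (\<exists>\<gamma>. piecewise_C1_curve M \<gamma> \<and> \<gamma> 0 = x \<and> \<gamma> 1 = x0 \<and> curve_length M \<gamma> \<le> R) \<and>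
     (\<exists>\<gamma>. piecewise_C1_curve M \<gamma> \<and> \<gamma> 0 = x0 \<and> \<gamma> 1 = x \<and> curve_length M \<gamma> \<le> R))" for x0
  proof -
    obtain U c B where U: "open U" "x0 \<in> U" and c: "c \<in> charts_at M x0" "U \<subseteq> chart_dom c" and B: "B > 0"
      and curve: "\<And>x y. x \<in> U \<Longrightarrow> y \<in> U \<Longrightarrow> \<exists>\<gamma>. piecewise_C1_curve M \<gamma> \<and> \<gamma> 0 = x \<and> \<gamma> 1 = y \<and>
       curve_length M \<gamma> \<le> B * norm (chart_map c x - chart_map c y)"
      using local_curves[of x0] by metis
    define V where "V = U \<inter> (chart_dom c \<inter> chart_map c -` ball (chart_map c x0) 1)"
    have oV: "open V"
      unfolding V_def using U(1)
      by (intro open_Int continuous_open_preimage[OF continuous_on_chart_map] chart_homeo(1) open_ball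
          charts_at_D(1)[OF c(1)])
    have xV: "x0 \<in> V" using U(2) c by (auto simp: V_def)
    have "B * norm (chart_map c x - chart_map c x0) \<le> B" "B * norm (chart_map c x0 - chart_map c x) \<le> B" if "x \<in> V" for x
      using that B by (auto simp: V_def dist_norm norm_minus_commute)
    then have "(\<exists>\<gamma>. piecewise_C1_curve M \<gamma> \<and> \<gamma> 0 = x \<and> \<gamma> 1 = x0 \<and> curve_length M \<gamma> \<le> B) \<and>
      (\<exists>\<gamma>. piecewise_C1_curve M \<gamma> \<and> \<gamma> 0 = x0 \<and> \<gamma> 1 = x \<and> curve_length M \<gamma> \<le> B)" if "x \<in> V" for x
      using curve[of x x0] curve[of x0 x] that U(2) order_trans unfolding V_def by blast
    then show ?thesis using oV xV by blast
  qed
  then obtain U R where U: "\<And>x0. open (U x0)" "\<And>x0. x0 \<in> U x0"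
    and R: "\<And>x0 x. x \<in> U x0 \<Longrightarrow>
     (\<exists>\<gamma>. piecewise_C1_curve M \<gamma> \<and> \<gamma> 0 = x \<and> \<gamma> 1 = x0 \<and> curve_length M \<gamma> \<le> R x0) \<and>
     (\<exists>\<gamma>. piecewise_C1_curve M \<gamma> \<and> \<gamma> 0 = x0 \<and> \<gamma> 1 = x \<and> curve_length M \<gamma> \<le> R x0)"
    by metis
  obtain F where F: "F \<subseteq> X" "finite F" "X \<subseteq> (\<Union>x0\<in>F. U x0)"
    using compactE_image[OF X(1), of X U] U by blast
  define Q where "Q = (\<lambda>(x0, y0). R x0 + rdist M x0 y0 + R y0) ` (F \<times> F)"
  have Q: "finite Q" using F by (simp add: Q_def)
  have "rdist M x y \<le> Max Q" if xy: "x \<in> X" "y \<in> X" for x y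
  proof -
    obtain x0 y0 where x0: "x0 \<in> F" "x \<in> U x0" and y0: "y0 \<in> F" "y \<in> U y0"
      using F(3) xy by blast
    obtain \<gamma>1 where \<gamma>1: "piecewise_C1_curve M \<gamma>1" "\<gamma>1 0 = x" "\<gamma>1 1 = x0" "curve_length M \<gamma>1 \<le> R x0"
      using R[OF x0(2)] by blast
    obtain \<gamma>3 where \<gamma>3: "piecewise_C1_curve M \<gamma>3" "\<gamma>3 0 = y0" "\<gamma>3 1 = y" "curve_length M \<gamma>3 \<le> R y0"
      using R[OF y0(2)] by blast
    obtain \<gamma>2 where "minimizing_geodesic M x0 y0 \<gamma>2"
      using X(2) x0 y0 F(1) unfolding weakly_minimizing_convex_def by blast
    then have \<gamma>2: "piecewise_C1_curve M \<gamma>2" "\<gamma>2 0 = x0" "\<gamma>2 1 = y0" "curve_length M \<gamma>2 = rdist M x0 y0"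
      using geodesic_piecewise_C1 unfolding minimizing_geodesic_def by auto
    obtain \<gamma>12 where \<gamma>12: "piecewise_C1_curve M \<gamma>12" "\<gamma>12 0 = x" "\<gamma>12 1 = y0"
      "curve_length M \<gamma>12 = curve_length M \<gamma>1 + curve_length M \<gamma>2"
      using join_curves[OF \<gamma>1(1) \<gamma>2(1)] \<gamma>1 \<gamma>2 by auto
    obtain \<gamma> where \<gamma>: "piecewise_C1_curve M \<gamma>" "\<gamma> 0 = x" "\<gamma> 1 = y"
      "curve_length M \<gamma> = curve_length M \<gamma>12 + curve_length M \<gamma>3"
      using join_curves[OF \<gamma>12(1) \<gamma>3(1)] \<gamma>12 \<gamma>3 by auto
    have "rdist M x y \<le> curve_length M \<gamma>" by (rule rdist_le_length[OF \<gamma>(1-3)])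
    also have "\<dots> \<le> R x0 + rdist M x0 y0 + R y0" using \<gamma>(4) \<gamma>12(4) \<gamma>1(4) \<gamma>2(4) \<gamma>3(4) by simp
    also have "\<dots> \<le> Max Q" using x0(1) y0(1) Q by (intro Max_ge) (auto simp: Q_def)
    finally show ?thesis .
  qed
  then show ?thesis by blast
qed

end

section \<open>The short-step method\<close>

lemma short_step_decrease:
  fixes g l L Lh :: real
  assumes "g > 0" "l > 0" "0 < L" "L \<le> Lh"
  defines "\<eta> \<equiv> min 1 (g / (Lh * l\<^sup>2))"
  shows "0 < \<eta>" "\<eta> \<le> 1"
    and "- \<eta> * g + L / 2 * \<eta>\<^sup>2 * l\<^sup>2 \<le> - min (g / 2) (g\<^sup>2 / (2 * Lh * l\<^sup>2))"
proof -
  have P: "Lh * l\<^sup>2 > 0" using assms by simp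
  show "0 < \<eta>" "\<eta> \<le> 1" using P assms(1) by (auto simp: \<eta>_def)
  have "L / 2 * \<eta>\<^sup>2 * l\<^sup>2 \<le> Lh / 2 * \<eta>\<^sup>2 * l\<^sup>2"
    using assms by (intro mult_right_mono) auto
  then have 1: "- \<eta> * g + L / 2 * \<eta>\<^sup>2 * l\<^sup>2 \<le> - \<eta> * g + \<eta>\<^sup>2 * (Lh * l\<^sup>2) / 2"
    by (simp add: mult_ac)
  show "- \<eta> * g + L / 2 * \<eta>\<^sup>2 * l\<^sup>2 \<le> - min (g / 2) (g\<^sup>2 / (2 * Lh * l\<^sup>2))"
  proof (cases "g \<ge> Lh * l\<^sup>2")
    case True
    then have "\<eta> = 1" using P by (simp add: \<eta>_def)
    \<comment> \<open>A full step is taken only if \<open>Lh * l\<^sup>2 \<le> g\<close>, so the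
      quadratic term costs at most half of the linear gain.\<close>
    then have "- \<eta> * g + \<eta>\<^sup>2 * (Lh * l\<^sup>2) / 2 \<le> - (g / 2)" using True by simp
    then show ?thesis using 1 min.cobounded1[of "g / 2" "g\<^sup>2 / (2 * Lh * l\<^sup>2)"] by linarith
  next
    case False
    then have \<eta>: "\<eta> = g / (Lh * l\<^sup>2)" using P by (simp add: \<eta>_def)
    \<comment> \<open>The unconstrained minimum of the quadratic model.\<close>
    have "- \<eta> * g + \<eta>\<^sup>2 * (Lh * l\<^sup>2) / 2 = - (g\<^sup>2 / (2 * (Lh * l\<^sup>2)))"
      unfolding \<eta> using P by (simp add: field_simps power2_eq_square)
    then show ?thesis using 1 min.cobounded2[of "g / 2" "g\<^sup>2 / (2 * Lh * l\<^sup>2)"]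
      by (simp add: mult.assoc)
  qed
qed

text \<open>The sequence decreases to some \<open>l\<close>, and its decrements tend to 0; passing
  to the limit in the descent inequality gives
  \<open>min (l / 2) (c * l\<^sup>2) \<le> 0\<close>.\<close>

lemma quadratic_descent_tendsto_zero:
  fixes h :: "nat \<Rightarrow> real"
  assumes nonneg: "\<And>k. h k \<ge> 0" and c: "c > 0"
    and step: "\<And>k. h (Suc k) \<le> h k - min (h k / 2) (c * (h k)\<^sup>2)"
  shows "h \<longlonglongrightarrow> 0"
proof -
  have m0: "min (h k / 2) (c * (h k)\<^sup>2) \<ge> 0" for k using nonneg[of k] c by simp
  have "decseq h"
  proof (rule decseq_SucI)
    show "h (Suc k) \<le> h k" for k using step[of k] m0[of k] by linarith
  qed
  then obtain l where l: "h \<longlonglongrightarrow> l" using nonneg decseq_convergent[of h 0] by blast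
  have "l \<ge> 0" using l nonneg by (intro LIMSEQ_le_const) auto
  have "(\<lambda>k. min (h k / 2) (c * (h k)\<^sup>2)) \<longlonglongrightarrow> min (l / 2) (c * l\<^sup>2)"
    by (intro tendsto_intros l) simp
  moreover have "(\<lambda>k. h k - h (Suc k)) \<longlonglongrightarrow> l - l"
    by (intro tendsto_intros l LIMSEQ_Suc)
  moreover have "min (h k / 2) (c * (h k)\<^sup>2) \<le> h k - h (Suc k)" for k using step[of k] by linarith
  ultimately have "min (l / 2) (c * l\<^sup>2) \<le> l - l" by (intro LIMSEQ_le) auto
  then have "l = 0" using \<open>l \<ge> 0\<close> c by (auto simp: min_def mult_le_0_iff split: if_splits)
  then show ?thesis using l by simp
qed

lemma geometric_rate:
  fixes h :: "nat \<Rightarrow> real"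
  assumes nonneg: "\<And>k. h k \<ge> 0" and q: "q > 0"
    and step: "\<And>k. k \<ge> S \<Longrightarrow> h (Suc k) \<le> q * h k"
  shows "h \<in> O(\<lambda>k. q ^ k)"
proof -
  have bound: "h k \<le> h S / q ^ S * q ^ k" if "k \<ge> S" for k
    using that
  proof (induction k rule: dec_induct)
    case (step k)
    have "h (Suc k) \<le> q * h k" using step.hyps assms(3) by simp
    also have "\<dots> \<le> q * (h S / q ^ S * q ^ k)" using step.IH q by (intro mult_left_mono) auto
    finally show ?case by (simp add: mult_ac)
  qed (use q in simp)
  show ?thesis
    using bound nonneg q
    by (intro bigoI[where c = "h S / q ^ S"] eventually_sequentiallyI[of S]) auto
qed

text \<open>The quantity \<open>h k powr - s\<close> grows at least linearly, because
  \<open>(1 - y) powr - s \<ge> 1 + s y\<close>.\<close>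

lemma power_rate:
  fixes h :: "nat \<Rightarrow> real"
  assumes pos: "\<And>k. h k > 0" and s: "s > 0" and C: "C > 0"
    and step: "\<And>k. k \<ge> S \<Longrightarrow> h (Suc k) \<le> h k - C * h k powr (1 + s)"
  shows "h \<in> O(\<lambda>k. real k powr (- 1 / s))"
proof -
  have inc: "h k powr (- s) + s * C \<le> h (Suc k) powr (- s)" if k: "k \<ge> S" for k
  proof -
    \<comment> \<open>The relative decrease guaranteed in one step. It is below 1 because
      \<open>h (Suc k)\<close> is positive.\<close>
    define y where "y = C * h k powr s"
    have y0: "y > 0" using C pos[of k] by (simp add: y_def)
    have le: "h (Suc k) \<le> h k * (1 - y)"
      using step[OF k] pos[of k] by (simp add: y_def powr_add algebra_simps)
    then have "h k * (1 - y) > 0" using pos[of "Suc k"] by linarith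
    then have y1: "y < 1" using pos[of k] by (simp add: zero_less_mult_iff)
    have "1 + s * y \<le> exp (s * y)" by (rule exp_ge_add_one_self)
    also have "\<dots> \<le> exp (- s * ln (1 - y))"
      using mult_left_mono[of y "- ln (1 - y)" s] ln_le_minus_one[of "1 - y"] y1 s by simp
    also have "\<dots> = (1 - y) powr (- s)" using y1 by (simp add: powr_def)
    finally have "h k powr (- s) * (1 + s * y) \<le> h k powr (- s) * (1 - y) powr (- s)"
      by (rule mult_left_mono) simp
    also have "\<dots> = (h k * (1 - y)) powr (- s)" using pos[of k] y1 by (simp add: powr_mult)
    also have "\<dots> \<le> h (Suc k) powr (- s)"
      using le pos[of "Suc k"] s by (intro powr_mono2') auto
    finally have "h k powr (- s) * (1 + s * y) \<le> h (Suc k) powr (- s)" .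
    moreover have "h k powr (- s) * (s * y) = s * C * (h k powr (- s) * h k powr s)"
      by (simp add: y_def)
    moreover have "h k powr (- s) * h k powr s = 1"
      using pos[of k] by (simp add: powr_add[symmetric])
    ultimately show ?thesis by (simp add: distrib_left)
  qed
  have lin: "s * C * real (k - S) \<le> h k powr (- s)" if "k \<ge> S" for k
    using that
  proof (induction k rule: dec_induct)
    case (step k)
    have "s * C * real (Suc k - S) = s * C * real (k - S) + s * C"
      using step.hyps by (simp add: Suc_diff_le distrib_left)
    then show ?case using step.IH inc[of k] step.hyps by linarith
  qed simp
  let ?c = "s * C / 2"
  have c: "?c > 0" using s C by simp
  \<comment> \<open>\<open>k \<ge> 2 * S + 1\<close> makes \<open>k - S\<close> at least half of
    \<open>k\<close>, whence the 2 in \<open>?c\<close>, and keeps the base of the negative power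
    positive.\<close>
  have bound: "h k \<le> ?c powr (- 1 / s) * real k powr (- 1 / s)" if k: "k \<ge> 2 * S + 1" for k
  proof -
    have "?c * real k \<le> s * C * real (k - S)"
    proof -
      have "real k / 2 \<le> real (k - S)" using k by linarith
      then have "s * C * (real k / 2) \<le> s * C * real (k - S)" using s C by (intro mult_left_mono) auto
      then show ?thesis by simp
    qed
    also have "\<dots> \<le> h k powr (- s)" using lin k by simp
    finally have le: "?c * real k \<le> h k powr (- s)" .
    have "h k = (h k powr (- s)) powr (- 1 / s)" using pos[of k] s by (simp add: powr_powr)
    also have "\<dots> \<le> (?c * real k) powr (- 1 / s)"
      using le c k s by (intro powr_mono2') auto
    also have "\<dots> = ?c powr (- 1 / s) * real k powr (- 1 / s)" using c by (subst powr_mult) auto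
    finally show ?thesis .
  qed
  show ?thesis
    using bound less_imp_le[OF pos]
    by (intro bigoI[where c = "?c powr (- 1 / s)"] eventually_sequentiallyI[of "2 * S + 1"]) auto
qed

lemma descent_rates:
  fixes h :: "nat \<Rightarrow> real"
  assumes pos: "\<And>k. h k > 0" and lim: "h \<longlonglongrightarrow> 0" and C: "C > 0"
    and step: "\<And>k. k \<ge> S \<Longrightarrow> h (Suc k) \<le> h k - min (h k / 2) (C * h k powr (2 * (1 - \<theta>)))"
  shows "\<theta> < 1 / 2 \<Longrightarrow> h \<in> O(\<lambda>k. real k powr (- 1 / (1 - 2 * \<theta>)))"
    and "\<theta> = 1 / 2 \<Longrightarrow> h \<in> O(\<lambda>k. (1 - min (1 / 2) C) ^ k)"
proof -
  assume \<theta>: "\<theta> < 1 / 2"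
  define s where "s = 1 - 2 * \<theta>"
  have s: "s > 0" and exp: "2 * (1 - \<theta>) = 1 + s" using \<theta> by (auto simp: s_def)
  \<comment> \<open>The solution of \<open>C * \<delta> powr s = 1 / 2\<close>: below it the power
    is the smaller branch of the minimum, so the descent takes the pure form of
    \<open>power_rate\<close>.\<close>
  define \<delta> where "\<delta> = (1 / (2 * C)) powr (1 / s)"
  have "\<delta> > 0" using C by (simp add: \<delta>_def)
  then obtain T where T: "\<And>k. k \<ge> T \<Longrightarrow> h k < \<delta>"
    using order_tendstoD(2)[OF lim] unfolding eventually_sequentially by blast
  show "h \<in> O(\<lambda>k. real k powr (- 1 / (1 - 2 * \<theta>)))"
    unfolding s_def[symmetric]
  proof (rule power_rate[OF pos s C])
    fix k assume k: "k \<ge> max S T"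
    have "h k powr s \<le> \<delta> powr s" using T[of k] k pos[of k] s by (intro powr_mono2) auto
    also have "\<dots> = 1 / (2 * C)" using C s by (simp add: \<delta>_def powr_powr)
    finally have "C * h k powr s \<le> 1 / 2" using C by (simp add: field_simps)
    then have "h k * (C * h k powr s) \<le> h k * (1 / 2)" using pos[of k] by (intro mult_left_mono) auto
    then have "C * h k powr (1 + s) \<le> h k / 2" using pos[of k] by (simp add: powr_add mult_ac)
    then show "h (Suc k) \<le> h k - C * h k powr (1 + s)"
      using step[of k] k unfolding exp by (simp add: min_absorb2)
  qed
next
  assume \<theta>: "\<theta> = 1 / 2"
  show "h \<in> O(\<lambda>k. (1 - min (1 / 2) C) ^ k)"
  proof (rule geometric_rate[where S = S])
    show "h (Suc k) \<le> (1 - min (1 / 2) C) * h k" if "k \<ge> S" for k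
    proof -
      \<comment> \<open>For this exponent the power is \<open>h k\<close> itself, so both branches
        are linear and share the factor \<open>h k\<close>.\<close>
      have "min (h k / 2) (C * h k) = min (1 / 2) C * h k"
        using pos[of k] min_mult_distrib_right[of "1/2" C "h k"] by simp
      then show ?thesis using step[OF that] pos[of k] \<theta> by (simp add: left_diff_distrib)
    qed
  qed (use pos less_imp_le in \<open>auto simp: min_def\<close>)
qed

section \<open>Gradient, feasible directions and optimality gap\<close>

locale rfw_problem = riem_mfd M
  for M :: "('m::{t2_space, second_countable_topology}, 'e::euclidean_space) riem" +
  fixes X W :: "'m set" and f :: "'m \<Rightarrow> real" and L :: real
  assumes X_ne: "X \<noteq> {}" and X_compact: "compact X"
    and X_convex: "weakly_minimizing_convex M X"
    and X_W: "X \<subseteq> W" and f_diff: "differentiable_fun_on M W f"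
    and L_pos: "L > 0" and reg: "regularity M f X L"
begin

lemma f_chart_has_derivative:
  assumes "x \<in> X" "c \<in> charts_at M x"
  shows "((f \<circ> chart_inv c) has_derivative
    frechet_derivative (f \<circ> chart_inv c) (at (chart_map c x))) (at (chart_map c x))"
proof -
  have "(f \<circ> chart_inv c) differentiable (at (chart_map c x))"
    using f_diff X_W assms unfolding differentiable_fun_on_def by blast
  then show ?thesis unfolding frechet_derivative_works .
qed

lemma f_derivative_chart_independent:
  assumes x: "x \<in> X" and c: "c \<in> charts_at M x" and c': "c' \<in> charts_at M x"
    and v: "v \<in> tangent_space M x"
  shows "frechet_derivative (f \<circ> chart_inv c) (at (chart_map c x)) (v c) =
    frechet_derivative (f \<circ> chart_inv c') (at (chart_map c' x)) (v c')"
proof -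
  note cD = charts_at_D[OF c] and cD' = charts_at_D[OF c']
  let ?U = "chart_map c ` (chart_dom c \<inter> chart_dom c')"
  have tr: "transition c c' (chart_map c x) = chart_map c' x" using cD by simp
  have "(((f \<circ> chart_inv c') \<circ> transition c c') has_derivative
     (frechet_derivative (f \<circ> chart_inv c') (at (chart_map c' x)) \<circ>
      frechet_derivative (transition c c') (at (chart_map c x)))) (at (chart_map c x))"
    by (rule diff_chain_at) (use transition_has_derivative[OF c c'] f_chart_has_derivative[OF x c'] tr in auto)
  moreover have "frechet_derivative (f \<circ> chart_inv c) (at (chart_map c x)) =
     frechet_derivative ((f \<circ> chart_inv c') \<circ> transition c c') (at (chart_map c x))"
    by (rule frechet_derivative_cong_open[OF chart_map_open[OF cD(1) chart_homeo(1)[OF cD'(1)]]])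
      (use cD cD' in auto)
  moreover have "v c' = frechet_derivative (transition c c') (at (chart_map c x)) (v c)"
    using v c c' unfolding tangent_space_def by blast
  ultimately show ?thesis by (simp add: frechet_derivative_eqI)
qed

text \<open>Riesz representation in one chart gives existence and uniqueness; the chain rule moves
  the formula to the other charts, as the description in \<open>rgrad\<close> quantifies over all of
  them.\<close>

lemma rgrad:
  assumes x: "x \<in> X"
  shows "rgrad M f x \<in> tangent_space M x"
    and "v \<in> tangent_space M x \<Longrightarrow> c' \<in> charts_at M x \<Longrightarrow>
      metric M x (rgrad M f x) v = frechet_derivative (f \<circ> chart_inv c') (at (chart_map c' x)) (v c')"
proof -
  let ?P = "\<lambda>w. w \<in> tangent_space M x \<and> (\<forall>v\<in>tangent_space M x. \<forall>c\<in>charts_at M x.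
        metric M x w v = frechet_derivative (f \<circ> chart_inv c) (at (chart_map c x)) (v c))"
  obtain c where c: "c \<in> charts_at M x" using charts_exist by blast
  note cD = charts_at_D[OF c]
  let ?\<phi> = "frechet_derivative (f \<circ> chart_inv c) (at (chart_map c x))"
  have "\<exists>!e. \<forall>w. metric_coord M c (chart_map c x) e w = ?\<phi> w"
    by (rule metric_coord_Riesz[OF cD(1) chart_map_img[OF cD(2)]
          has_derivative_linear[OF f_chart_has_derivative[OF x c]]])
  then obtain e where e: "\<And>w. metric_coord M c (chart_map c x) e w = ?\<phi> w"
    and uniq: "\<And>e'. (\<And>w. metric_coord M c (chart_map c x) e' w = ?\<phi> w) \<Longrightarrow> e' = e" by blast
  have "?P (tvec M c x e)"
  proof (intro conjI ballI)
    show t: "tvec M c x e \<in> tangent_space M x" by (rule tvec_in_tangent_space[OF c])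
    fix v c' assume v: "v \<in> tangent_space M x" and c': "c' \<in> charts_at M x"
    have "metric M x (tvec M c x e) v = ?\<phi> (v c)"
      using metric_eq_coord[OF c t v] e c by simp
    then show "metric M x (tvec M c x e) v = frechet_derivative (f \<circ> chart_inv c') (at (chart_map c' x)) (v c')"
      using f_derivative_chart_independent[OF x c c' v] by simp
  qed
  moreover have "w = tvec M c x e" if w: "?P w" for w
  proof -
    have "w c = e"
    proof (rule uniq)
      fix a
      have "metric M x w (tvec M c x a) = ?\<phi> a"
        using w c tvec_in_tangent_space[OF c, of a] by simp
      then show "metric_coord M c (chart_map c x) (w c) a = ?\<phi> a"
        using metric_eq_coord[OF c conjunct1[OF w] tvec_in_tangent_space[OF c, of a]] c by simp
    qed
    then show ?thesis using tvec_of_tangent[OF c conjunct1[OF w]] by simp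
  qed
  ultimately have "?P (rgrad M f x)"
    unfolding rgrad_def by (rule theI)
  then show "rgrad M f x \<in> tangent_space M x"
    "v \<in> tangent_space M x \<Longrightarrow> c' \<in> charts_at M x \<Longrightarrow>
      metric M x (rgrad M f x) v = frechet_derivative (f \<circ> chart_inv c') (at (chart_map c' x)) (v c')"
    by blast+
qed

lemma f_along_geodesic:
  assumes g: "geodesic M {0..1} \<gamma>" and x: "\<gamma> 0 \<in> X"
  shows "((\<lambda>t. f (\<gamma> t)) has_vector_derivative
     metric M (\<gamma> 0) (rgrad M f (\<gamma> 0)) (velocity M {0..1} \<gamma> 0)) (at 0 within {0..1})"
proof -
  obtain c where c: "c \<in> charts_at M (\<gamma> 0)" using charts_exist by blast
  note cD = charts_at_D[OF c]
  have 0: "(0::real) \<in> {0..1}" by simp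
  obtain d where d: "d > 0" and dom: "\<And>r. r \<in> {0..1} \<Longrightarrow> \<bar>r - 0\<bar> < d \<Longrightarrow> \<gamma> r \<in> chart_dom c"
    using continuous_on_stays_near[OF geodesicD(1)[OF g] 0 chart_homeo(1)[OF cD(1)] cD(2)] by blast
  have y': "((chart_map c \<circ> \<gamma>) has_vector_derivative velocity M {0..1} \<gamma> 0 c) (at 0 within {0..1})"
    using geodesicD(2)[OF g cD(1) 0 cD(2)] c by (simp add: velocity_def)
  have "(((f \<circ> chart_inv c) \<circ> (chart_map c \<circ> \<gamma>)) has_vector_derivative
     frechet_derivative (f \<circ> chart_inv c) (at (chart_map c (\<gamma> 0))) (velocity M {0..1} \<gamma> 0 c)) (at 0 within {0..1})"
    by (rule vector_derivative_diff_chain_within[OF y'])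
      (simp only: o_apply[of "chart_map c" \<gamma>] has_derivative_at_withinI[OF f_chart_has_derivative[OF x c]])
  then have "(((f \<circ> chart_inv c) \<circ> (chart_map c \<circ> \<gamma>)) has_vector_derivative
     metric M (\<gamma> 0) (rgrad M f (\<gamma> 0)) (velocity M {0..1} \<gamma> 0)) (at 0 within {0..1})"
    using rgrad(2)[OF x geodesic_velocity_tangent[OF g 0] c] by simp
  then show ?thesis
    by (rule has_vector_derivative_transform_within[OF _ d 0])
      (use dom cD in \<open>auto simp: dist_real_def\<close>)
qed

text \<open>The initial velocity of a minimizing geodesic in \<open>X\<close> is feasible. By
  convexity every difference quotient of \<open>f\<close> along the geodesic at time 0 is at most
  \<open>f y - f x\<close>, and so is its limit, the directional derivative.\<close>

lemma feasible_direction_to: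
  assumes x: "x \<in> X" and y: "y \<in> X"
  shows "\<exists>v\<in>feasible_dirs M X x. rexp M x v = y \<and> tnorm M x v = rdist M x y \<and>
     metric M x (rgrad M f x) v \<le> f y - f x"
proof -
  obtain \<gamma> where g: "geodesic M {0..1} \<gamma>" and ends: "\<gamma> 0 = x" "\<gamma> 1 = y"
    and len: "curve_length M \<gamma> = rdist M x y" and im: "\<gamma> ` {0..1} \<subseteq> X"
    using X_convex x y unfolding weakly_minimizing_convex_def minimizing_geodesic_def by metis
  define v where "v = velocity M {0..1} \<gamma> 0"
  have ex: "rexp M x (tscale t v) = \<gamma> t" if "t \<in> {0..1}" for t
    using rexp_scaled_geodesic[OF g that] by (simp add: v_def ends)
  have ex1: "rexp M x v = y" using rexp_geodesic[OF g] by (simp add: v_def ends)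
  have nv: "tnorm M x v = rdist M x y" using geodesic_length[OF g] len by (simp add: v_def ends)
  have "v \<in> tangent_space M x"
    using geodesic_velocity_tangent[OF g, of 0] by (simp add: v_def ends)
  then have v: "v \<in> feasible_dirs M X x"
    using ex ex1 nv y im by (auto simp: feasible_dirs_def)
  have conv: "f (\<gamma> t) \<le> (1 - t) * f x + t * f y" if "t \<in> {0..1}" for t
    using reg x v that ex[OF that] ex1 unfolding regularity_def by metis
  have "((\<lambda>t. f (\<gamma> t)) has_vector_derivative metric M x (rgrad M f x) v) (at 0 within {0..1})"
    using f_along_geodesic[OF g] x by (simp add: ends v_def)
  then have "((\<lambda>t. (f (\<gamma> t) - f (\<gamma> 0)) / (t - 0)) \<longlongrightarrow> metric M x (rgrad M f x) v) (at 0 within {0..1})"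
    unfolding has_real_derivative_iff_has_vector_derivative[symmetric] has_field_derivative_iff .
  moreover have "\<forall>\<^sub>F t in at 0 within {0..1}. (f (\<gamma> t) - f (\<gamma> 0)) / (t - 0) \<le> f y - f x"
    unfolding eventually_at_filter
  proof (rule always_eventually, intro allI impI)
    fix t :: real assume t: "t \<noteq> 0" "t \<in> {0..1}"
    then have "f (\<gamma> t) - f x \<le> t * (f y - f x)" using conv[of t] by (simp add: algebra_simps)
    then show "(f (\<gamma> t) - f (\<gamma> 0)) / (t - 0) \<le> f y - f x"
      using t by (simp add: ends field_simps)
  qed
  ultimately have "metric M x (rgrad M f x) v \<le> f y - f x"
    by (rule tendsto_upperbound) (rule Icc_not_bot, simp_all)
  then show ?thesis using v ex1 nv by blast
qed

lemma f_continuous: "continuous_on X f"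
  unfolding continuous_on_eq_continuous_within
proof
  fix x assume x: "x \<in> X"
  obtain c where c: "c \<in> charts_at M x" using charts_exist by blast
  note cD = charts_at_D[OF c]
  have 1: "isCont (f \<circ> chart_inv c) (chart_map c x)"
    by (rule has_derivative_continuous[OF f_chart_has_derivative[OF x c]])
  have 2: "isCont (chart_map c) x"
    using continuous_on_chart_map[OF cD(1)] chart_homeo(1)[OF cD(1)] cD(2)
    by (simp add: continuous_on_eq_continuous_at)
  have "isCont ((f \<circ> chart_inv c) \<circ> chart_map c) x" by (rule continuous_at_compose[OF 2 1])
  moreover have "\<forall>\<^sub>F z in nhds x. ((f \<circ> chart_inv c) \<circ> chart_map c) z = f z"
    using eventually_nhds_in_open[OF chart_homeo(1)[OF cD(1)] cD(2)]
    by eventually_elim (use cD(1) in simp)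
  ultimately have "isCont f x" using isCont_cong by blast
  then show "continuous (at x within X) f" by (rule continuous_at_imp_continuous_within)
qed

lemma optimizer_exists: "\<exists>y. y \<in> optimizers f X"
proof -
  obtain y where "y \<in> X" "\<And>z. z \<in> X \<Longrightarrow> f y \<le> f z"
    using continuous_attains_inf[OF X_compact X_ne f_continuous] by blast
  then show ?thesis by (auto simp: optimizers_def is_arg_min_def not_less)
qed

lemma optimizers_subset: "optimizers f X \<subseteq> X"
  by (auto simp: optimizers_def is_arg_min_def)

lemma min_value_optimizer:
  assumes "y \<in> optimizers f X"
  shows "min_value f X = f y"
  unfolding min_value_def
  using assms by (intro cInf_eq_minimum) (auto simp: optimizers_def is_arg_min_def not_less)

lemma gap_nonneg: "x \<in> X \<Longrightarrow> gap f X x \<ge> 0"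
  using optimizer_exists min_value_optimizer
  by (fastforce simp: gap_def optimizers_def is_arg_min_def not_less)

lemma gap_eq_0_iff:
  assumes x: "x \<in> X"
  shows "gap f X x = 0 \<longleftrightarrow> x \<in> optimizers f X"
proof
  obtain y where y: "y \<in> optimizers f X" using optimizer_exists by blast
  assume "gap f X x = 0"
  then have "f x = f y" using min_value_optimizer[OF y] by (simp add: gap_def)
  then show "x \<in> optimizers f X" using x y by (auto simp: optimizers_def is_arg_min_def)
qed (simp add: gap_def min_value_optimizer)

text \<open>Inside \<open>X\<close> the distance is attained by a geodesic, so its sign can be read
  off from the norm of the initial velocity.\<close>

lemma rdist_nonneg:
  assumes "x \<in> X" "y \<in> X"
  shows "rdist M x y \<ge> 0"
proof -
  obtain v where "v \<in> tangent_space M x" "tnorm M x v = rdist M x y"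
    using feasible_direction_to[OF assms] by (auto simp: feasible_dirs_def)
  then show ?thesis using tnorm_nonneg[of v x] by simp
qed

lemma rdist_le_diam:
  assumes "x \<in> X" "y \<in> X"
  shows "rdist M x y \<le> rdiam M X"
proof -
  obtain R where "\<And>x y. x \<in> X \<Longrightarrow> y \<in> X \<Longrightarrow> rdist M x y \<le> R"
    using rdist_bounded[OF X_compact X_convex] by blast
  then show ?thesis
    unfolding rdiam_def using assms by (intro cSup_upper bdd_aboveI[of _ R]) auto
qed

lemma feasible_dirs_D:
  assumes "x \<in> X" "v \<in> feasible_dirs M X x"
  shows "v \<in> tangent_space M x" "tnorm M x v \<ge> 0" "tnorm M x v \<le> rdiam M X"
proof -
  show "v \<in> tangent_space M x" using assms by (simp add: feasible_dirs_def)
  then show "tnorm M x v \<ge> 0" by (rule tnorm_nonneg)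
  show "tnorm M x v \<le> rdiam M X" using assms rdist_le_diam by (simp add: feasible_dirs_def)
qed

section \<open>The decrease in one step\<close>

lemma gap_le_step_gap:
  assumes x: "x \<in> X" and v: "v \<in> fw_oracle M f X x"
  shows "gap f X x \<le> step_gap M f x v"
proof -
  obtain y where y: "y \<in> optimizers f X" using optimizer_exists by blast
  then have "y \<in> X" using optimizers_subset by blast
  from feasible_direction_to[OF x this] obtain w where
    w: "w \<in> feasible_dirs M X x" "metric M x (rgrad M f x) w \<le> f y - f x" by blast
  have "metric M x (rgrad M f x) v \<le> metric M x (rgrad M f x) w"
    using v w(1) by (auto simp: fw_oracle_def is_arg_min_def not_less)
  then show ?thesis using w(2) min_value_optimizer[OF y] by (simp add: gap_def step_gap_def)
qed

lemma oracle_feasible: "v \<in> fw_oracle M f X x \<Longrightarrow> v \<in> feasible_dirs M X x"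
  by (auto simp: fw_oracle_def is_arg_min_def)

lemma fw_gap_eq:
  assumes "v \<in> fw_oracle M f X x"
  shows "fw_gap M f X x = step_gap M f x v"
proof -
  have "(INF v\<in>feasible_dirs M X x. metric M x (rgrad M f x) v) = metric M x (rgrad M f x) v"
    using assms by (intro cInf_eq_minimum) (auto simp: fw_oracle_def is_arg_min_def not_less)
  then show ?thesis by (simp add: fw_gap_def step_gap_def)
qed

text \<open>The \<open>SUP\<close> is an upper bound because the diameter bounds all these
  lengths.\<close>

lemma length_le_max_oracle_length:
  assumes "x \<in> X" "v \<in> fw_oracle M f X x"
  shows "tnorm M x v \<le> max_oracle_length M f X x"
  unfolding max_oracle_length_def
  using assms feasible_dirs_D(3)[OF assms(1) oracle_feasible]
  by (intro cSUP_upper bdd_aboveI[of _ "rdiam M X"]) auto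

text \<open>The zero direction has gap 0. This justifies the divisions by the length.\<close>

lemma step_length_pos:
  assumes x: "x \<in> X" and v: "v \<in> fw_oracle M f X x" and g: "step_gap M f x v \<noteq> 0"
  shows "tnorm M x v > 0"
proof -
  note D = feasible_dirs_D[OF x oracle_feasible[OF v]]
  have "v \<noteq> (\<lambda>_. 0)" using g metric_zero_right[OF rgrad(1)[OF x]] by (auto simp: step_gap_def)
  then show ?thesis using tnorm_eq_0[OF D(1)] D(2) by fastforce
qed

lemma short_step_descent:
  assumes x: "x \<in> X" and v: "v \<in> fw_oracle M f X x" and g: "step_gap M f x v \<noteq> 0" and Lh: "L \<le> Lh"
  defines "x' \<equiv> rexp M x (tscale (short_step M f Lh x v) v)"
  shows "x' \<in> X"
    and "gap f X x' \<le> gap f X x -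
       min (step_gap M f x v / 2) ((step_gap M f x v)\<^sup>2 / (2 * Lh * (tnorm M x v)\<^sup>2))"
proof -
  \<comment> \<open>A nonzero oracle gap is positive, as it dominates the nonnegative
    \<open>gap\<close>.\<close>
  have pos: "step_gap M f x v > 0" "tnorm M x v > 0"
    using gap_le_step_gap[OF x v] gap_nonneg[OF x] g step_length_pos[OF x v g] by auto
  note sd = short_step_decrease[OF pos L_pos Lh]
  have \<eta>: "short_step M f Lh x v \<in> {0..1}" using sd(1,2) by (simp add: short_step_def)
  have vf: "v \<in> feasible_dirs M X x" by (rule oracle_feasible[OF v])
  then show "x' \<in> X" using \<eta> by (auto simp: x'_def feasible_dirs_def)
  have "f x' \<le> f x + short_step M f Lh x v * metric M x (rgrad M f x) v +
      L / 2 * (short_step M f Lh x v)\<^sup>2 * (tnorm M x v)\<^sup>2"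
    using reg x vf \<eta> unfolding regularity_def x'_def by blast
  then have "f x' \<le> f x + (- short_step M f Lh x v * step_gap M f x v +
      L / 2 * (short_step M f Lh x v)\<^sup>2 * (tnorm M x v)\<^sup>2)"
    by (simp add: step_gap_def)
  then show "gap f X x' \<le> gap f X x -
       min (step_gap M f x v / 2) ((step_gap M f x v)\<^sup>2 / (2 * Lh * (tnorm M x v)\<^sup>2))"
    using sd(3) unfolding short_step_def gap_def by linarith
qed

text \<open>By convexity along a minimizing geodesic to an optimizer and Cauchy-Schwarz,
  \<open>gap x \<le> \<parallel>grad f x\<parallel> dist_opt x\<close>, so the denominator in the scaling condition is not 0.\<close>

lemma dist_opt_pos:
  assumes x: "x \<in> X" and no: "x \<notin> optimizers f X"
  shows "dist_opt M f X x > 0"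
proof -
  have gap: "gap f X x > 0" using gap_nonneg[OF x] gap_eq_0_iff[OF x] no by fastforce
  let ?G = "tnorm M x (rgrad M f x)"
  have G: "?G \<ge> 0" by (rule tnorm_nonneg[OF rgrad(1)[OF x]])
  have le: "gap f X x \<le> ?G * rdist M x y" if y: "y \<in> optimizers f X" for y
  proof -
    have yX: "y \<in> X" using y optimizers_subset by blast
    obtain w where w: "w \<in> feasible_dirs M X x" "tnorm M x w = rdist M x y"
      "metric M x (rgrad M f x) w \<le> f y - f x"
      using feasible_direction_to[OF x yX] by blast
    have "gap f X x \<le> \<bar>metric M x (rgrad M f x) w\<bar>"
      using w(3) min_value_optimizer[OF y] by (simp add: gap_def)
    also have "\<dots> \<le> ?G * tnorm M x w"
      by (rule metric_Cauchy_Schwarz[OF rgrad(1)[OF x] feasible_dirs_D(1)[OF x w(1)]])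
    finally show ?thesis using w(2) by simp
  qed
  obtain y where y: "y \<in> optimizers f X" using optimizer_exists by blast
  have "?G \<noteq> 0" using le[OF y] gap by auto
  then have Gpos: "?G > 0" using G by simp
  have "gap f X x / ?G \<le> dist_opt M f X x"
    unfolding dist_opt_def
    using y le Gpos by (intro cINF_greatest) (auto simp: field_simps)
  moreover have "gap f X x / ?G > 0" using gap Gpos by simp
  ultimately show ?thesis by linarith
qed

section \<open>Error bound and scaling near the optimizers\<close>

lemma scaled_step_bound:
  assumes x: "x \<in> X" and v: "v \<in> fw_oracle M f X x" and g: "step_gap M f x v \<noteq> 0"
    and no: "x \<notin> optimizers f X"
    and hb: "hoelder_error_bound M f X c \<theta> R_H" "dist_opt M f X x \<le> R_H"
    and sc: "length_normalized_scaling M f X \<sigma> R_S" "dist_opt M f X x \<le> R_S"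
    and pos: "c > 0" "\<sigma> > 0"
  shows "\<sigma> / c * gap f X x powr (1 - \<theta>) \<le> step_gap M f x v / tnorm M x v"
proof -
  let ?h = "gap f X x" and ?r = "dist_opt M f X x" and ?l = "tnorm M x v"
  have h: "?h > 0" using gap_nonneg[OF x] gap_eq_0_iff[OF x] no by fastforce
  have r: "?r > 0" by (rule dist_opt_pos[OF x no])
  have l: "?l > 0" by (rule step_length_pos[OF x v g])
  have gpos: "step_gap M f x v > 0" using gap_le_step_gap[OF x v] h by linarith
  have "?r \<le> c * ?h powr \<theta>" using hb x unfolding hoelder_error_bound_def by blast
  \<comment> \<open>The exponent \<open>1 - \<theta>\<close> arises here: the distance in the
    denominator is replaced by its upper bound \<open>c * ?h powr \<theta>\<close>.\<close>
  then have "\<sigma> * ?h / (c * ?h powr \<theta>) \<le> \<sigma> * ?h / ?r"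
    using pos h r by (intro divide_left_mono mult_pos_pos) auto
  also have "\<dots> \<le> fw_gap M f X x / max_oracle_length M f X x"
    using sc x no unfolding length_normalized_scaling_def by blast
  \<comment> \<open>Any choice of the oracle is covered: all choices have the same gap, and none is
    longer than \<open>max_oracle_length\<close>.\<close>
  also have "\<dots> \<le> step_gap M f x v / ?l"
    unfolding fw_gap_eq[OF v]
    using length_le_max_oracle_length[OF x v] l gpos by (intro divide_left_mono) auto
  finally show ?thesis using h by (simp add: powr_diff)
qed

text \<open>Around each optimizer there is an open set of points at distance at most
  \<open>R\<close>, obtained from coordinate segments in a ball of radius \<open>R / B\<close>. On
  the compact rest \<open>K\<close> of \<open>X\<close>, if there is any, \<open>f\<close> attains a
  minimum, which lies above \<open>min_value f X\<close>; its gap serves as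
  \<open>\<delta>\<close>.\<close>

lemma dist_opt_small:
  assumes R: "R > 0"
  shows "\<exists>\<delta>>0. \<forall>x\<in>X. gap f X x < \<delta> \<longrightarrow> dist_opt M f X x \<le> R"
proof -
  have "\<exists>U. open U \<and> y \<in> U \<and> (\<forall>x\<in>U. rdist M x y \<le> R)" for y
  proof -
    obtain U c B where U: "open U" "y \<in> U" and c: "c \<in> charts_at M y" "U \<subseteq> chart_dom c" and B: "B > 0"
      and curve: "\<And>x z. x \<in> U \<Longrightarrow> z \<in> U \<Longrightarrow> \<exists>\<gamma>. piecewise_C1_curve M \<gamma> \<and> \<gamma> 0 = x \<and> \<gamma> 1 = z \<and>
       curve_length M \<gamma> \<le> B * norm (chart_map c x - chart_map c z)"
      using local_curves[of y] by metis
    define V where "V = U \<inter> (chart_dom c \<inter> chart_map c -` ball (chart_map c y) (R / B))"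
    have "open V"
      unfolding V_def using U(1)
      by (intro open_Int continuous_open_preimage[OF continuous_on_chart_map] chart_homeo(1) open_ball
          charts_at_D(1)[OF c(1)])
    moreover have "y \<in> V" using U(2) c R B by (auto simp: V_def)
    moreover have "rdist M x y \<le> R" if x: "x \<in> V" for x
    proof -
      obtain \<gamma> where \<gamma>: "piecewise_C1_curve M \<gamma>" "\<gamma> 0 = x" "\<gamma> 1 = y"
        "curve_length M \<gamma> \<le> B * norm (chart_map c x - chart_map c y)"
        using curve[of x y] x U(2) by (auto simp: V_def)
      have "norm (chart_map c x - chart_map c y) \<le> R / B"
        using x by (simp add: V_def dist_norm norm_minus_commute)
      then have "B * norm (chart_map c x - chart_map c y) \<le> R" using B by (simp add: field_simps)
      then show ?thesis using rdist_le_length[OF \<gamma>(1-3)] \<gamma>(4) by linarith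
    qed
    ultimately show ?thesis by blast
  qed
  then obtain U where U: "\<And>y. open (U y)" "\<And>y. y \<in> U y" "\<And>y x. x \<in> U y \<Longrightarrow> rdist M x y \<le> R"
    by metis
  have small: "dist_opt M f X x \<le> R" if x: "x \<in> X" and y: "y \<in> optimizers f X" "x \<in> U y" for x y
  proof -
    have "bdd_below ((\<lambda>y. rdist M x y) ` optimizers f X)"
      using rdist_nonneg[OF x] optimizers_subset by (intro bdd_belowI[of _ 0]) auto
    then have "dist_opt M f X x \<le> rdist M x y" unfolding dist_opt_def using y(1) by (rule cINF_lower)
    also have "\<dots> \<le> R" by (rule U(3)[OF y(2)])
    finally show ?thesis .
  qed
  define K where "K = X - (\<Union>y\<in>optimizers f X. U y)"
  show ?thesis
  proof (cases "K = {}")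
    case True
    then show ?thesis using small by (intro exI[of _ 1]) (auto simp: K_def)
  next
    case False
    have "compact K" unfolding K_def using U(1) by (intro compact_diff X_compact) auto
    moreover have "continuous_on K f" by (rule continuous_on_subset[OF f_continuous]) (auto simp: K_def)
    ultimately obtain z where z: "z \<in> K" "\<And>x. x \<in> K \<Longrightarrow> f z \<le> f x"
      using continuous_attains_inf[of K f] False by blast
    have zX: "z \<in> X" and "z \<notin> optimizers f X" using z(1) U(2) by (auto simp: K_def)
    then have "gap f X z > 0" using gap_nonneg[OF zX] gap_eq_0_iff[OF zX] by fastforce
    moreover have "dist_opt M f X x \<le> R" if x: "x \<in> X" "gap f X x < gap f X z" for x
    proof -
      have "x \<notin> K" using z(2)[of x] x(2) by (auto simp: gap_def)
      then show ?thesis using x(1) small[OF x(1)] by (auto simp: K_def)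
    qed
    ultimately show ?thesis by blast
  qed
qed

end

theorem proposition4p6:
  fixes M :: "('m::{t2_space, second_countable_topology}, 'e::euclidean_space) riem"
    and X W :: "'m set"
    and f :: "'m \<Rightarrow> real"
    and L Lh :: real
    and x :: "nat \<Rightarrow> 'm"
    and v :: "nat \<Rightarrow> ('m, 'e) tangent"
    and N :: enat
    and D :: real
    and h :: "nat \<Rightarrow> real"
  assumes "riemannian_manifold M"
    and "connected (UNIV :: 'm set)"
    and "complete_manifold M"
    and "X \<noteq> {}" and "compact X"
    and "D = rdiam M X" and "D > 0"
    and "weakly_minimizing_convex M X"
    and "open W" and "X \<subseteq> W" and "differentiable_fun_on M W f"
    and "L > 0" and "regularity M f X L"
    and "Lh \<ge> L"
    and "short_step_RFW_run M f X Lh x v N"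
    and "\<And>k. h k = gap f X (x k)"
  shows "(\<forall>k. enat k < N \<longrightarrow>
            x (Suc k) \<in> X \<and>
            h (Suc k) \<le> h k - min (h k / 2) ((h k)\<^sup>2 / (2 * Lh * D\<^sup>2))) \<and>
         ((\<exists>n. N = enat n \<and> x n \<in> optimizers f X) \<or> (N = \<infinity> \<and> h \<longlonglongrightarrow> 0)) \<and>
         (\<forall>c \<theta> R_H \<sigma> R_S C.
            c > 0 \<and> 0 < \<theta> \<and> \<theta> \<le> 1 / 2 \<and> R_H > 0 \<and> hoelder_error_bound M f X c \<theta> R_H \<and>
            \<sigma> > 0 \<and> R_S > 0 \<and> length_normalized_scaling M f X \<sigma> R_S \<and>
            C = \<sigma>\<^sup>2 / (2 * Lh * c\<^sup>2) \<longrightarrow>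
            (\<exists>S. \<forall>k\<ge>S. enat k < N \<longrightarrow>
               h (Suc k) \<le> h k - min (h k / 2) (C * h k powr (2 * (1 - \<theta>)))) \<and>
            (N = \<infinity> \<and> \<theta> < 1 / 2 \<longrightarrow> h \<in> O(\<lambda>k. real k powr (- 1 / (1 - 2 * \<theta>)))) \<and>
            (N = \<infinity> \<and> \<theta> = 1 / 2 \<longrightarrow> h \<in> O(\<lambda>k. (1 - min (1 / 2) C) ^ k)))"
proof -
  interpret rfw_problem M X W f L
    using assms by unfold_locales
  note D = assms(6,7) and Lh = assms(14) and hdef = assms(16)
  have Lh0: "Lh > 0" using L_pos Lh by linarith
  have x0: "x 0 \<in> X" and
    chosen: "\<And>k. enat k \<le> N \<Longrightarrow> v k \<in> fw_oracle M f X (x k)" and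
    nonterm: "\<And>k. enat k < N \<Longrightarrow> step_gap M f (x k) (v k) \<noteq> 0" and
    xSuc: "\<And>k. enat k < N \<Longrightarrow> x (Suc k) = rexp M (x k) (tscale (short_step M f Lh (x k) (v k)) (v k))" and
    final: "\<And>n. N = enat n \<Longrightarrow> step_gap M f (x n) (v n) = 0"
    using assms(15) unfolding short_step_RFW_run_def by auto
  \<comment> \<open>Up to and including \<open>N\<close>: the terminal iterate is still produced by
    the run, while later values of \<open>x\<close> are arbitrary.\<close>
  have xX: "x k \<in> X" if "enat k \<le> N" for k
    using that
  proof (induction k)
    case (Suc k)
    then have k: "enat k < N" using Suc_ile_eq by blast
    show ?case
      unfolding xSuc[OF k]
      using Suc.IH k chosen[of k] nonterm[OF k] Lh by (intro short_step_descent(1)) auto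
  qed (rule x0)
  have xSX: "x (Suc k) \<in> X" if "enat k < N" for k
    using that xX[of "Suc k"] Suc_ile_eq by blast
  define g where "g k = step_gap M f (x k) (v k)" for k
  define l where "l k = tnorm M (x k) (v k)" for k
  have step: "h (Suc k) \<le> h k - min (g k / 2) ((g k)\<^sup>2 / (2 * Lh * (l k)\<^sup>2))" if k: "enat k < N" for k
    using short_step_descent(2)[OF xX chosen nonterm[OF k] Lh] k
    unfolding hdef xSuc[OF k] g_def l_def by simp
  have lpos: "l k > 0" and lD: "l k \<le> D" and hg: "h k \<le> g k" and h0: "h k \<ge> 0" and gpos: "g k > 0"
    if k: "enat k < N" for k
  proof -
    have k': "enat k \<le> N" using k by simp
    show "l k > 0" unfolding l_def by (rule step_length_pos[OF xX[OF k'] chosen[OF k'] nonterm[OF k]])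
    show "l k \<le> D" unfolding l_def D(1)
      by (rule feasible_dirs_D(3)[OF xX[OF k'] oracle_feasible[OF chosen[OF k']]])
    show "h k \<le> g k" unfolding hdef g_def by (rule gap_le_step_gap[OF xX[OF k'] chosen[OF k']])
    moreover show "h k \<ge> 0" unfolding hdef by (rule gap_nonneg[OF xX[OF k']])
    ultimately show "g k > 0" using nonterm[OF k] unfolding g_def by linarith
  qed
  have basic: "h (Suc k) \<le> h k - min (h k / 2) ((h k)\<^sup>2 / (2 * Lh * D\<^sup>2))" if k: "enat k < N" for k
  proof -
    have "(h k)\<^sup>2 / (2 * Lh * D\<^sup>2) \<le> (g k)\<^sup>2 / (2 * Lh * (l k)\<^sup>2)"
      using lpos[OF k] lD[OF k] hg[OF k] h0[OF k] Lh0
      by (intro frac_le mult_left_mono power_mono) auto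
    then have "min (h k / 2) ((h k)\<^sup>2 / (2 * Lh * D\<^sup>2)) \<le> min (g k / 2) ((g k)\<^sup>2 / (2 * Lh * (l k)\<^sup>2))"
      using hg[OF k] by (intro min.mono) auto
    then show ?thesis using step[OF k] by linarith
  qed
  \<comment> \<open>A strict decrease ends at a nonnegative value. Hence no nonterminal iterate is
    an optimizer, as the scaling condition and the negative powers in \<open>power_rate\<close>
    require.\<close>
  have hpos: "h k > 0" if k: "enat k < N" for k
  proof -
    have "h (Suc k) \<ge> 0" unfolding hdef by (rule gap_nonneg[OF xSX[OF k]])
    moreover have "min (g k / 2) ((g k)\<^sup>2 / (2 * Lh * (l k)\<^sup>2)) > 0"
      using gpos[OF k] lpos[OF k] Lh0 by simp
    ultimately show ?thesis using step[OF k] by linarith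
  qed
  have lim: "h \<longlonglongrightarrow> 0" if N: "N = \<infinity>"
  proof (rule quadratic_descent_tendsto_zero)
    show "h k \<ge> 0" for k using h0 N by simp
    show "1 / (2 * Lh * D\<^sup>2) > 0" using Lh0 D by simp
    show "h (Suc k) \<le> h k - min (h k / 2) (1 / (2 * Lh * D\<^sup>2) * (h k)\<^sup>2)" for k
      using basic[of k] N by simp
  qed
  have stop: "x n \<in> optimizers f X" if N: "N = enat n" for n
  proof -
    have n: "enat n \<le> N" using N by simp
    have "gap f X (x n) \<le> 0" using gap_le_step_gap[OF xX[OF n] chosen[OF n]] final[OF N] by simp
    then show ?thesis using gap_nonneg[OF xX[OF n]] gap_eq_0_iff[OF xX[OF n]] by simp
  qed
  have local_rates: "(\<exists>S. \<forall>k\<ge>S. enat k < N \<longrightarrow>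
               h (Suc k) \<le> h k - min (h k / 2) (C * h k powr (2 * (1 - \<theta>)))) \<and>
            (N = \<infinity> \<and> \<theta> < 1 / 2 \<longrightarrow> h \<in> O(\<lambda>k. real k powr (- 1 / (1 - 2 * \<theta>)))) \<and>
            (N = \<infinity> \<and> \<theta> = 1 / 2 \<longrightarrow> h \<in> O(\<lambda>k. (1 - min (1 / 2) C) ^ k))"
    if c: "c > 0" and R_H: "R_H > 0" "hoelder_error_bound M f X c \<theta> R_H"
      and \<sigma>: "\<sigma> > 0" and R_S: "R_S > 0" "length_normalized_scaling M f X \<sigma> R_S"
      and C: "C = \<sigma>\<^sup>2 / (2 * Lh * c\<^sup>2)" for c \<theta> R_H \<sigma> R_S C
  proof -
    have Cpos: "C > 0" using c \<sigma> Lh0 by (simp add: C)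
    have fast: "h (Suc k) \<le> h k - min (h k / 2) (C * h k powr (2 * (1 - \<theta>)))"
      if k: "enat k < N" and r: "dist_opt M f X (x k) \<le> min R_H R_S" for k
    proof -
      have k': "enat k \<le> N" using k by simp
      have no: "x k \<notin> optimizers f X" using hpos[OF k] gap_eq_0_iff[OF xX[OF k']] hdef[of k] by auto
      have "\<sigma> / c * h k powr (1 - \<theta>) \<le> g k / l k"
        using scaled_step_bound[OF xX[OF k'] chosen[OF k'] nonterm[OF k] no R_H(2) _ R_S(2) _ c \<sigma>] r
        by (simp add: hdef g_def l_def)
      \<comment> \<open>Squared and divided by \<open>2 * Lh\<close>, the bound becomes one for the
        second branch of the decrease; this produces \<open>C\<close>.\<close>
      then have "(\<sigma> / c * h k powr (1 - \<theta>))\<^sup>2 \<le> (g k / l k)\<^sup>2"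
        using c \<sigma> by (intro power_mono) auto
      moreover have "(h k powr (1 - \<theta>))\<^sup>2 = h k powr (2 * (1 - \<theta>))"
        using hpos[OF k] by (simp add: powr_numeral[symmetric] powr_powr mult.commute)
      ultimately have "\<sigma>\<^sup>2 / c\<^sup>2 * h k powr (2 * (1 - \<theta>)) \<le> (g k)\<^sup>2 / (l k)\<^sup>2"
        by (simp add: power_mult_distrib power_divide)
      then have "\<sigma>\<^sup>2 / c\<^sup>2 * h k powr (2 * (1 - \<theta>)) / (2 * Lh) \<le> (g k)\<^sup>2 / (l k)\<^sup>2 / (2 * Lh)"
        using Lh0 by (intro divide_right_mono) auto
      then have "C * h k powr (2 * (1 - \<theta>)) \<le> (g k)\<^sup>2 / (2 * Lh * (l k)\<^sup>2)"
        by (simp add: C mult_ac)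
      then have "min (h k / 2) (C * h k powr (2 * (1 - \<theta>))) \<le> min (g k / 2) ((g k)\<^sup>2 / (2 * Lh * (l k)\<^sup>2))"
        using hg[OF k] by (intro min.mono) auto
      then show ?thesis using step[OF k] by linarith
    qed
    have ex: "\<exists>S. \<forall>k\<ge>S. enat k < N \<longrightarrow>
        h (Suc k) \<le> h k - min (h k / 2) (C * h k powr (2 * (1 - \<theta>)))"
    proof (cases N)
      case (enat n)
      \<comment> \<open>No iteration from \<open>n\<close> on is nonterminal, so the claim is
        vacuous there.\<close>
      then show ?thesis by (intro exI[of _ n]) auto
    next
      case infinity
      obtain \<delta> where \<delta>: "\<delta> > 0" "\<And>z. z \<in> X \<Longrightarrow> gap f X z < \<delta> \<Longrightarrow> dist_opt M f X z \<le> min R_H R_S"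
        using dist_opt_small[of "min R_H R_S"] R_H(1) R_S(1) by auto
      obtain S where S: "\<And>k. k \<ge> S \<Longrightarrow> h k < \<delta>"
        using order_tendstoD(2)[OF lim[OF infinity] \<delta>(1)] unfolding eventually_sequentially by blast
      have "h (Suc k) \<le> h k - min (h k / 2) (C * h k powr (2 * (1 - \<theta>)))" if "k \<ge> S" for k
        using S[OF that] infinity xX[of k] by (intro fast \<delta>(2)) (auto simp: hdef)
      then show ?thesis by blast
    qed
    moreover have "(\<theta> < 1 / 2 \<longrightarrow> h \<in> O(\<lambda>k. real k powr (- 1 / (1 - 2 * \<theta>)))) \<and>
       (\<theta> = 1 / 2 \<longrightarrow> h \<in> O(\<lambda>k. (1 - min (1 / 2) C) ^ k))" if N: "N = \<infinity>"
    proof -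
      obtain S where S: "\<And>k. k \<ge> S \<Longrightarrow> h (Suc k) \<le> h k - min (h k / 2) (C * h k powr (2 * (1 - \<theta>)))"
        using ex N by auto
      have "h k > 0" for k using hpos N by simp
      from descent_rates[OF this lim[OF N] Cpos S] show ?thesis by blast
    qed
    ultimately show ?thesis by blast
  qed
  show ?thesis
  proof (intro conjI allI impI)
    show "(\<exists>n. N = enat n \<and> x n \<in> optimizers f X) \<or> (N = \<infinity> \<and> h \<longlonglongrightarrow> 0)"
      using stop lim by (cases N) auto
  qed (use xSX basic local_rates in blast)+
qed

end
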